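(* Let $J(q)=\frac12\|u_q-z_d\|_{\mathcal{H}}^2+\frac M2\|q\|_{\mathcal{Q}}^2$ for $q\in\mathcal{Q}$. With $C(q)=u_q-u_0$ ($u_0$ being $u_q$ for $q=0$), $\Pi(q,\eta)=(C(q),C(\eta))_{\mathcal{H}}+M(q,\eta)_{\mathcal{Q}}$ and $\mathcal{L}(q)=(C(q),z_d-u_0)_{\mathcal{H}}$, the following hold: (i) The adjoint state $p_q$ satisfies $(C(\eta),u_q-z_d)_{\mathcal{H}}=-(\eta,p_q)_{\mathcal{Q}}$ for all $q,\eta\in\mathcal{Q}$. (ii) $J$ is Gâteaux differentiable and, for all $q,\eta\in\mathcal{Q}$, $$\langle J'(q),\eta-q\rangle=(u_\eta-u_q,u_q-z_d)_{\mathcal{H}}+M(q,\eta-q)_{\mathcal{Q}}=\Pi(q,\eta-q)-\mathcal{L}(\eta-q).$$ (iii) $J'(q)=Mq-p_q$ for all $q\in\mathcal{Q}$. (iv) The optimality condition for the problem of finding $\overline{q}\in\mathcal{Q}$ with $J(\overline{q})=\min_{q\in\mathcal{Q}}J(q)$ is $M\overline{q}-p_{\overline{q}}=0$ in $\mathcal{Q}$.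
   Context: $\Omega\subset\mathbb{R}^n$ is a bounded domain with regular boundary $\Gamma=\Gamma_1\cup\Gamma_2$, $\Gamma_1,\Gamma_2$ disjoint with positive $(n-1)$-dimensional measure; $T>0$. Put $V=H^1(\Omega)$, $V_0=\{v\in V: v|_{\Gamma_1}=0\}$, $H=L^2(\Omega)$, $Q=L^2(\Gamma_2)$, $\mathcal{H}=L^2(0,T;H)$, $\mathcal{Q}=L^2(0,T;Q)$ with their usual inner products, and $a(u,v)=\int_\Omega\nabla u\cdot\nabla v\,dx$. Fixed data: $g\in\mathcal{H}$, $b\in H^{1/2}(\Gamma_1)$, $v_b\in V$ with $v_b=b$ on $\Gamma_1$, $z_d\in\mathcal{H}$, and a constant $M>0$; data and domain are sufficiently smooth for the variational problems below to have unique solutions. For $q\in\mathcal{Q}$, $u_q$ is the unique function with $u_q-v_b\in L^2(0,T;V_0)$, $\dot u_q\in L^2(0,T;V_0')$, $u_q(0)=v_b$ and, for a.e. $t\in(0,T)$, $\langle\dot u_q(t),v\rangle+a(u_q(t),v)=(g(t),v)_H-(q(t),v)_Q$ for all $v\in V_0$. The adjoint state $p_q$ is the unique function with $p_q\in L^2(0,T;V_0)$, $\dot p_q\in L^2(0,T;V_0')$, $p_q(T)=0$ and, for a.e. $t$, $-\langle\dot p_q(t),v\rangle+a(p_q(t),v)=(u_q(t)-z_d(t),v)_H$ for all $v\in V_0$. Here $\langle\cdot,\cdot\rangle$ in the equations is the duality between $V_0'$ and $V_0$. When $v\in V$ or $p_q$ appears in an expression in $Q$ or $\mathcal{Q}$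 it stands for its trace on $\Gamma_2$; $J'(q)$ is identified with an element of $\mathcal{Q}$ by the Riesz isomorphism. *)

theory Defs
  imports "HOL-Analysis.Analysis" "HOL-Library.Function_Algebras"
begin

text \<open>
  Elements of $L^2$, $H^1$ and of the Bochner spaces are represented by functions; equality in
  such a space is equality almost everywhere. Functions form a real vector space under the
  pointwise operations.
\<close>

instantiation "fun" :: (type, real_vector) real_vector
begin

definition scaleR_fun :: "real \<Rightarrow> ('a \<Rightarrow> 'b) \<Rightarrow> 'a \<Rightarrow> 'b"
  where "scaleR_fun c f = (\<lambda>x. c *\<^sub>R f x)"

instance
  by standard (auto simp: scaleR_fun_def fun_eq_iff scaleR_add_right scaleR_add_left)

end


subsection \<open>Bounded functionals and Gateaux derivatives on a space \<open>X\<close> with (semi)norm \<open>N\<close>\<close>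

definition dual_space :: "'b::real_vector set \<Rightarrow> ('b \<Rightarrow> real) \<Rightarrow> ('b \<Rightarrow> real) set" where
  "dual_space X N = {F. (\<forall>u\<in>X. \<forall>v\<in>X. F (u + v) = F u + F v) \<and>
                        (\<forall>c. \<forall>v\<in>X. F (c *\<^sub>R v) = c * F v) \<and>
                        (\<exists>K. \<forall>v\<in>X. \<bar>F v\<bar> \<le> K * N v)}"

definition dual_norm :: "'b::real_vector set \<Rightarrow> ('b \<Rightarrow> real) \<Rightarrow> ('b \<Rightarrow> real) \<Rightarrow> real" where
  "dual_norm X N F = Sup {\<bar>F v\<bar> | v. v \<in> X \<and> N v \<le> 1}"

definition gateaux_derivative ::
    "('b::real_vector \<Rightarrow> real) \<Rightarrow> 'b \<Rightarrow> 'b \<Rightarrow> real" where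
  "gateaux_derivative J q \<eta> = Lim (at 0) (\<lambda>s. (J (q + s *\<^sub>R \<eta>) - J q) / s)"

definition gateaux_differentiable ::
    "'b::real_vector set \<Rightarrow> ('b \<Rightarrow> real) \<Rightarrow> ('b \<Rightarrow> real) \<Rightarrow> 'b \<Rightarrow> bool" where
  "gateaux_differentiable X N J q \<longleftrightarrow>
     (\<forall>\<eta>\<in>X. ((\<lambda>s. (J (q + s *\<^sub>R \<eta>) - J q) / s) \<longlongrightarrow> gateaux_derivative J q \<eta>) (at 0)) \<and>
     gateaux_derivative J q \<in> dual_space X N"

definition riesz_representative ::
    "'b set \<Rightarrow> ('b \<Rightarrow> 'b \<Rightarrow> real) \<Rightarrow> ('b \<Rightarrow> real) \<Rightarrow> 'b \<Rightarrow> bool" where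
  "riesz_representative X ip F r \<longleftrightarrow> r \<in> X \<and> (\<forall>\<eta>\<in>X. F \<eta> = ip r \<eta>)"


subsection \<open>Smooth functions and domains\<close>

primrec Ck :: "nat \<Rightarrow> ('a::euclidean_space \<Rightarrow> real) \<Rightarrow> bool" where
  "Ck 0 f \<longleftrightarrow> continuous_on UNIV f"
| "Ck (Suc k) f \<longleftrightarrow> (\<forall>x. f differentiable (at x)) \<and>
     (\<forall>i\<in>Basis. Ck k (\<lambda>x. frechet_derivative f (at x) i))"

definition test_functions :: "'a::euclidean_space set \<Rightarrow> ('a \<Rightarrow> real) set" where
  "test_functions \<Omega> = {\<phi>. (\<forall>k. Ck k \<phi>) \<and> compact (closure {x. \<phi> x \<noteq> 0}) \<and>
                          closure {x. \<phi> x \<noteq> 0} \<subseteq> \<Omega>}"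

text \<open>
  Near each boundary point, the domain is the set of points below the graph of a Lipschitz
  function over the hyperplane orthogonal to a unit vector \<open>\<nu>\<close>; \<open>y - (y \<bullet> \<nu>) *\<^sub>R \<nu>\<close> is the
  projection of \<open>y\<close> to that hyperplane.
\<close>
definition lipschitz_boundary :: "'a::euclidean_space set \<Rightarrow> bool" where
  "lipschitz_boundary \<Omega> \<longleftrightarrow>
     (\<forall>x\<in>frontier \<Omega>. \<exists>\<nu> r L (\<psi> :: 'a \<Rightarrow> real). norm \<nu> = 1 \<and> r > 0 \<and> L-lipschitz_on UNIV \<psi> \<and>
        (\<forall>y\<in>ball x r. y \<in> \<Omega> \<longleftrightarrow> y \<bullet> \<nu> < \<psi> (y - (y \<bullet> \<nu>) *\<^sub>R \<nu>)))"


subsection \<open>Surface measure\<close>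

text \<open>
  Hausdorff measure, normalised so that it agrees with surface area. Boundedness of the covering
  sets is required explicitly because the library assigns an unspecified diameter to unbounded
  sets; empty covering sets are given weight \<open>0\<close> because \<open>0 ^ 0 = 1\<close> in dimension \<open>0\<close>.
\<close>
definition hausdorff_delta :: "nat \<Rightarrow> real \<Rightarrow> 'a::metric_space set \<Rightarrow> ennreal" where
  "hausdorff_delta s \<delta> A =
     Inf {(\<Sum>i. if C i = {} then 0
                else ennreal (unit_ball_vol (real s) * (diameter (C i) / 2) ^ s)) |
          C :: nat \<Rightarrow> 'a set.
          A \<subseteq> (\<Union>i. C i) \<and> (\<forall>i. bounded (C i) \<and> diameter (C i) \<le> \<delta>)}"

definition hausdorff :: "nat \<Rightarrow> 'a::metric_space set \<Rightarrow> ennreal" where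
  "hausdorff s A = (SUP \<delta>\<in>{0<..}. hausdorff_delta s \<delta> A)"

text \<open>
  The Hausdorff measure of codimension one, which is countably additive on the Borel sets.
\<close>
definition surface_measure :: "'a::euclidean_space measure" where
  "surface_measure = measure_of UNIV (sets borel) (hausdorff (DIM('a) - 1))"

abbreviation surface_on :: "'a::euclidean_space set \<Rightarrow> 'a measure" where
  "surface_on \<Gamma> \<equiv> restrict_space surface_measure \<Gamma>"


subsection \<open>Lebesgue and Sobolev spaces\<close>

definition L2 :: "'a measure \<Rightarrow> ('a \<Rightarrow> real) set" where
  "L2 M = {f. f \<in> borel_measurable M \<and> integrable M (\<lambda>x. (f x)\<^sup>2)}"

definition L2_inner :: "'a measure \<Rightarrow> ('a \<Rightarrow> real) \<Rightarrow> ('a \<Rightarrow> real) \<Rightarrow> real" where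
  "L2_inner M f g = (\<integral>x. f x * g x \<partial>M)"

definition L2_norm :: "'a measure \<Rightarrow> ('a \<Rightarrow> real) \<Rightarrow> real" where
  "L2_norm M f = sqrt (L2_inner M f f)"

definition is_weak_gradient ::
    "'a::euclidean_space set \<Rightarrow> ('a \<Rightarrow> real) \<Rightarrow> ('a \<Rightarrow> 'a) \<Rightarrow> bool" where
  "is_weak_gradient \<Omega> f G \<longleftrightarrow>
     (\<forall>i\<in>Basis. (\<lambda>x. G x \<bullet> i) \<in> L2 (lebesgue_on \<Omega>)) \<and>
     (\<forall>i\<in>Basis. \<forall>\<phi>\<in>test_functions \<Omega>.
        (\<integral>x. f x * frechet_derivative \<phi> (at x) i \<partial>lebesgue_on \<Omega>) =
        - (\<integral>x. (G x \<bullet> i) * \<phi> x \<partial>lebesgue_on \<Omega>))"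

definition H1 :: "'a::euclidean_space set \<Rightarrow> ('a \<Rightarrow> real) set" where
  "H1 \<Omega> = {f \<in> L2 (lebesgue_on \<Omega>). \<exists>G. is_weak_gradient \<Omega> f G}"

text \<open>The weak gradient is determined up to a null set.\<close>
definition weak_gradient :: "'a::euclidean_space set \<Rightarrow> ('a \<Rightarrow> real) \<Rightarrow> 'a \<Rightarrow> 'a" where
  "weak_gradient \<Omega> f = (SOME G. is_weak_gradient \<Omega> f G)"

definition dirichlet_form ::
    "'a::euclidean_space set \<Rightarrow> ('a \<Rightarrow> real) \<Rightarrow> ('a \<Rightarrow> real) \<Rightarrow> real" where
  "dirichlet_form \<Omega> u v = (\<integral>x. weak_gradient \<Omega> u x \<bullet> weak_gradient \<Omega> v x \<partial>lebesgue_on \<Omega>)"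

definition H1_norm :: "'a::euclidean_space set \<Rightarrow> ('a \<Rightarrow> real) \<Rightarrow> real" where
  "H1_norm \<Omega> v = sqrt (L2_inner (lebesgue_on \<Omega>) v v + dirichlet_form \<Omega> v v)"

text \<open>
  The trace operator is the bounded linear map from $H^1(\Omega)$ to $L^2(\partial\Omega)$ which
  restricts functions that are continuous up to the boundary. On a bounded domain with Lipschitz
  boundary it exists, and it is unique up to equality almost everywhere.
\<close>
definition trace_operator ::
    "'a::euclidean_space set \<Rightarrow> (('a \<Rightarrow> real) \<Rightarrow> ('a \<Rightarrow> real)) \<Rightarrow> bool" where
  "trace_operator \<Omega> tr \<longleftrightarrow>
     (\<forall>v\<in>H1 \<Omega>. tr v \<in> L2 (surface_on (frontier \<Omega>))) \<and>
     (\<forall>v\<in>H1 \<Omega>. \<forall>w\<in>H1 \<Omega>. AE x in surface_on (frontier \<Omega>). tr (v + w) x = tr v x + tr w x) \<and>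
     (\<forall>c. \<forall>v\<in>H1 \<Omega>. AE x in surface_on (frontier \<Omega>). tr (c *\<^sub>R v) x = c * tr v x) \<and>
     (\<exists>K. \<forall>v\<in>H1 \<Omega>. L2_norm (surface_on (frontier \<Omega>)) (tr v) \<le> K * H1_norm \<Omega> v) \<and>
     (\<forall>v\<in>H1 \<Omega>. continuous_on (closure \<Omega>) v \<longrightarrow>
        (AE x in surface_on (frontier \<Omega>). tr v x = v x))"

definition V0 ::
    "'a::euclidean_space set \<Rightarrow> (('a \<Rightarrow> real) \<Rightarrow> ('a \<Rightarrow> real)) \<Rightarrow> 'a set \<Rightarrow> ('a \<Rightarrow> real) set" where
  "V0 \<Omega> tr \<Gamma>1 = {v \<in> H1 \<Omega>. AE x in surface_on \<Gamma>1. tr v x = 0}"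

text \<open>$H^{1/2}(\Gamma_1)$ as the space of restrictions to $\Gamma_1$ of traces.\<close>
definition H_half ::
    "'a::euclidean_space set \<Rightarrow> (('a \<Rightarrow> real) \<Rightarrow> ('a \<Rightarrow> real)) \<Rightarrow> 'a set \<Rightarrow> ('a \<Rightarrow> real) set" where
  "H_half \<Omega> tr \<Gamma>1 = {b \<in> L2 (surface_on \<Gamma>1). \<exists>v\<in>H1 \<Omega>. AE x in surface_on \<Gamma>1. tr v x = b x}"


subsection \<open>Bochner spaces on the time interval\<close>

abbreviation time :: "real \<Rightarrow> real measure" where
  "time T \<equiv> lebesgue_on {0<..<T}"

definition strongly_measurable ::
    "'t measure \<Rightarrow> 'b::real_vector set \<Rightarrow> ('b \<Rightarrow> real) \<Rightarrow> ('t \<Rightarrow> 'b) \<Rightarrow> bool" where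
  "strongly_measurable M X N u \<longleftrightarrow>
     (\<exists>s. (\<forall>k::nat. simple_function M (s k) \<and> s k ` space M \<subseteq> X) \<and>
          (AE t in M. (\<lambda>k. N (s k t - u t)) \<longlonglongrightarrow> 0))"

definition L2_time :: "real \<Rightarrow> 'b::real_vector set \<Rightarrow> ('b \<Rightarrow> real) \<Rightarrow> (real \<Rightarrow> 'b) set" where
  "L2_time T X N = {u. (AE t in time T. u t \<in> X) \<and> strongly_measurable (time T) X N u \<and>
                       integrable (time T) (\<lambda>t. (N (u t))\<^sup>2)}"

text \<open>The spaces $L^2(0,T;L^2(M))$: $\mathcal{H}$ and $\mathcal{Q}$ are the instances where
  \<open>M\<close> is \<open>lebesgue_on \<Omega>\<close> and \<open>surface_on \<Gamma>2\<close>.\<close>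

definition L2L2 :: "real \<Rightarrow> 'a measure \<Rightarrow> (real \<Rightarrow> 'a \<Rightarrow> real) set" where
  "L2L2 T M = L2_time T (L2 M) (L2_norm M)"

definition L2L2_inner ::
    "real \<Rightarrow> 'a measure \<Rightarrow> (real \<Rightarrow> 'a \<Rightarrow> real) \<Rightarrow> (real \<Rightarrow> 'a \<Rightarrow> real) \<Rightarrow> real" where
  "L2L2_inner T M u v = (\<integral>t. L2_inner M (u t) (v t) \<partial>time T)"

definition L2L2_norm :: "real \<Rightarrow> 'a measure \<Rightarrow> (real \<Rightarrow> 'a \<Rightarrow> real) \<Rightarrow> real" where
  "L2L2_norm T M u = sqrt (L2L2_inner T M u u)"

definition L2L2_eq ::
    "real \<Rightarrow> 'a measure \<Rightarrow> (real \<Rightarrow> 'a \<Rightarrow> real) \<Rightarrow> (real \<Rightarrow> 'a \<Rightarrow> real) \<Rightarrow> bool" where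
  "L2L2_eq T M u v \<longleftrightarrow> (AE t in time T. AE x in M. u t x = v t x)"

text \<open>
  \<open>w\<close> is the distributional time derivative of \<open>u\<close> with values in the dual of \<open>X\<close>, where
  $L^2(\Omega)$ is embedded in the dual by the inner product. The identity
  $\int \phi' u = -\int \phi w$ in the dual space is tested against the elements of \<open>X\<close>.
\<close>
definition weak_time_derivative ::
    "real \<Rightarrow> 'a::euclidean_space set \<Rightarrow> ('a \<Rightarrow> real) set \<Rightarrow>
     (real \<Rightarrow> 'a \<Rightarrow> real) \<Rightarrow> (real \<Rightarrow> ('a \<Rightarrow> real) \<Rightarrow> real) \<Rightarrow> bool" where
  "weak_time_derivative T \<Omega> X u w \<longleftrightarrow>
     (\<forall>\<phi>\<in>test_functions {0<..<T}. \<forall>v\<in>X.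
        (\<integral>t. deriv \<phi> t * L2_inner (lebesgue_on \<Omega>) (u t) v \<partial>time T) =
        - (\<integral>t. \<phi> t * w t v \<partial>time T))"

text \<open>\<open>u(s) = v\<close> refers to the representative of \<open>u\<close> that is continuous with values in
  $L^2(\Omega)$.\<close>
definition value_at ::
    "real \<Rightarrow> 'a::euclidean_space set \<Rightarrow> (real \<Rightarrow> 'a \<Rightarrow> real) \<Rightarrow> real \<Rightarrow> ('a \<Rightarrow> real) \<Rightarrow> bool" where
  "value_at T \<Omega> u s v \<longleftrightarrow>
     (\<exists>uc. (\<forall>t\<in>{0..T}. uc t \<in> L2 (lebesgue_on \<Omega>)) \<and>
           (\<forall>t\<in>{0..T}. ((\<lambda>r. L2_norm (lebesgue_on \<Omega>) (uc r - uc t)) \<longlongrightarrow> 0) (at t within {0..T})) \<and>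
           L2L2_eq T (lebesgue_on \<Omega>) uc u \<and>
           (AE x in lebesgue_on \<Omega>. uc s x = v x))"


subsection \<open>State and adjoint problems\<close>

definition is_state ::
    "real \<Rightarrow> 'a::euclidean_space set \<Rightarrow> (('a \<Rightarrow> real) \<Rightarrow> ('a \<Rightarrow> real)) \<Rightarrow> 'a set \<Rightarrow> 'a set \<Rightarrow>
     (real \<Rightarrow> 'a \<Rightarrow> real) \<Rightarrow> ('a \<Rightarrow> real) \<Rightarrow> (real \<Rightarrow> 'a \<Rightarrow> real) \<Rightarrow> (real \<Rightarrow> 'a \<Rightarrow> real) \<Rightarrow> bool" where
  "is_state T \<Omega> tr \<Gamma>1 \<Gamma>2 g vb q u \<longleftrightarrow>
     (\<lambda>t. u t - vb) \<in> L2_time T (V0 \<Omega> tr \<Gamma>1) (H1_norm \<Omega>) \<and>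
     (\<exists>w \<in> L2_time T (dual_space (V0 \<Omega> tr \<Gamma>1) (H1_norm \<Omega>)) (dual_norm (V0 \<Omega> tr \<Gamma>1) (H1_norm \<Omega>)).
        weak_time_derivative T \<Omega> (V0 \<Omega> tr \<Gamma>1) u w \<and>
        (AE t in time T. \<forall>v\<in>V0 \<Omega> tr \<Gamma>1.
           w t v + dirichlet_form \<Omega> (u t) v =
           L2_inner (lebesgue_on \<Omega>) (g t) v - L2_inner (surface_on \<Gamma>2) (q t) (tr v))) \<and>
     value_at T \<Omega> u 0 vb"

text \<open>In the adjoint problem, \<open>f\<close> stands for the right-hand side $u_q - z_d$.\<close>
definition is_adjoint_state ::
    "real \<Rightarrow> 'a::euclidean_space set \<Rightarrow> (('a \<Rightarrow> real) \<Rightarrow> ('a \<Rightarrow> real)) \<Rightarrow> 'a set \<Rightarrow>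
     (real \<Rightarrow> 'a \<Rightarrow> real) \<Rightarrow> (real \<Rightarrow> 'a \<Rightarrow> real) \<Rightarrow> bool" where
  "is_adjoint_state T \<Omega> tr \<Gamma>1 f p \<longleftrightarrow>
     p \<in> L2_time T (V0 \<Omega> tr \<Gamma>1) (H1_norm \<Omega>) \<and>
     (\<exists>w \<in> L2_time T (dual_space (V0 \<Omega> tr \<Gamma>1) (H1_norm \<Omega>)) (dual_norm (V0 \<Omega> tr \<Gamma>1) (H1_norm \<Omega>)).
        weak_time_derivative T \<Omega> (V0 \<Omega> tr \<Gamma>1) p w \<and>
        (AE t in time T. \<forall>v\<in>V0 \<Omega> tr \<Gamma>1.
           - w t v + dirichlet_form \<Omega> (p t) v = L2_inner (lebesgue_on \<Omega>) (f t) v)) \<and>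
     value_at T \<Omega> p T 0"


subsection \<open>The control problem\<close>

text \<open>In the following, \<open>u\<close> is the map $q \mapsto u_q$.\<close>

definition cost ::
    "real \<Rightarrow> 'a::euclidean_space set \<Rightarrow> 'a set \<Rightarrow> real \<Rightarrow> (real \<Rightarrow> 'a \<Rightarrow> real) \<Rightarrow>
     ((real \<Rightarrow> 'a \<Rightarrow> real) \<Rightarrow> (real \<Rightarrow> 'a \<Rightarrow> real)) \<Rightarrow> (real \<Rightarrow> 'a \<Rightarrow> real) \<Rightarrow> real" where
  "cost T \<Omega> \<Gamma>2 M zd u q =
     1/2 * (L2L2_norm T (lebesgue_on \<Omega>) (u q - zd))\<^sup>2 + M/2 * (L2L2_norm T (surface_on \<Gamma>2) q)\<^sup>2"

definition control_map ::
    "((real \<Rightarrow> 'a \<Rightarrow> real) \<Rightarrow> (real \<Rightarrow> 'a \<Rightarrow> real)) \<Rightarrow> (real \<Rightarrow> 'a \<Rightarrow> real) \<Rightarrow> (real \<Rightarrow> 'a \<Rightarrow> real)" where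
  "control_map u q = u q - u 0"

definition Pi_form ::
    "real \<Rightarrow> 'a::euclidean_space set \<Rightarrow> 'a set \<Rightarrow> real \<Rightarrow>
     ((real \<Rightarrow> 'a \<Rightarrow> real) \<Rightarrow> (real \<Rightarrow> 'a \<Rightarrow> real)) \<Rightarrow>
     (real \<Rightarrow> 'a \<Rightarrow> real) \<Rightarrow> (real \<Rightarrow> 'a \<Rightarrow> real) \<Rightarrow> real" where
  "Pi_form T \<Omega> \<Gamma>2 M u q \<eta> =
     L2L2_inner T (lebesgue_on \<Omega>) (control_map u q) (control_map u \<eta>) +
     M * L2L2_inner T (surface_on \<Gamma>2) q \<eta>"

definition L_form ::
    "real \<Rightarrow> 'a::euclidean_space set \<Rightarrow> (real \<Rightarrow> 'a \<Rightarrow> real) \<Rightarrow>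
     ((real \<Rightarrow> 'a \<Rightarrow> real) \<Rightarrow> (real \<Rightarrow> 'a \<Rightarrow> real)) \<Rightarrow> (real \<Rightarrow> 'a \<Rightarrow> real) \<Rightarrow> real" where
  "L_form T \<Omega> zd u q = L2L2_inner T (lebesgue_on \<Omega>) (control_map u q) (zd - u 0)"

end

theory Submission
  imports Defs
begin

text \<open>
  By uniqueness of the state, $q \mapsto u_q$ is affine, so $J$ is a quadratic polynomial along every
  line and (ii)--(iv) follow from (i) by algebra. For (i), test the equation of $C(\eta)$ with the
  adjoint state $p_q$ and the adjoint equation with $C(\eta)$: the Dirichlet forms cancel by symmetry,
  and what remains is integration by parts in time for two functions of $L^2(0,T;V_0)$ with
  derivatives in $L^2(0,T;V_0')$. This is proved with difference quotients: the scalar functions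
  $(u(t),v)$ are primitives of $\langle \dot u(t),v\rangle$, and the difference quotients converge weakly,
  with a bound that is uniform in the step, when they are paired with simple functions.
  Uniqueness of weak gradients, which makes the Dirichlet form bilinear, needs smooth bump functions.
\<close>

subsection \<open>Seminormed spaces and bounded pairings\<close>

text \<open>Elements of the function spaces are plain functions, and equality almost everywhere is
  not equality. All spaces are therefore subsets of a function type with a seminorm, and no
  vector-valued integral is formed: functions of time with values in such a space enter only through
  scalar pairings, namely inner products and evaluations of functionals. The locales below treat
  measurability and integrability of both kinds of pairing at once. For the same reason weak
  gradients, traces and the solution map are linear only up to null sets, and their linearity is
  exploited after pairing. No pointwise majorant of the difference quotients that is uniform in the
  step is used. Its substitute is a uniform bound on integrals: for nonnegative f, the quotients of
  the primitive of f have integral at most that of f. Combined with a weighted Young inequality this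
  makes error terms small for all steps simultaneously. The boundary terms of the integration by
  parts vanish because C(\<eta>) starts at 0 and the adjoint state ends at 0.\<close>

locale vector_subspace =
  fixes X :: "'b::real_vector set"
  assumes zero_in: "0 \<in> X"
    and add_in: "u \<in> X \<Longrightarrow> v \<in> X \<Longrightarrow> u + v \<in> X"
    and scaleR_in: "v \<in> X \<Longrightarrow> c *\<^sub>R v \<in> X"
begin

lemma uminus_in: "v \<in> X \<Longrightarrow> - v \<in> X"
  using scaleR_in[of v "-1"] by simp

lemma diff_in: "u \<in> X \<Longrightarrow> v \<in> X \<Longrightarrow> u - v \<in> X"
  using add_in[of u "- v"] uminus_in by simp

end

text \<open>Only a seminorm: functions that differ on a null set have distance 0 without being
  equal. Nonnegativity is derived below from 0 = N (v - v), which is at most 2 N v.\<close>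

locale seminormed_space = vector_subspace X for X :: "'b::real_vector set" +
  fixes N :: "'b \<Rightarrow> real"
  assumes triangle: "u \<in> X \<Longrightarrow> v \<in> X \<Longrightarrow> N (u + v) \<le> N u + N v"
    and homogeneous: "v \<in> X \<Longrightarrow> N (c *\<^sub>R v) = \<bar>c\<bar> * N v"
begin

lemma seminorm_zero [simp]: "N 0 = 0"
  using homogeneous[OF zero_in, of 0] by simp

lemma seminorm_uminus: "v \<in> X \<Longrightarrow> N (- v) = N v"
  using homogeneous[of v "-1"] by simp

lemma seminorm_nonneg: "v \<in> X \<Longrightarrow> 0 \<le> N v"
  using triangle[of v "- v"] uminus_in[of v] seminorm_uminus[of v] by simp

lemma seminorm_diff_commute: "u \<in> X \<Longrightarrow> v \<in> X \<Longrightarrow> N (u - v) = N (v - u)"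
  using seminorm_uminus[of "u - v"] diff_in by simp

lemma triangle_diff: "u \<in> X \<Longrightarrow> v \<in> X \<Longrightarrow> N (u - v) \<le> N u + N v"
  using triangle[of u "- v"] uminus_in seminorm_uminus by simp

lemma reverse_triangle: "u \<in> X \<Longrightarrow> v \<in> X \<Longrightarrow> \<bar>N u - N v\<bar> \<le> N (u - v)"
  using triangle[of "u - v" v] triangle[of "v - u" u] diff_in seminorm_diff_commute[of u v]
  by (simp add: abs_le_iff)

end

text \<open>The bound with constant 1 fits both kinds of instance: a semi-inner product with its own
  seminorm, by Cauchy-Schwarz, and the evaluation of a functional, where the dual norm absorbs the
  constant.\<close>

locale seminormed_pairing =
  X: seminormed_space X N + Y: seminormed_space Y N'
  for X :: "'b::real_vector set" and N :: "'b \<Rightarrow> real"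
    and Y :: "'c::real_vector set" and N' :: "'c \<Rightarrow> real" +
  fixes B :: "'b \<Rightarrow> 'c \<Rightarrow> real"
  assumes add_left: "u \<in> X \<Longrightarrow> u' \<in> X \<Longrightarrow> v \<in> Y \<Longrightarrow> B (u + u') v = B u v + B u' v"
    and add_right: "u \<in> X \<Longrightarrow> v \<in> Y \<Longrightarrow> v' \<in> Y \<Longrightarrow> B u (v + v') = B u v + B u v'"
    and scaleR_left: "u \<in> X \<Longrightarrow> v \<in> Y \<Longrightarrow> B (c *\<^sub>R u) v = c * B u v"
    and scaleR_right: "u \<in> X \<Longrightarrow> v \<in> Y \<Longrightarrow> B u (c *\<^sub>R v) = c * B u v"
    and bounded: "u \<in> X \<Longrightarrow> v \<in> Y \<Longrightarrow> \<bar>B u v\<bar> \<le> N u * N' v"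
begin

lemma diff_left: "u \<in> X \<Longrightarrow> u' \<in> X \<Longrightarrow> v \<in> Y \<Longrightarrow> B (u - u') v = B u v - B u' v"
  using add_left[of u "- u'" v] scaleR_left[of u' v "-1"] X.uminus_in by simp

lemma diff_right: "u \<in> X \<Longrightarrow> v \<in> Y \<Longrightarrow> v' \<in> Y \<Longrightarrow> B u (v - v') = B u v - B u v'"
  using add_right[of u v "- v'"] scaleR_right[of u v' "-1"] Y.uminus_in by simp

end

locale semi_inner_space = vector_subspace X for X :: "'b::real_vector set" +
  fixes ip :: "'b \<Rightarrow> 'b \<Rightarrow> real"
  assumes sym: "u \<in> X \<Longrightarrow> v \<in> X \<Longrightarrow> ip u v = ip v u"
    and ip_add_left: "u \<in> X \<Longrightarrow> u' \<in> X \<Longrightarrow> v \<in> X \<Longrightarrow> ip (u + u') v = ip u v + ip u' v"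
    and ip_scaleR_left: "u \<in> X \<Longrightarrow> v \<in> X \<Longrightarrow> ip (c *\<^sub>R u) v = c * ip u v"
    and nonneg: "v \<in> X \<Longrightarrow> 0 \<le> ip v v"
begin

lemma ip_add_right: "u \<in> X \<Longrightarrow> v \<in> X \<Longrightarrow> v' \<in> X \<Longrightarrow> ip u (v + v') = ip u v + ip u v'"
  using ip_add_left[of v v' u] add_in sym by simp

lemma ip_scaleR_right: "u \<in> X \<Longrightarrow> v \<in> X \<Longrightarrow> ip u (c *\<^sub>R v) = c * ip u v"
  using ip_scaleR_left[of v u c] scaleR_in sym by simp

lemma ip_expand:
  assumes "u \<in> X" "v \<in> X"
  shows "ip (u + c *\<^sub>R v) (u + c *\<^sub>R v) = ip u u + 2 * c * ip u v + c\<^sup>2 * ip v v"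
  using assms
  by (simp add: ip_add_left ip_add_right ip_scaleR_left ip_scaleR_right add_in scaleR_in
      sym[of v u] algebra_simps power2_eq_square)

lemma cauchy_schwarz:
  assumes u: "u \<in> X" and v: "v \<in> X"
  shows "\<bar>ip u v\<bar> \<le> sqrt (ip u u) * sqrt (ip v v)"
proof -
  have quad: "0 \<le> ip u u + 2 * c * ip u v + c\<^sup>2 * ip v v" for c
    using nonneg[of "u + c *\<^sub>R v"] ip_expand[OF u v, of c] u v add_in scaleR_in by simp
  have "(ip u v)\<^sup>2 \<le> ip u u * ip v v"
  proof (cases "ip v v = 0")
    case True
    have "ip u v = 0"
    proof (rule ccontr)
      assume "ip u v \<noteq> 0"
      \<comment> \<open>The form may be degenerate. In this case the polynomial in
        \<open>quad\<close> is affine in \<open>c\<close>, and the chosen \<open>c\<close> gives it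
        the value -1.\<close>
      then show False
        using quad[of "- (ip u u + 1) / (2 * ip u v)"] True by (simp add: field_simps)
    qed
    then show ?thesis using True by simp
  next
    case False
    then have pos: "ip v v > 0" using nonneg[OF v] by simp
    \<comment> \<open>The quadratic is evaluated at its minimum point.\<close>
    have "0 \<le> ip u u - (ip u v)\<^sup>2 / ip v v"
      using quad[of "- ip u v / ip v v"] pos by (simp add: field_simps power2_eq_square)
    then show ?thesis using pos by (simp add: field_simps)
  qed
  then have "sqrt ((ip u v)\<^sup>2) \<le> sqrt (ip u u * ip v v)" by (rule real_sqrt_le_mono)
  then show ?thesis by (simp add: real_sqrt_mult)
qed

sublocale seminormed_space X "\<lambda>v. sqrt (ip v v)"
proof
  fix u v :: 'b and c :: real
  assume v: "v \<in> X"
  show "sqrt (ip (c *\<^sub>R v) (c *\<^sub>R v)) = \<bar>c\<bar> * sqrt (ip v v)"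
    using v scaleR_in[OF v] by (simp add: ip_scaleR_left ip_scaleR_right real_sqrt_mult)
  assume u: "u \<in> X"
  have "ip (u + v) (u + v) = ip u u + 2 * ip u v + ip v v"
    using ip_expand[OF u v, of 1] by simp
  also have "\<dots> \<le> (sqrt (ip u u) + sqrt (ip v v))\<^sup>2"
    using cauchy_schwarz[OF u v] nonneg[OF u] nonneg[OF v]
    by (simp add: power2_eq_square algebra_simps abs_le_iff)
  finally show "sqrt (ip (u + v) (u + v)) \<le> sqrt (ip u u) + sqrt (ip v v)"
    using nonneg[OF u] nonneg[OF v] by (intro real_le_lsqrt) auto
qed

lemma seminormed: "seminormed_space X (\<lambda>v. sqrt (ip v v))"
  by (rule seminormed_space_axioms)

sublocale pairing: seminormed_pairing X "\<lambda>v. sqrt (ip v v)" X "\<lambda>v. sqrt (ip v v)" ip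
  by standard (auto intro: ip_add_left ip_add_right ip_scaleR_left ip_scaleR_right cauchy_schwarz)

end


subsection \<open>Bochner measurability\<close>

text \<open>Lebesgue measure is complete, so a change on a null set preserves measurability.
  Extension by zero carries this fact over to the restricted measure.\<close>

lemma borel_measurable_lebesgue_on_AE:
  fixes f g :: "real \<Rightarrow> real"
  assumes S: "S \<in> sets lebesgue" and g: "g \<in> borel_measurable (lebesgue_on S)"
    and eq: "AE t in lebesgue_on S. f t = g t"
  shows "f \<in> borel_measurable (lebesgue_on S)"
proof -
  have "(\<lambda>x. if x \<in> S then g x else 0) \<in> borel_measurable lebesgue"
    using g S by (simp add: borel_measurable_if)
  moreover have "AE x in lebesgue. (if x \<in> S then g x else 0) = (if x \<in> S then f x else 0)"
    using eq S by (subst (asm) AE_restrict_space_iff) (auto elim!: eventually_mono)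
  ultimately have "(\<lambda>x. if x \<in> S then f x else 0) \<in> borel_measurable lebesgue"
    by (rule borel_measurable_AE)
  then show ?thesis using S by (simp add: borel_measurable_if)
qed


lemma borel_measurable_lebesgue_on_LIMSEQ_AE:
  fixes f :: "real \<Rightarrow> real"
  assumes S: "S \<in> sets lebesgue" and s: "\<And>k. s k \<in> borel_measurable (lebesgue_on S)"
    and lim: "AE t in lebesgue_on S. (\<lambda>k. s k t) \<longlonglongrightarrow> f t"
  shows "f \<in> borel_measurable (lebesgue_on S)"
proof (rule borel_measurable_lebesgue_on_AE[OF S])
  show "(\<lambda>t. lim (\<lambda>k. s k t)) \<in> borel_measurable (lebesgue_on S)"
    by (intro borel_measurable_lim_metric s)
  show "AE t in lebesgue_on S. f t = lim (\<lambda>k. s k t)"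
    using lim by (auto elim!: eventually_mono simp: limI)
qed

text \<open>The space of values carries no sigma-algebra. As \<open>s\<close> takes finitely many
  values, the composite is pieced together from the functions \<open>g v\<close> on the level sets
  of \<open>s\<close>, so measurability of each single \<open>g v\<close> suffices.\<close>

lemma borel_measurable_simple_function_compose:
  assumes s: "simple_function M s"
    and g: "\<And>v. v \<in> s ` space M \<Longrightarrow> g v \<in> borel_measurable M"
  shows "(\<lambda>t. g (s t) t) \<in> borel_measurable M"
proof (rule measurable_compose_countable'[where I = "s ` space M" and g = s])
  show "s \<in> M \<rightarrow>\<^sub>M count_space (s ` space M)"
    using s by (simp add: simple_function_def measurable_count_space_eq2)
  show "countable (s ` space M)"
    using s by (simp add: simple_function_def countable_finite)
qed (rule g)

context seminormed_space
begin

lemma strongly_measurable_seminorm: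
  fixes S :: "real set"
  assumes "S \<in> sets lebesgue" "strongly_measurable (lebesgue_on S) X N u"
    "AE t in lebesgue_on S. u t \<in> X"
  shows "(\<lambda>t. N (u t)) \<in> borel_measurable (lebesgue_on S)"
proof -
  obtain s where s: "\<And>k. simple_function (lebesgue_on S) (s k)" "\<And>k. s k ` S \<subseteq> X"
    and lim: "AE t in lebesgue_on S. (\<lambda>k. N (s k t - u t)) \<longlonglongrightarrow> 0"
    using assms(2) by (auto simp: strongly_measurable_def)
  have "AE t in lebesgue_on S. t \<in> S" by (rule AE_I2) simp
  then have "AE t in lebesgue_on S. (\<lambda>k. N (s k t)) \<longlonglongrightarrow> N (u t)"
    using assms(3) lim
  proof eventually_elim
    case (elim t)
    have "\<bar>N (s k t) - N (u t)\<bar> \<le> N (s k t - u t)" for k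
      using reverse_triangle s(2) elim by blast
    then show ?case
      using elim(3) by (intro LIM_zero_cancel[where l = "N (u t)"] Lim_null_comparison[OF _ elim(3)]) auto
  qed
  then show ?thesis
    by (rule borel_measurable_lebesgue_on_LIMSEQ_AE[OF assms(1), rotated])
      (rule borel_measurable_simple_function_compose[where g = "\<lambda>v t. N v", OF s(1)], simp)
qed

lemma L2_time_seminorm:
  assumes "u \<in> L2_time T X N"
  shows "(\<lambda>t. N (u t)) \<in> borel_measurable (time T)"
  using assms by (auto simp: L2_time_def intro!: strongly_measurable_seminorm)

lemma L2_time_simple_function:
  assumes s: "simple_function (time T) s" "s ` {0<..<T} \<subseteq> X"
  shows "s \<in> L2_time T X N"
proof -
  have "strongly_measurable (time T) X N s"
    unfolding strongly_measurable_def using s by (intro exI[of _ "\<lambda>k. s"]) auto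
  moreover have ae: "AE t in time T. s t \<in> X" using s(2) by (intro AE_I2) auto
  moreover have "integrable (time T) (\<lambda>t. (N (s t))\<^sup>2)"
  proof (rule integrableI_bounded_set[where A = "{0<..<T}" and B = "Max ((\<lambda>v. (N v)\<^sup>2) ` s ` {0<..<T})"])
    show "(\<lambda>t. (N (s t))\<^sup>2) \<in> borel_measurable (time T)"
      by (rule borel_measurable_simple_function_compose[where g = "\<lambda>v t. (N v)\<^sup>2", OF s(1)]) simp
    show "AE t in time T. t \<in> {0<..<T} \<longrightarrow>
        norm ((N (s t))\<^sup>2) \<le> Max ((\<lambda>v. (N v)\<^sup>2) ` s ` {0<..<T})"
      using s(1) by (intro AE_I2) (auto simp: simple_function_def intro!: Max_ge)
  qed (use emeasure_bounded_finite[of "{0<..<T}"] in \<open>auto simp: emeasure_restrict_space intro!: AE_I2\<close>)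
  ultimately show ?thesis by (simp add: L2_time_def)
qed

lemma L2_time_const: "v \<in> X \<Longrightarrow> (\<lambda>t. v) \<in> L2_time T X N"
  by (rule L2_time_simple_function) auto

text \<open>A Lipschitz bound and a growth bound take the place of linearity of \<open>f\<close>,
  because the trace is linear only up to null sets. The applications are scaling, the embedding into
  L2 with constant 1, and the trace.\<close>

lemma L2_time_compose:
  assumes Y: "seminormed_space Y N'" and u: "u \<in> L2_time T X N"
    and im: "\<And>v. v \<in> X \<Longrightarrow> f v \<in> Y"
    and lip: "\<And>v w. v \<in> X \<Longrightarrow> w \<in> X \<Longrightarrow> N' (f v - f w) \<le> K * N (v - w)"
    and bnd: "\<And>v. v \<in> X \<Longrightarrow> N' (f v) \<le> K * N v"
  shows "(\<lambda>t. f (u t)) \<in> L2_time T Y N'"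
proof -
  interpret Y: seminormed_space Y N' by (rule Y)
  obtain s where s: "\<And>k. simple_function (time T) (s k)" "\<And>k. s k ` {0<..<T} \<subseteq> X"
    and lim: "AE t in time T. (\<lambda>k. N (s k t - u t)) \<longlonglongrightarrow> 0"
    and X: "AE t in time T. u t \<in> X" and int: "integrable (time T) (\<lambda>t. (N (u t))\<^sup>2)"
    using u by (auto simp: L2_time_def strongly_measurable_def)
  have sp: "AE t in time T. t \<in> {0<..<T}" by (rule AE_I2) simp
  have "AE t in time T. (\<lambda>k. N' (f (s k t) - f (u t))) \<longlonglongrightarrow> 0"
    using sp lim X
  proof eventually_elim
    case (elim t)
    have sX: "s k t \<in> X" for k using s(2) elim(1) by blast
    show ?case
      using lip[OF sX elim(3)] Y.seminorm_nonneg[OF Y.diff_in[OF im[OF sX] im[OF elim(3)]]]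
      by (intro Lim_null_comparison[OF _ tendsto_mult_right_zero[OF elim(2), of K]]) auto
  qed
  then have sm: "strongly_measurable (time T) Y N' (\<lambda>t. f (u t))"
    unfolding strongly_measurable_def using s im
    by (intro exI[of _ "\<lambda>k t. f (s k t)"])
      (auto simp: image_subset_iff intro!: simple_function_compose1[where g = f])
  have ae: "AE t in time T. f (u t) \<in> Y" using X by eventually_elim (rule im)
  have "integrable (time T) (\<lambda>t. (N' (f (u t)))\<^sup>2)"
  proof (rule Bochner_Integration.integrable_bound)
    show "integrable (time T) (\<lambda>t. K\<^sup>2 * (N (u t))\<^sup>2)" using int by simp
    show "(\<lambda>t. (N' (f (u t)))\<^sup>2) \<in> borel_measurable (time T)"
      using Y.strongly_measurable_seminorm[OF _ sm ae] by simp
    show "AE t in time T. norm ((N' (f (u t)))\<^sup>2) \<le> norm (K\<^sup>2 * (N (u t))\<^sup>2)"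
      using X
    proof eventually_elim
      case (elim t)
      show ?case
        using power_mono[OF bnd[OF elim] Y.seminorm_nonneg[OF im[OF elim]], of 2]
        by (simp add: power_mult_distrib)
    qed
  qed
  then show ?thesis using ae sm by (simp add: L2_time_def)
qed

lemma L2_time_scaleR:
  assumes "u \<in> L2_time T X N" shows "(\<lambda>t. c *\<^sub>R u t) \<in> L2_time T X N"
proof (rule L2_time_compose[OF seminormed_space_axioms assms])
  show "N (c *\<^sub>R v - c *\<^sub>R w) \<le> \<bar>c\<bar> * N (v - w)" if "v \<in> X" "w \<in> X" for v w
    using homogeneous[OF diff_in[OF that], of c] by (simp add: scaleR_diff_right)
qed (auto simp: homogeneous intro: scaleR_in)

lemma L2_time_add:
  assumes "u \<in> L2_time T X N" "v \<in> L2_time T X N" shows "(\<lambda>t. u t + v t) \<in> L2_time T X N"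
proof -
  obtain s where s: "\<And>k. simple_function (time T) (s k)" "\<And>k. s k ` {0<..<T} \<subseteq> X"
    and slim: "AE t in time T. (\<lambda>k. N (s k t - u t)) \<longlonglongrightarrow> 0"
    and uX: "AE t in time T. u t \<in> X" and uint: "integrable (time T) (\<lambda>t. (N (u t))\<^sup>2)"
    using assms(1) by (auto simp: L2_time_def strongly_measurable_def)
  obtain r where r: "\<And>k. simple_function (time T) (r k)" "\<And>k. r k ` {0<..<T} \<subseteq> X"
    and rlim: "AE t in time T. (\<lambda>k. N (r k t - v t)) \<longlonglongrightarrow> 0"
    and vX: "AE t in time T. v t \<in> X" and vint: "integrable (time T) (\<lambda>t. (N (v t))\<^sup>2)"
    using assms(2) by (auto simp: L2_time_def strongly_measurable_def)
  have sp: "AE t in time T. t \<in> {0<..<T}" by (rule AE_I2) simp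
  have "AE t in time T. (\<lambda>k. N ((s k t + r k t) - (u t + v t))) \<longlonglongrightarrow> 0"
    using sp slim rlim uX vX
  proof eventually_elim
    case (elim t)
    have mem: "s k t - u t \<in> X" "r k t - v t \<in> X" for k
      using s(2) r(2) elim diff_in by blast+
    have "N ((s k t + r k t) - (u t + v t)) \<le> N (s k t - u t) + N (r k t - v t)" for k
      using triangle[OF mem] by (simp add: algebra_simps)
    moreover have "0 \<le> N ((s k t + r k t) - (u t + v t))" for k
      using seminorm_nonneg[OF add_in[OF mem]] by (simp add: algebra_simps)
    ultimately show ?case
      using tendsto_add[OF elim(2,3)]
      by (intro Lim_null_comparison[OF _ tendsto_add_zero[OF elim(2,3)]]) auto
  qed
  then have sm: "strongly_measurable (time T) X N (\<lambda>t. u t + v t)"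
    unfolding strongly_measurable_def using s r add_in
    by (intro exI[of _ "\<lambda>k t. s k t + r k t"])
      (auto simp: image_subset_iff intro!: simple_function_add)
  have X: "AE t in time T. u t + v t \<in> X"
    using uX vX by eventually_elim (rule add_in)
  have "integrable (time T) (\<lambda>t. (N (u t + v t))\<^sup>2)"
  proof (rule Bochner_Integration.integrable_bound)
    show "integrable (time T) (\<lambda>t. 2 * (N (u t))\<^sup>2 + 2 * (N (v t))\<^sup>2)" using uint vint by simp
    show "(\<lambda>t. (N (u t + v t))\<^sup>2) \<in> borel_measurable (time T)"
      using strongly_measurable_seminorm[OF _ sm X] by simp
    show "AE t in time T. norm ((N (u t + v t))\<^sup>2) \<le> norm (2 * (N (u t))\<^sup>2 + 2 * (N (v t))\<^sup>2)"
      using uX vX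
    proof eventually_elim
      case (elim t)
      have "(N (u t + v t))\<^sup>2 \<le> (N (u t) + N (v t))\<^sup>2"
        using triangle[OF elim] seminorm_nonneg[OF add_in[OF elim]] by (rule power_mono)
      also have "\<dots> \<le> 2 * (N (u t))\<^sup>2 + 2 * (N (v t))\<^sup>2"
        using sum_squares_ge_zero[of "N (u t) - N (v t)" 0] by (simp add: power2_eq_square algebra_simps)
      finally show ?case by simp
    qed
  qed
  then show ?thesis using X sm by (simp add: L2_time_def)
qed

lemma L2_time_diff:
  assumes "u \<in> L2_time T X N" "v \<in> L2_time T X N" shows "(\<lambda>t. u t - v t) \<in> L2_time T X N"
  using L2_time_add[OF assms(1) L2_time_scaleR[OF assms(2), of "-1"]] by simp

text \<open>Strong measurability supplies simple functions that converge pointwise only. Truncating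
  them produces a majorant, and dominated convergence then gives convergence in square mean.\<close>

lemma L2_time_simple_approx:
  assumes "u \<in> L2_time T X N"
  obtains s where "\<And>k::nat. simple_function (time T) (s k)" "\<And>k. s k ` {0<..<T} \<subseteq> X"
    "(\<lambda>k. \<integral>t. (N (u t - s k t))\<^sup>2 \<partial>time T) \<longlonglongrightarrow> 0"
proof -
  obtain s where s: "\<And>k. simple_function (time T) (s k)" "\<And>k. s k ` {0<..<T} \<subseteq> X"
    and lim: "AE t in time T. (\<lambda>k. N (s k t - u t)) \<longlonglongrightarrow> 0"
    and X: "AE t in time T. u t \<in> X" and int: "integrable (time T) (\<lambda>t. (N (u t))\<^sup>2)"
    using assms by (auto simp: L2_time_def strongly_measurable_def)
  have sp: "AE t in time T. t \<in> {0<..<T}" by (rule AE_I2) simp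
  \<comment> \<open>Values of \<open>s k\<close> more than twice as large as \<open>u t\<close> are
    replaced by 0. Then N (u t - r k t) is at most 3 N (u t), which explains the factor 9 in the
    majorant.\<close>
  define r where "r k t = (if N (s k t) \<le> 2 * N (u t) then s k t else 0)" for k t
  have Nu: "(\<lambda>t. N (u t)) \<in> borel_measurable (time T)" by (rule L2_time_seminorm[OF assms])
  have Ns: "(\<lambda>t. N (s k t)) \<in> borel_measurable (time T)" for k
    by (rule borel_measurable_simple_function_compose[where g = "\<lambda>v t. N v", OF s(1)]) simp
  have r1: "simple_function (time T) (r k)" for k
    unfolding r_def using Nu Ns[of k] by (intro simple_function_If s borel_measurable_le) auto
  have r2: "r k ` {0<..<T} \<subseteq> X" for k
    using s(2) zero_in by (auto simp: r_def)
  have r2': "r k t \<in> X" if "t \<in> {0<..<T}" for k t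
    using r2 that by blast
  have sX: "s k t \<in> X" if "t \<in> {0<..<T}" for k t
    using s(2) that by blast
  have "(\<lambda>k. \<integral>t. (N (u t - r k t))\<^sup>2 \<partial>time T) \<longlonglongrightarrow> (\<integral>t. 0 \<partial>time T)"
  proof (rule integral_dominated_convergence)
    show "integrable (time T) (\<lambda>t. 9 * (N (u t))\<^sup>2)" using int by simp
    show "AE t in time T. norm ((N (u t - r k t))\<^sup>2) \<le> 9 * (N (u t))\<^sup>2" for k
      using sp X
    proof eventually_elim
      case (elim t)
      have "N (u t - r k t) \<le> N (u t) + N (r k t)"
        using triangle_diff elim r2' by blast
      also have "N (r k t) \<le> 2 * N (u t)"
        using seminorm_nonneg[OF elim(2)] by (simp add: r_def)
      finally have "(N (u t - r k t))\<^sup>2 \<le> (3 * N (u t))\<^sup>2"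
        using seminorm_nonneg[of "u t - r k t"] diff_in elim r2' by (intro power_mono) auto
      then show ?case by (simp add: power_mult_distrib)
    qed
    show "AE t in time T. (\<lambda>k. (N (u t - r k t))\<^sup>2) \<longlonglongrightarrow> 0"
      using sp X lim
    proof eventually_elim
      case (elim t)
      have lim': "(\<lambda>k. N (u t - s k t)) \<longlonglongrightarrow> 0"
        using elim(3) seminorm_diff_commute[OF elim(2) sX[OF elim(1)]] by simp
      have "(\<lambda>k. N (u t - r k t)) \<longlonglongrightarrow> 0"
      \<comment> \<open>If N (u t) = 0, the truncation leaves only values of seminorm 0. Otherwise N
        (u t - s k t) < N (u t) eventually, hence N (s k t) < 2 N (u t), and the truncation is no
        longer active.\<close>
      proof (cases "N (u t) = 0")
        case True
        have "N (u t - r k t) = 0" for k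
          using triangle_diff[OF elim(2) r2'[OF elim(1), of k]] True
            seminorm_nonneg[OF diff_in[OF elim(2) r2'[OF elim(1), of k]]]
            seminorm_nonneg[OF sX[OF elim(1), of k]]
          by (auto simp: r_def split: if_splits)
        then show ?thesis by simp
      next
        case False
        then have pos: "0 < N (u t)" using seminorm_nonneg[OF elim(2)] by simp
        have "eventually (\<lambda>k. N (u t - s k t) < N (u t)) sequentially"
          using order_tendstoD(2)[OF lim' pos] .
        then have "eventually (\<lambda>k. N (u t - s k t) = N (u t - r k t)) sequentially"
        proof eventually_elim
          case (elim k)
          then show ?case
            using reverse_triangle[OF \<open>u t \<in> X\<close> sX[OF \<open>t \<in> {0<..<T}\<close>, of k]] pos
            by (auto simp: r_def)
        qed
        then show ?thesis using lim' by (rule Lim_transform_eventually[rotated])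
      qed
      then show ?case using tendsto_power[of "\<lambda>k. N (u t - r k t)" 0 _ 2] by simp
    qed
    have "(\<lambda>t. N (u t - r k t)) \<in> borel_measurable (time T)" for k
    proof (rule strongly_measurable_seminorm)
      show ae: "AE t in time T. u t - r k t \<in> X"
        using sp X by eventually_elim (intro diff_in r2')
      have "AE t in time T. (\<lambda>j. N (s j t - r k t - (u t - r k t))) \<longlonglongrightarrow> 0"
        using lim by simp
      then show "strongly_measurable (time T) X N (\<lambda>t. u t - r k t)"
        unfolding strongly_measurable_def using s r1 sX r2' diff_in
        by (intro exI[of _ "\<lambda>j t. s j t - r k t"])
          (auto simp: image_subset_iff intro!: simple_function_diff diff_in)
    qed simp
    then show "(\<lambda>t. (N (u t - r k t))\<^sup>2) \<in> borel_measurable (time T)" for k by simp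
  qed simp
  then have "(\<lambda>k. \<integral>t. (N (u t - r k t))\<^sup>2 \<partial>time T) \<longlonglongrightarrow> 0" by simp
  with r1 r2 show thesis by (rule that)
qed

end

context seminormed_pairing
begin

lemma pairing_tendsto:
  assumes X: "\<And>k. s k \<in> X" "u \<in> X" "((\<lambda>k. N (s k - u)) \<longlongrightarrow> 0) F"
    and Y: "\<And>k. r k \<in> Y" "v \<in> Y" "((\<lambda>k. N' (r k - v)) \<longlongrightarrow> 0) F"
  shows "((\<lambda>k. B (s k) (r k)) \<longlongrightarrow> B u v) F"
proof -
  let ?a = "\<lambda>k. N (s k - u)" and ?b = "\<lambda>k. N' (r k - v)"
  have le: "\<bar>B (s k) (r k) - B u v\<bar> \<le> ?a k * ?b k + ?a k * N' v + N u * ?b k" for k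
  proof -
    have "B (s k) (r k) - B u v = B (s k - u) (r k - v) + B (s k - u) v + B u (r k - v)"
      using X Y by (simp add: diff_left diff_right X.diff_in Y.diff_in)
    then show ?thesis
      using bounded[OF X.diff_in Y.diff_in, OF X(1)[of k] X(2) Y(1)[of k] Y(2)]
        bounded[OF X.diff_in Y(2), OF X(1)[of k] X(2)] bounded[OF X(2) Y.diff_in, OF Y(1)[of k] Y(2)]
      by linarith
  qed
  have lim: "((\<lambda>k. ?a k * ?b k + ?a k * N' v + N u * ?b k) \<longlongrightarrow> 0) F"
    using tendsto_add[OF tendsto_add[OF tendsto_mult[OF X(3) Y(3)] tendsto_mult[OF X(3) tendsto_const[of "N' v"]]]
        tendsto_mult[OF tendsto_const[of "N u"] Y(3)]] by simp
  have "((\<lambda>k. B (s k) (r k) - B u v) \<longlongrightarrow> 0) F"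
    by (rule Lim_null_comparison[OF _ lim]) (simp add: le)
  then show ?thesis by (rule LIM_zero_cancel)
qed

text \<open>The pairing of two simple functions is a simple scalar function, and
  \<open>pairing_tendsto\<close> passes to the limit.\<close>

lemma pairing_measurable:
  fixes S :: "real set"
  assumes S: "S \<in> sets lebesgue"
    and u: "strongly_measurable (lebesgue_on S) X N u" "AE t in lebesgue_on S. u t \<in> X"
    and v: "strongly_measurable (lebesgue_on S) Y N' v" "AE t in lebesgue_on S. v t \<in> Y"
  shows "(\<lambda>t. B (u t) (v t)) \<in> borel_measurable (lebesgue_on S)"
proof -
  obtain s where s: "\<And>k. simple_function (lebesgue_on S) (s k)" "\<And>k. s k ` S \<subseteq> X"
    and slim: "AE t in lebesgue_on S. (\<lambda>k. N (s k t - u t)) \<longlonglongrightarrow> 0"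
    using u(1) by (auto simp: strongly_measurable_def)
  obtain r where r: "\<And>k. simple_function (lebesgue_on S) (r k)" "\<And>k. r k ` S \<subseteq> Y"
    and rlim: "AE t in lebesgue_on S. (\<lambda>k. N' (r k t - v t)) \<longlonglongrightarrow> 0"
    using v(1) by (auto simp: strongly_measurable_def)
  have sp: "AE t in lebesgue_on S. t \<in> S" by (rule AE_I2) simp
  have "AE t in lebesgue_on S. (\<lambda>k. B (s k t) (r k t)) \<longlonglongrightarrow> B (u t) (v t)"
    using sp slim rlim u(2) v(2)
  proof eventually_elim
    case (elim t)
    have sX: "s k t \<in> X" and rY: "r k t \<in> Y" for k using s(2) r(2) elim(1) by blast+
    show ?case by (rule pairing_tendsto[OF sX elim(4) elim(2) rY elim(5) elim(3)])
  qed
  then show ?thesis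
    by (rule borel_measurable_lebesgue_on_LIMSEQ_AE[OF S, rotated])
      (rule borel_measurable_simple_function, rule simple_function_compose2[OF s(1) r(1)])
qed

lemma pairing_integrable:
  assumes u: "u \<in> L2_time T X N" and v: "v \<in> L2_time T Y N'"
  shows "integrable (time T) (\<lambda>t. B (u t) (v t))"
proof (rule Bochner_Integration.integrable_bound)
  show "integrable (time T) (\<lambda>t. (N (u t))\<^sup>2 + (N' (v t))\<^sup>2)"
    using u v by (simp add: L2_time_def)
  show "(\<lambda>t. B (u t) (v t)) \<in> borel_measurable (time T)"
    using u v by (intro pairing_measurable) (auto simp: L2_time_def)
  have "AE t in time T. u t \<in> X" "AE t in time T. v t \<in> Y" using u v by (auto simp: L2_time_def)
  then show "AE t in time T. norm (B (u t) (v t)) \<le> norm ((N (u t))\<^sup>2 + (N' (v t))\<^sup>2)"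
  proof eventually_elim
    case (elim t)
    have "\<bar>B (u t) (v t)\<bar> \<le> N (u t) * N' (v t)" by (rule bounded[OF elim])
    also have "\<dots> \<le> (N (u t))\<^sup>2 + (N' (v t))\<^sup>2"
      using zero_le_power2[of "N (u t) - N' (v t)"]
        mult_nonneg_nonneg[OF X.seminorm_nonneg Y.seminorm_nonneg, OF elim]
      unfolding power2_diff by linarith
    finally show ?case by simp
  qed
qed

end


subsection \<open>Smooth functions\<close>

text \<open>\<open>Ck\<close> speaks about the chosen \<open>frechet_derivative\<close>. By
  uniqueness any explicitly computed family of derivatives may be used instead, which is how the
  closure properties below are proved.\<close>

lemma Ck_SucI:
  assumes "\<And>x. (f has_derivative f' x) (at x)" "\<And>i. i \<in> Basis \<Longrightarrow> Ck k (\<lambda>x. f' x i)"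
  shows "Ck (Suc k) f"
proof -
  have "frechet_derivative f (at x) = f' x" for x
    using frechet_derivative_at[OF assms(1)[of x]] by simp
  then show ?thesis using assms by (auto simp: differentiable_def)
qed

lemma Ck_Suc_has_derivative:
  "Ck (Suc k) f \<Longrightarrow> (f has_derivative frechet_derivative f (at x)) (at x)"
  by (simp add: frechet_derivative_works[symmetric])

text \<open>The product rule multiplies a partial derivative, which is \<open>Ck k\<close>, by an
  original factor, which is \<open>Ck (Suc k)\<close>. Lowering the order of the latter keeps the
  induction for products going.\<close>

lemma Ck_SucD: "Ck (Suc k) f \<Longrightarrow> Ck k f"
proof (induction k arbitrary: f)
  case 0
  then show ?case
    by (auto intro!: differentiable_imp_continuous_on simp: differentiable_on_def
        intro: differentiable_at_withinI)
next
  case (Suc k)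
  have "\<forall>i\<in>Basis. Ck (Suc k) (\<lambda>x. frechet_derivative f (at x) i)" using Suc.prems unfolding Ck.simps(2)[of "Suc k" f] by blast
  then have "\<forall>i\<in>Basis. Ck k (\<lambda>x. frechet_derivative f (at x) i)" using Suc.IH by blast
  then show ?case using Suc.prems by simp
qed

lemma Ck_const: "Ck k (\<lambda>x. c)"
proof (induction k arbitrary: c)
  case (Suc k)
  show ?case by (rule Ck_SucI[where f' = "\<lambda>x h. 0"]) (auto intro: Suc)
qed simp

lemma Ck_add: "Ck k f \<Longrightarrow> Ck k g \<Longrightarrow> Ck k (\<lambda>x. f x + g x)"
proof (induction k arbitrary: f g)
  case (Suc k)
  show ?case
  proof (rule Ck_SucI)
    show "((\<lambda>x. f x + g x) has_derivative
        (\<lambda>h. frechet_derivative f (at x) h + frechet_derivative g (at x) h)) (at x)" for x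
      by (intro has_derivative_add Ck_Suc_has_derivative[OF Suc.prems(1)] Ck_Suc_has_derivative[OF Suc.prems(2)])
    show "Ck k (\<lambda>x. frechet_derivative f (at x) i + frechet_derivative g (at x) i)" if "i \<in> Basis" for i
      using Suc.prems that by (intro Suc.IH) auto
  qed
qed (auto intro: continuous_intros)

lemma Ck_mult: "Ck k f \<Longrightarrow> Ck k g \<Longrightarrow> Ck k (\<lambda>x. f x * g x)"
proof (induction k arbitrary: f g)
  case (Suc k)
  show ?case
  proof (rule Ck_SucI)
    show "((\<lambda>x. f x * g x) has_derivative
        (\<lambda>h. f x * frechet_derivative g (at x) h + frechet_derivative f (at x) h * g x)) (at x)" for x
      by (intro has_derivative_mult Ck_Suc_has_derivative[OF Suc.prems(1)] Ck_Suc_has_derivative[OF Suc.prems(2)])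
    show "Ck k (\<lambda>x. f x * frechet_derivative g (at x) i + frechet_derivative f (at x) i * g x)"
      if "i \<in> Basis" for i
      using Suc.prems that Ck_SucD[OF Suc.prems(1)] Ck_SucD[OF Suc.prems(2)]
      by (intro Ck_add Suc.IH) auto
  qed
qed (auto intro: continuous_intros)

lemma Ck_prod: "finite I \<Longrightarrow> (\<And>i. i \<in> I \<Longrightarrow> Ck k (f i)) \<Longrightarrow> Ck k (\<lambda>x. \<Prod>i\<in>I. f i x)"
  by (induction I rule: finite_induct) (auto intro: Ck_mult Ck_const)

lemma Ck_compose_affine:
  fixes f :: "real \<Rightarrow> real" and a :: "'a::euclidean_space"
  shows "Ck k f \<Longrightarrow> Ck k (\<lambda>x. f (a \<bullet> x + c))"
proof (induction k arbitrary: f)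
  case 0
  then show ?case
    by (auto intro!: continuous_on_compose2[where f = "\<lambda>x. a \<bullet> x + c" and g = f and t = UNIV] continuous_intros)
next
  case (Suc k)
  \<comment> \<open>On the real line a derivative is determined by its value at 1, the only element
    of \<open>Basis\<close>; this is the partial derivative that \<open>Ck\<close> controls.\<close>
  have lin: "frechet_derivative f (at y) h = frechet_derivative f (at y) 1 * h" for y h
    using linear_scale[OF has_derivative_linear[OF Ck_Suc_has_derivative[OF Suc.prems, of y]], of h 1]
    by simp
  show ?case
  proof (rule Ck_SucI)
    show "((\<lambda>x. f (a \<bullet> x + c)) has_derivative
        (\<lambda>h. frechet_derivative f (at (a \<bullet> x + c)) 1 * (a \<bullet> h))) (at x)" for x
    proof -
      have "((\<lambda>x. a \<bullet> x + c) has_derivative (\<lambda>h. a \<bullet> h)) (at x)"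
        by (auto intro!: derivative_eq_intros)
      from has_derivative_compose[OF this Ck_Suc_has_derivative[OF Suc.prems]]
      show ?thesis by (subst (asm) lin)
    qed
    show "Ck k (\<lambda>x. frechet_derivative f (at (a \<bullet> x + c)) 1 * (a \<bullet> i))" for i
      using Suc.prems by (intro Ck_mult Ck_const Suc.IH) auto
  qed
qed

lemma Ck_SucI_real:
  fixes f :: "real \<Rightarrow> real"
  assumes "\<And>x. (f has_real_derivative f' x) (at x)" "Ck k f'"
  shows "Ck (Suc k) f"
  by (rule Ck_SucI[where f' = "\<lambda>x h. f' x * h"])
    (use assms in \<open>auto simp: has_field_derivative_def\<close>)

section \<open>Smooth bumps and smooth steps built from exp (-1/x)\<close>

definition flat :: "real poly \<Rightarrow> real \<Rightarrow> real" where
  "flat p x = (if x > 0 then poly p (inverse x) * exp (- inverse x) else 0)"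

lemma poly_times_exp_minus_tendsto_0: "((\<lambda>y. poly p y * exp (- y)) \<longlongrightarrow> (0::real)) at_top"
proof -
  have "((\<lambda>y. \<Sum>i\<le>degree p. coeff p i * (y ^ i / exp y)) \<longlongrightarrow> (\<Sum>i\<le>degree p. coeff p i * 0)) at_top"
    by (intro tendsto_intros tendsto_power_div_exp_0)
  then show ?thesis
    by (simp add: poly_altdef sum_divide_distrib exp_minus divide_inverse[symmetric])
qed

text \<open>With y = 1/x, the derivative of p(y) exp(-y) in x is y^2 (p(y) - p'(y)) exp(-y), so the
  new polynomial is X^2 (p - p'). The family is closed under differentiation, which makes all its
  members smooth by induction.\<close>

lemma flat_has_derivative:
  "(flat p has_real_derivative flat ([:0, 0, 1:] * (p - pderiv p)) x) (at x)"
proof -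
  consider "x > 0" | "x < 0" | "x = 0" by linarith
  then show ?thesis
  proof cases
    case 1
    have "((\<lambda>x. poly p (inverse x) * exp (- inverse x)) has_real_derivative
        flat ([:0, 0, 1:] * (p - pderiv p)) x) (at x)"
      using 1 by (auto intro!: derivative_eq_intros simp: flat_def power2_eq_square algebra_simps)
    moreover have "eventually (\<lambda>y. y \<in> {0<..}) (nhds x)"
      using 1 by (intro eventually_nhds_in_open) auto
    ultimately show ?thesis
      by (subst DERIV_cong_ev[OF refl _ refl]) (auto simp: flat_def elim!: eventually_mono)
  next
    case 2
    have "eventually (\<lambda>y. y \<in> {..<0}) (nhds x)"
      using 2 by (intro eventually_nhds_in_open) auto
    then show ?thesis
      using 2 by (subst DERIV_cong_ev[OF refl _ refl, where g = "\<lambda>_. 0"])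
        (auto simp: flat_def elim!: eventually_mono)
  next
    case 3
    \<comment> \<open>Division by h multiplies the polynomial by X, and the exponential still wins
      as 1/h tends to infinity.\<close>
    have "((\<lambda>h. poly ([:0, 1:] * p) (inverse h) * exp (- inverse h)) \<longlongrightarrow> 0) (at_right 0)"
      by (rule filterlim_compose[OF poly_times_exp_minus_tendsto_0 filterlim_inverse_at_top_right])
    moreover have pos: "eventually (\<lambda>h::real. h > 0) (at_right 0)"
      by (auto simp: eventually_at_right_field intro: exI[of _ 1])
    moreover from pos
    have "eventually (\<lambda>h. poly ([:0, 1:] * p) (inverse h) * exp (- inverse h) = flat p h / h) (at_right 0)"
      by eventually_elim (simp add: flat_def field_simps)
    ultimately have "((\<lambda>h. flat p h / h) \<longlongrightarrow> 0) (at_right 0)"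
      by (blast intro: Lim_transform_eventually)
    moreover have "((\<lambda>h. flat p h / h) \<longlongrightarrow> 0) (at_left 0)"
    proof (rule Lim_transform_eventually)
      show "eventually (\<lambda>h. 0 = flat p h / h) (at_left 0)"
        by (auto simp: eventually_at_left_field flat_def intro: exI[of _ "-1"])
    qed simp
    ultimately have "((\<lambda>h. flat p h / h) \<longlongrightarrow> 0) (at 0)"
      by (simp add: filterlim_split_at)
    then show ?thesis using 3 by (simp add: DERIV_def flat_def)
  qed
qed

lemma Ck_flat: "Ck k (flat p)"
proof (induction k arbitrary: p)
  case 0
  show ?case
    using DERIV_isCont[OF flat_has_derivative] by (auto intro!: continuous_at_imp_continuous_on)
next
  case (Suc k)
  show ?case by (rule Ck_SucI_real[OF flat_has_derivative Suc])
qed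

lemma flat_1_bounds: "0 \<le> flat 1 x" "flat 1 x \<le> 1" "flat 1 x = 0 \<longleftrightarrow> x \<le> 0"
  by (auto simp: flat_def)

lemma flat_1_tendsto:
  "(\<lambda>n. flat 1 (real n * x)) \<longlonglongrightarrow> (if x > 0 then 1 else 0)"
proof (cases "x > 0")
  case True
  have "(\<lambda>n. exp (- (inverse x * inverse (real n)))) \<longlonglongrightarrow> exp (- (inverse x * 0))"
    by (intro tendsto_intros lim_inverse_n)
  then have "(\<lambda>n. exp (- inverse (real n * x))) \<longlonglongrightarrow> 1" by (simp add: mult.commute)
  moreover have "eventually (\<lambda>n. exp (- inverse (real n * x)) = flat 1 (real n * x)) sequentially"
    using eventually_gt_at_top[of 0] by eventually_elim (use True in \<open>simp add: flat_def\<close>)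
  ultimately show ?thesis using True by (simp add: Lim_transform_eventually)
next
  case False
  then have "flat 1 (real n * x) = 0" for n
    by (simp add: flat_1_bounds mult_nonneg_nonpos)
  then show ?thesis using False by simp
qed

text \<open>Each factor \<open>flat 1\<close> is a smooth ramp that starts at one face of the box.
  Growing \<open>n\<close> steepens the ramps, so that the products converge to the indicator of the
  open box while they stay in [0, 1] and vanish off the box.\<close>

definition box_bump :: "'a::euclidean_space \<Rightarrow> 'a \<Rightarrow> nat \<Rightarrow> 'a \<Rightarrow> real" where
  "box_bump a b n x =
     (\<Prod>i\<in>Basis. flat 1 (real n * (x \<bullet> i - a \<bullet> i)) * flat 1 (real n * (b \<bullet> i - x \<bullet> i)))"

lemma box_bump_bounds: "0 \<le> box_bump a b n x" "box_bump a b n x \<le> 1"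
  unfolding box_bump_def
  by (auto intro!: prod_nonneg prod_le_1 mult_nonneg_nonneg mult_le_one flat_1_bounds)

lemma box_bump_test_function:
  assumes "cbox a b \<subseteq> \<Omega>"
  shows "box_bump a b n \<in> test_functions \<Omega>"
proof -
  have "{x. box_bump a b n x \<noteq> 0} \<subseteq> cbox a b"
  proof clarify
    fix x assume "box_bump a b n x \<noteq> 0"
    then have "\<forall>i\<in>Basis. \<not> real n * (x \<bullet> i - a \<bullet> i) \<le> 0 \<and> \<not> real n * (b \<bullet> i - x \<bullet> i) \<le> 0"
      by (auto simp: box_bump_def flat_1_bounds(3))
    then have "\<forall>i\<in>Basis. a \<bullet> i \<le> x \<bullet> i \<and> x \<bullet> i \<le> b \<bullet> i"
      by (smt (verit) mult_nonneg_nonpos of_nat_0_le_iff)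
    then show "x \<in> cbox a b" by (simp add: mem_box)
  qed
  then have sub: "closure {x. box_bump a b n x \<noteq> 0} \<subseteq> cbox a b"
    by (rule closure_minimal) (rule closed_cbox)
  moreover have "compact (closure {x. box_bump a b n x \<noteq> 0})"
    using compact_Int_closed[OF compact_cbox closed_closure, of a b "{x. box_bump a b n x \<noteq> 0}"] sub
    by (simp add: Int_absorb1)
  moreover have "Ck k (box_bump a b n)" for k
  proof -
    have "Ck k (\<lambda>x. flat 1 (real n * (x \<bullet> i - a \<bullet> i)))" for i
      using Ck_compose_affine[OF Ck_flat, of k 1 "real n *\<^sub>R i" "- (real n * (a \<bullet> i))"]
      by (simp add: algebra_simps inner_commute)
    moreover have "Ck k (\<lambda>x. flat 1 (real n * (b \<bullet> i - x \<bullet> i)))" for i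
      using Ck_compose_affine[OF Ck_flat, of k 1 "- real n *\<^sub>R i" "real n * (b \<bullet> i)"]
      by (simp add: algebra_simps inner_commute)
    ultimately show ?thesis
      unfolding box_bump_def by (intro Ck_prod Ck_mult) auto
  qed
  ultimately show ?thesis using assms by (auto simp: test_functions_def)
qed

lemma box_bump_tendsto: "(\<lambda>n. box_bump a b n x) \<longlonglongrightarrow> indicator (box a b) x"
proof -
  have "(\<lambda>n. box_bump a b n x) \<longlonglongrightarrow>
      (\<Prod>i\<in>Basis. (if x \<bullet> i - a \<bullet> i > 0 then 1 else 0) * (if b \<bullet> i - x \<bullet> i > 0 then 1 else 0))"
    unfolding box_bump_def by (intro tendsto_prod tendsto_mult flat_1_tendsto)
  also have "(\<Prod>i\<in>Basis. (if x \<bullet> i - a \<bullet> i > 0 then 1 else 0) * (if b \<bullet> i - x \<bullet> i > 0 then 1 else 0)) =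
      (indicator (box a b) x :: real)"
    by (auto simp: indicator_def mem_box intro!: prod.neutral)
  finally show ?thesis .
qed

text \<open>The candidate is the oriented integral from 0. The fundamental theorem is applied on a
  compact interval that has both 0 and \<open>x\<close> in its interior, so that the derivative
  obtained at \<open>x\<close> is two-sided.\<close>

lemma antiderivative_on_UNIV:
  fixes f :: "real \<Rightarrow> real"
  assumes "continuous_on UNIV f"
  obtains g where "\<And>x. (g has_real_derivative f x) (at x)"
proof (rule that)
  fix x :: real
  let ?g = "\<lambda>u. LBINT y=0..u. f y" and ?a = "- \<bar>x\<bar> - 1" and ?b = "\<bar>x\<bar> + 1"
  have "(?g has_vector_derivative f x) (at x within {?a..?b})"
    using continuous_on_subset[OF assms]
    by (intro interval_integral_FTC2[where c = 0, unfolded zero_ereal_def[symmetric]]) auto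
  moreover have "at x within {?a..?b} = at x"
    by (rule at_within_interior) (auto simp: interior_atLeastAtMost_real)
  ultimately have "(?g has_vector_derivative f x) (at x)" by (simp only:)
  then show "(?g has_real_derivative f x) (at x)"
    by (simp only: has_real_derivative_iff_has_vector_derivative)
qed

text \<open>\<open>R\<close> is an antiderivative of a bump on (0, 1), divided by its total
  increase. Rescaled copies of \<rho> serve as approximate identities of mass 1, and rescaled copies
  of \<open>R\<close> approximate indicators of half lines.\<close>

lemma smooth_step:
  obtains R \<rho> :: "real \<Rightarrow> real"
  where "\<And>k. Ck k \<rho>" "\<And>x. (R has_real_derivative \<rho> x) (at x)" "\<And>x. 0 \<le> \<rho> x"
    "\<And>x. x \<notin> {0<..<1} \<Longrightarrow> \<rho> x = 0"
    "\<And>x. x \<le> 0 \<Longrightarrow> R x = 0" "\<And>x. x \<ge> 1 \<Longrightarrow> R x = 1"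
proof -
  define \<sigma> where "\<sigma> x = flat 1 x * flat 1 (1 - x)" for x
  have \<sigma>: "Ck k \<sigma>" for k
    unfolding \<sigma>_def using Ck_compose_affine[OF Ck_flat, of k 1 "-1::real" 1]
    by (intro Ck_mult Ck_flat) simp
  obtain g where g: "\<And>x. (g has_real_derivative \<sigma> x) (at x)"
    using antiderivative_on_UNIV[of \<sigma>] \<sigma>[of 0] by auto
  define c where "c = g 1 - g 0"
  \<comment> \<open>The mean value theorem replaces integration throughout: the increase
    \<open>c\<close> is positive because \<sigma> is positive inside (0, 1), and \<open>g\<close> is
    constant outside because \<sigma> vanishes there.\<close>
  obtain z where z: "0 < z" "z < 1" "g 1 - g 0 = (1 - 0) * \<sigma> z"
    using MVT2[of 0 1 g \<sigma>] g by auto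
  then have c: "c > 0" using flat_1_bounds[of z] flat_1_bounds[of "1 - z"] by (simp add: c_def \<sigma>_def less_le)
  have left: "g x = g 0" if "x \<le> 0" for x
  proof (cases "x = 0")
    case False
    then obtain z where "x < z" "z < 0" "g 0 - g x = (0 - x) * \<sigma> z"
      using MVT2[of x 0 g \<sigma>] g \<open>x \<le> 0\<close> by auto
    then show ?thesis using flat_1_bounds(3)[of z] by (simp add: \<sigma>_def)
  qed simp
  have right: "g x = g 1" if "x \<ge> 1" for x
  proof (cases "x = 1")
    case False
    then obtain z where "1 < z" "z < x" "g x - g 1 = (x - 1) * \<sigma> z"
      using MVT2[of 1 x g \<sigma>] g \<open>x \<ge> 1\<close> by auto
    then show ?thesis using flat_1_bounds(3)[of "1 - z"] by (simp add: \<sigma>_def)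
  qed simp
  show thesis
  proof (rule that[of "\<lambda>x. inverse c * \<sigma> x" "\<lambda>x. inverse c * (g x - g 0)"])
    show "((\<lambda>x. inverse c * (g x - g 0)) has_real_derivative inverse c * \<sigma> x) (at x)" for x
      using g[of x] by (auto intro!: derivative_eq_intros)
    show "0 \<le> inverse c * \<sigma> x" for x using c by (simp add: \<sigma>_def flat_1_bounds)
    show "Ck k (\<lambda>x. inverse c * \<sigma> x)" for k by (intro Ck_mult Ck_const \<sigma>)
    show "inverse c * \<sigma> x = 0" if "x \<notin> {0<..<1}" for x
      using that flat_1_bounds(3)[of x] flat_1_bounds(3)[of "1 - x"] by (auto simp: \<sigma>_def)
    show "inverse c * (g x - g 0) = 0" if "x \<le> 0" for x using left[OF that] by simp
    show "inverse c * (g x - g 0) = 1" if "x \<ge> 1" for x using right[OF that] c by (simp add: c_def)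
  qed
qed


subsection \<open>The spaces $L^2$ and $H^1$\<close>

lemma L2_mult_integrable:
  assumes "f \<in> L2 M" "g \<in> L2 M" shows "integrable M (\<lambda>x. f x * g x)"
proof (rule Bochner_Integration.integrable_bound)
  show "integrable M (\<lambda>x. (f x)\<^sup>2 + (g x)\<^sup>2)" using assms by (simp add: L2_def)
  show "(\<lambda>x. f x * g x) \<in> borel_measurable M" using assms by (auto simp: L2_def)
  have "\<bar>f x * g x\<bar> \<le> (f x)\<^sup>2 + (g x)\<^sup>2" for x
    using zero_le_power2[of "f x - g x"] zero_le_power2[of "f x + g x"]
    unfolding power2_diff power2_sum by (simp add: abs_le_iff)
  then show "AE x in M. norm (f x * g x) \<le> norm ((f x)\<^sup>2 + (g x)\<^sup>2)" by simp
qed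

lemma L2_semi_inner: "semi_inner_space (L2 M) (L2_inner M)"
proof
  fix f g h :: "'a \<Rightarrow> real" and c :: real
  show "0 \<in> L2 M" by (simp add: L2_def zero_fun_def)
  assume f: "f \<in> L2 M"
  show "c *\<^sub>R f \<in> L2 M" using f by (auto simp: L2_def scaleR_fun_def power_mult_distrib)
  show "0 \<le> L2_inner M f f" by (simp add: L2_inner_def)
  assume g: "g \<in> L2 M"
  show "f + g \<in> L2 M"
    using f g L2_mult_integrable[OF f g]
    by (auto simp: L2_def plus_fun_def power2_sum mult.assoc)
  show "L2_inner M f g = L2_inner M g f" by (simp add: L2_inner_def mult.commute)
  show "L2_inner M (c *\<^sub>R f) g = c * L2_inner M f g"
    by (simp add: L2_inner_def scaleR_fun_def mult.assoc)
  assume h: "h \<in> L2 M"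
  show "L2_inner M (f + g) h = L2_inner M f h + L2_inner M g h"
    using L2_mult_integrable[OF f h] L2_mult_integrable[OF g h]
    by (simp add: L2_inner_def plus_fun_def distrib_right)
qed

interpretation L2: semi_inner_space "L2 M" "L2_inner M" for M
  by (rule L2_semi_inner)

lemma L2_norm_eq: "L2_norm M = (\<lambda>v. sqrt (L2_inner M v v))"
  by (simp add: fun_eq_iff L2_norm_def)

interpretation L2_normed: seminormed_space "L2 M" "L2_norm M" for M
  unfolding L2_norm_eq by (rule L2.seminormed_space_axioms)

interpretation L2_pairing: seminormed_pairing "L2 M" "L2_norm M" "L2 M" "L2_norm M" "L2_inner M" for M
  unfolding L2_norm_eq by (rule L2.pairing.seminormed_pairing_axioms)

lemma L2_inner_self_eq_0:
  assumes "v \<in> L2 M" shows "L2_inner M v v = 0 \<longleftrightarrow> (AE x in M. v x = 0)"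
proof -
  have "integrable M (\<lambda>x. v x * v x)" using assms by (intro L2_mult_integrable)
  then show ?thesis
    unfolding L2_inner_def by (subst integral_nonneg_eq_0_iff_AE) auto
qed

lemma L2_inner_cong_AE:
  assumes "f \<in> L2 M" "f' \<in> L2 M" "g \<in> L2 M" "g' \<in> L2 M"
    "AE x in M. f x = f' x" "AE x in M. g x = g' x"
  shows "L2_inner M f g = L2_inner M f' g'"
  unfolding L2_inner_def
  using assms by (intro integral_cong_AE) (auto simp: L2_def)

lemma continuous_in_L2:
  fixes \<Omega> :: "'a::euclidean_space set"
  assumes "\<Omega> \<in> sets lebesgue" "bounded \<Omega>" "continuous_on UNIV f"
  shows "f \<in> L2 (lebesgue_on \<Omega>)"
proof -
  have "continuous_on (closure \<Omega>) f" using assms(3) continuous_on_subset by blast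
  then have "bounded (f ` closure \<Omega>)"
    using assms(2) by (intro compact_imp_bounded compact_continuous_image) (auto simp: compact_closure)
  then obtain K where K: "\<And>x. x \<in> \<Omega> \<Longrightarrow> \<bar>f x\<bar> \<le> K"
    using closure_subset by (force simp: bounded_iff)
  have "f \<in> borel_measurable lborel" using assms(3) by (simp add: borel_measurable_continuous_onI)
  then have m: "f \<in> borel_measurable (lebesgue_on \<Omega>)"
    by (intro measurable_restrict_space1 measurable_completion)
  have "finite_measure (lebesgue_on \<Omega>)"
    using assms by (intro finite_measure_lebesgue_on bounded_set_imp_lmeasurable)
  then have "integrable (lebesgue_on \<Omega>) (\<lambda>x. (f x)\<^sup>2)"
  proof (rule finite_measure.integrable_const_bound[where B = "K\<^sup>2"])
    show "AE x in lebesgue_on \<Omega>. norm ((f x)\<^sup>2) \<le> K\<^sup>2"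
      using K by (intro AE_I2) (fastforce simp: abs_le_square_iff[symmetric])
  qed (use m in simp)
  then show ?thesis using m by (simp add: L2_def)
qed

lemma L2_integrable:
  assumes "finite_measure M" "f \<in> L2 M" shows "integrable M f"
proof -
  have "(\<lambda>x. 1) \<in> L2 M" using assms(1) by (simp add: L2_def finite_measure.integrable_const)
  from L2_mult_integrable[OF assms(2) this] show ?thesis by simp
qed

lemma test_function_continuous:
  assumes "\<phi> \<in> test_functions \<Omega>"
  shows "continuous_on UNIV \<phi>" "i \<in> Basis \<Longrightarrow> continuous_on UNIV (\<lambda>x. frechet_derivative \<phi> (at x) i)"
proof -
  have "Ck 0 \<phi>" "Ck (Suc 0) \<phi>" using assms unfolding test_functions_def by blast+
  then show "continuous_on UNIV \<phi>"
    "i \<in> Basis \<Longrightarrow> continuous_on UNIV (\<lambda>x. frechet_derivative \<phi> (at x) i)" by auto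
qed

text \<open>Open boxes are stable under intersection and generate the Borel sets, so a Dynkin
  argument reaches every Borel set; the \<open>null\<close> case then adds the null sets of the
  completion. The rule serves for vanishing integrals here and for limits of integrals in time
  later.\<close>

lemma lebesgue_box_induct [consumes 1, case_names box empty compl union null]:
  fixes A :: "'a::euclidean_space set"
  assumes A: "A \<in> sets lebesgue"
    and box: "\<And>a b. P (box a b)" and empty: "P {}"
    and compl: "\<And>A. A \<in> sets lebesgue \<Longrightarrow> P A \<Longrightarrow> P (UNIV - A)"
    and union: "\<And>A::nat \<Rightarrow> 'a set. disjoint_family A \<Longrightarrow> (\<And>i. A i \<in> sets lebesgue) \<Longrightarrow>
      (\<And>i. P (A i)) \<Longrightarrow> P (\<Union>i. A i)"
    and null: "\<And>A B. A \<in> sets lebesgue \<Longrightarrow> B \<in> sets lebesgue \<Longrightarrow>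
      AE x in lebesgue. (indicator A x :: real) = indicator B x \<Longrightarrow> P A \<Longrightarrow> P B"
  shows "P A"
proof -
  have leb: "B \<in> sets lebesgue" if "B \<in> sigma_sets UNIV (range (\<lambda>(a, b). box a b))" for B :: "'a set"
    using that unfolding borel_eq_box[symmetric] by (intro sets_completionI_sets) (simp add: borel_eq_box del: box_real)
  obtain S N N' where S: "A = S \<union> N" "N \<subseteq> N'" "N' \<in> null_sets lborel" "S \<in> sets lborel"
    using A by (rule sets_completionE)
  have "Int_stable (range (\<lambda>(a, b). box a b :: 'a set))"
    by (auto simp: Int_stable_def box_Int_box)
  moreover have "range (\<lambda>(a, b). box a b :: 'a set) \<subseteq> Pow UNIV" by auto
  moreover have "S \<in> sigma_sets UNIV (range (\<lambda>(a, b). box a b))"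
    using S(4) unfolding sets_lborel borel_eq_box by (simp del: box_real)
  ultimately have "P S"
  proof (induction rule: sigma_sets_induct_disjoint)
    case (union F)
    then show ?case by (intro assms(5)) (auto intro: leb)
  qed (use box empty compl leb in auto)
  moreover have "AE x in lebesgue. x \<notin> N'" using S(3) by (intro AE_not_in null_sets_completionI)
  then have "AE x in lebesgue. (indicator S x :: real) = indicator A x"
    using S(1,2) by (auto simp: indicator_def elim!: eventually_mono)
  ultimately show ?thesis
    using S(4) A by (intro null[of S A]) (auto intro: sets_completionI_sets)
qed

text \<open>The fundamental lemma of the calculus of variations. Orthogonality passes from bumps to
  boxes with closure in \<Omega>, then to all measurable subsets of such a box, and a function whose
  integrals over all measurable sets vanish is zero almost everywhere.\<close>

lemma AE_zero_if_orthogonal_to_test_functions: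
  fixes \<Omega> :: "'a::euclidean_space set"
  assumes \<Omega>: "open \<Omega>" and h: "integrable (lebesgue_on \<Omega>) h"
    and orth: "\<And>\<phi>. \<phi> \<in> test_functions \<Omega> \<Longrightarrow> (\<integral>x. h x * \<phi> x \<partial>lebesgue_on \<Omega>) = 0"
  shows "AE x in lebesgue_on \<Omega>. h x = 0"
proof -
  have \<Omega>m: "\<Omega> \<in> sets lebesgue" using \<Omega> by simp
  define h0 where "h0 x = (if x \<in> \<Omega> then h x else 0)" for x
  have h0: "integrable lebesgue h0"
    unfolding h0_def using h \<Omega>m by (simp add: Lebesgue_Measure.integrable_restrict_UNIV)
  have box_zero: "(LINT x:box a b|lebesgue. h0 x) = 0" if ab: "cbox a b \<subseteq> \<Omega>" for a b
  proof -
    have "(\<lambda>n. \<integral>x. h x * box_bump a b n x \<partial>lebesgue_on \<Omega>) \<longlonglongrightarrow>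
        (\<integral>x. h x * indicator (box a b) x \<partial>lebesgue_on \<Omega>)"
    proof (rule integral_dominated_convergence)
      show "integrable (lebesgue_on \<Omega>) (\<lambda>x. \<bar>h x\<bar>)" using h by simp
      have m: "(\<lambda>x. box_bump a b n x) \<in> borel_measurable (lebesgue_on \<Omega>)" for n
        using test_function_continuous(1)[OF box_bump_test_function[OF ab]]
        by (intro measurable_restrict_space1 measurable_completion)
          (simp add: borel_measurable_continuous_onI)
      show "(\<lambda>x. h x * box_bump a b n x) \<in> borel_measurable (lebesgue_on \<Omega>)" for n
        using h m by (intro borel_measurable_times) auto
      show "(\<lambda>x. h x * indicator (box a b) x) \<in> borel_measurable (lebesgue_on \<Omega>)"
        by (rule borel_measurable_times[OF borel_measurable_integrable[OF h] measurable_restrict_space1])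
          (intro borel_measurable_indicator, simp)
      show "AE x in lebesgue_on \<Omega>. (\<lambda>n. h x * box_bump a b n x) \<longlonglongrightarrow> h x * indicator (box a b) x"
        by (intro AE_I2 tendsto_mult_left box_bump_tendsto)
      show "AE x in lebesgue_on \<Omega>. norm (h x * box_bump a b n x) \<le> \<bar>h x\<bar>" for n
        using box_bump_bounds[of a b n] by (intro AE_I2) (simp add: abs_mult mult_left_le)
    qed
    then have "(\<integral>x. h x * indicator (box a b) x \<partial>lebesgue_on \<Omega>) = 0"
      using orth[OF box_bump_test_function[OF ab]] by (simp add: LIMSEQ_const_iff)
    also have "(\<integral>x. h x * indicator (box a b) x \<partial>lebesgue_on \<Omega>) =
        (\<integral>x. (if x \<in> \<Omega> then h x * indicator (box a b) x else 0) \<partial>lebesgue)"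
      using \<Omega>m by (simp add: Lebesgue_Measure.integral_restrict_UNIV)
    also have "\<dots> = (LINT x:box a b|lebesgue. h0 x)"
      unfolding set_lebesgue_integral_def h0_def
      by (intro Bochner_Integration.integral_cong) (auto simp: indicator_def)
    finally show ?thesis .
  qed
  \<comment> \<open>The cut-off to one box inside \<Omega> lets the box induction start: an
    arbitrary box meets \<open>box c d\<close> in a box whose closure still lies in \<Omega>, where
    \<open>box_zero\<close> applies.\<close>
  have local: "AE x in lebesgue. x \<in> cbox c d \<longrightarrow> h0 x = 0" if cd: "cbox c d \<subseteq> \<Omega>" for c d
  proof -
    have int: "integrable lebesgue (\<lambda>x. indicator (box c d) x * h0 x)"
      using integrable_mult_indicator[of "box c d" lebesgue h0] h0 by simp
    have zero: "(LINT x:E|lebesgue. indicator (box c d) x * h0 x) = 0" if "E \<in> sets lebesgue" for E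
      using that
    proof (induction rule: lebesgue_box_induct)
      case (box a b)
      obtain e f where ef: "box a b \<inter> box c d = box e f"
        using box_Int_box[of a b c d] by (rule that)
      have "(LINT x:box a b|lebesgue. indicator (box c d) x * h0 x) = (LINT x:box e f|lebesgue. h0 x)"
        unfolding set_lebesgue_integral_def ef[symmetric]
        by (intro Bochner_Integration.integral_cong) (auto simp: indicator_def)
      also have "\<dots> = 0"
      \<comment> \<open>Only for a nonempty open box is the corresponding closed box its
        closure.\<close>
      proof (cases "box e f = {}")
        case False
        then have "cbox e f = closure (box e f)" by simp
        also have "\<dots> \<subseteq> cbox c d"
          using ef box_subset_cbox[of c d] by (intro closure_minimal) auto
        finally show ?thesis using cd by (intro box_zero) auto
      qed (simp add: set_lebesgue_integral_def)
      finally show ?case .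
    next
      case empty
      show ?case by (simp add: set_lebesgue_integral_def)
    next
      case (compl A)
      have "(LINT x:UNIV - A|lebesgue. indicator (box c d) x * h0 x) =
          (LINT x|lebesgue. indicator (box c d) x * h0 x) - (LINT x:A|lebesgue. indicator (box c d) x * h0 x)"
        unfolding set_lebesgue_integral_def
        using integrable_mult_indicator[OF compl(1) int]
        by (subst Bochner_Integration.integral_diff[symmetric, OF int])
          (auto intro!: Bochner_Integration.integral_cong simp: indicator_def)
      also have "(LINT x|lebesgue. indicator (box c d) x * h0 x) = (LINT x:box c d|lebesgue. h0 x)"
        by (simp add: set_lebesgue_integral_def)
      finally show ?case using compl(2) box_zero[OF cd] by simp
    next
      case (union A)
      have "(LINT x:(\<Union>i. A i)|lebesgue. indicator (box c d) x * h0 x) =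
          (\<Sum>i. (LINT x:A i|lebesgue. indicator (box c d) x * h0 x))"
      proof (rule lebesgue_integral_countable_add)
        show "set_integrable lebesgue (\<Union>i. A i) (\<lambda>x. indicator (box c d) x * h0 x)"
          unfolding set_integrable_def using union(2) by (intro integrable_mult_indicator int) auto
      qed (use union in \<open>auto simp: disjoint_family_on_def\<close>)
      then show ?case using union by simp
    next
      case (null A B)
      have "(LINT x:A|lebesgue. indicator (box c d) x * h0 x) = (LINT x:B|lebesgue. indicator (box c d) x * h0 x)"
        unfolding set_lebesgue_integral_def
        using null(3) integrable_mult_indicator[OF null(1) int] integrable_mult_indicator[OF null(2) int]
        by (intro integral_cong_AE borel_measurable_integrable) (auto elim!: eventually_mono)
      then show ?case using null(4) by simp
    qed
    have "AE x in lebesgue. indicator (box c d) x * h0 x = (0::real)"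
    proof (rule density_unique_real[OF int])
      fix A :: "'a set" assume "A \<in> sets lebesgue"
      then show "(LINT x:A|lebesgue. indicator (box c d) x * h0 x) = (LINT x:A|lebesgue. 0)"
        by (simp add: zero set_lebesgue_integral_def[of _ _ "\<lambda>x. 0"])
    qed simp
    moreover have "AE x in lebesgue. x \<notin> cbox c d - box c d"
      by (intro AE_not_in) (simp add: negligible_iff_null_sets[symmetric] negligible_frontier_interval)
    ultimately show ?thesis
      by eventually_elim (auto simp: indicator_def split: if_splits)
  qed
  \<comment> \<open>Countability of the cover lets the exceptional null sets of the single boxes be
    united.\<close>
  obtain D where D: "countable D" "D \<subseteq> Pow \<Omega>" "\<And>X. X \<in> D \<Longrightarrow> \<exists>a b. X = cbox a b" "\<Union>D = \<Omega>"
    using open_countable_Union_open_cbox[OF \<Omega>] by metis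
  have "AE x in lebesgue. \<forall>X\<in>D. x \<in> X \<longrightarrow> h0 x = 0"
  proof (subst AE_ball_countable[OF D(1)], safe)
    fix X assume X: "X \<in> D"
    then obtain a b where "X = cbox a b" using D(3) by blast
    with X D(2) show "AE x in lebesgue. x \<in> X \<longrightarrow> h0 x = 0" by (auto intro!: local)
  qed
  then have "AE x in lebesgue. x \<in> \<Omega> \<longrightarrow> h x = 0"
    by eventually_elim (metis D(4) Union_iff h0_def)
  then show ?thesis using \<Omega>m by (simp add: AE_restrict_space_iff)
qed


section \<open>Weak gradients: linearity and uniqueness\<close>

lemma is_weak_gradient_add:
  assumes \<Omega>: "\<Omega> \<in> sets lebesgue" "bounded \<Omega>"
    and f: "f \<in> L2 (lebesgue_on \<Omega>)" "is_weak_gradient \<Omega> f F"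
    and g: "g \<in> L2 (lebesgue_on \<Omega>)" "is_weak_gradient \<Omega> g G"
  shows "is_weak_gradient \<Omega> (f + g) (\<lambda>x. F x + G x)"
  unfolding is_weak_gradient_def
proof (intro conjI ballI)
  fix i :: 'a assume i: "i \<in> Basis"
  have FG: "(\<lambda>x. F x \<bullet> i) \<in> L2 (lebesgue_on \<Omega>)" "(\<lambda>x. G x \<bullet> i) \<in> L2 (lebesgue_on \<Omega>)"
    using f g i by (auto simp: is_weak_gradient_def)
  then show "(\<lambda>x. (F x + G x) \<bullet> i) \<in> L2 (lebesgue_on \<Omega>)"
    using L2.add_in[OF FG] by (simp add: inner_add_left plus_fun_def)
  fix \<phi> assume \<phi>: "\<phi> \<in> test_functions \<Omega>"
  have L: "\<phi> \<in> L2 (lebesgue_on \<Omega>)" "(\<lambda>x. frechet_derivative \<phi> (at x) i) \<in> L2 (lebesgue_on \<Omega>)"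
    using test_function_continuous[OF \<phi>] i by (auto intro!: continuous_in_L2 \<Omega>)
  have "(\<integral>x. f x * frechet_derivative \<phi> (at x) i \<partial>lebesgue_on \<Omega>) = - (\<integral>x. (F x \<bullet> i) * \<phi> x \<partial>lebesgue_on \<Omega>)"
    "(\<integral>x. g x * frechet_derivative \<phi> (at x) i \<partial>lebesgue_on \<Omega>) = - (\<integral>x. (G x \<bullet> i) * \<phi> x \<partial>lebesgue_on \<Omega>)"
    using f g i \<phi> by (auto simp: is_weak_gradient_def)
  then show "(\<integral>x. (f + g) x * frechet_derivative \<phi> (at x) i \<partial>lebesgue_on \<Omega>) =
      - (\<integral>x. ((F x + G x) \<bullet> i) * \<phi> x \<partial>lebesgue_on \<Omega>)"
    using L2_mult_integrable[OF f(1) L(2)] L2_mult_integrable[OF g(1) L(2)]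
      L2_mult_integrable[OF FG(1) L(1)] L2_mult_integrable[OF FG(2) L(1)]
    by (simp add: distrib_right inner_add_left)
qed

lemma is_weak_gradient_scaleR:
  assumes "is_weak_gradient \<Omega> f F"
  shows "is_weak_gradient \<Omega> (c *\<^sub>R f) (\<lambda>x. c *\<^sub>R F x)"
  unfolding is_weak_gradient_def
proof (intro conjI ballI)
  fix i :: 'a assume i: "i \<in> Basis"
  then have "(\<lambda>x. F x \<bullet> i) \<in> L2 (lebesgue_on \<Omega>)" using assms by (auto simp: is_weak_gradient_def)
  from L2.scaleR_in[OF this, of c] show "(\<lambda>x. (c *\<^sub>R F x) \<bullet> i) \<in> L2 (lebesgue_on \<Omega>)"
    by (simp add: scaleR_fun_def)
  fix \<phi> assume "\<phi> \<in> test_functions \<Omega>"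
  then have "(\<integral>x. f x * frechet_derivative \<phi> (at x) i \<partial>lebesgue_on \<Omega>) = - (\<integral>x. (F x \<bullet> i) * \<phi> x \<partial>lebesgue_on \<Omega>)"
    using assms i by (auto simp: is_weak_gradient_def)
  then show "(\<integral>x. (c *\<^sub>R f) x * frechet_derivative \<phi> (at x) i \<partial>lebesgue_on \<Omega>) =
      - (\<integral>x. ((c *\<^sub>R F x) \<bullet> i) * \<phi> x \<partial>lebesgue_on \<Omega>)"
    by (simp add: scaleR_fun_def mult.assoc)
qed

text \<open>Two gradients of \<open>f\<close> have the same integrals against every test function,
  so each component of their difference is orthogonal to all test functions. Boundedness of \<Omega>
  makes the square integrable components integrable.\<close>

lemma is_weak_gradient_unique:
  assumes \<Omega>: "open \<Omega>" "bounded \<Omega>"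
    and F: "is_weak_gradient \<Omega> f F" and G: "is_weak_gradient \<Omega> f G"
  shows "AE x in lebesgue_on \<Omega>. F x = G x"
proof -
  have \<Omega>m: "\<Omega> \<in> sets lebesgue" using \<Omega> by simp
  have fin: "finite_measure (lebesgue_on \<Omega>)"
    using \<Omega> by (intro finite_measure_lebesgue_on bounded_set_imp_lmeasurable) auto
  have "AE x in lebesgue_on \<Omega>. F x \<bullet> i - G x \<bullet> i = 0" if i: "i \<in> Basis" for i
  proof (rule AE_zero_if_orthogonal_to_test_functions[OF \<Omega>(1)])
    have FG: "(\<lambda>x. F x \<bullet> i) \<in> L2 (lebesgue_on \<Omega>)" "(\<lambda>x. G x \<bullet> i) \<in> L2 (lebesgue_on \<Omega>)"
      using F G i by (auto simp: is_weak_gradient_def)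
    then show "integrable (lebesgue_on \<Omega>) (\<lambda>x. F x \<bullet> i - G x \<bullet> i)"
      by (intro Bochner_Integration.integrable_diff L2_integrable fin)
    fix \<phi> assume \<phi>: "\<phi> \<in> test_functions \<Omega>"
    have L: "\<phi> \<in> L2 (lebesgue_on \<Omega>)"
      using test_function_continuous[OF \<phi>] by (intro continuous_in_L2 \<Omega>m \<Omega>(2))
    have "(\<integral>x. (F x \<bullet> i) * \<phi> x \<partial>lebesgue_on \<Omega>) = (\<integral>x. (G x \<bullet> i) * \<phi> x \<partial>lebesgue_on \<Omega>)"
      using F G i \<phi> by (auto simp: is_weak_gradient_def)
    then show "(\<integral>x. (F x \<bullet> i - G x \<bullet> i) * \<phi> x \<partial>lebesgue_on \<Omega>) = 0"
      using L2_mult_integrable[OF FG(1) L] L2_mult_integrable[OF FG(2) L]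
      by (simp add: left_diff_distrib)
  qed
  then have "AE x in lebesgue_on \<Omega>. \<forall>i\<in>Basis. F x \<bullet> i - G x \<bullet> i = 0"
    by (intro AE_finite_allI) auto
  then show ?thesis by eventually_elim (auto intro: euclidean_eqI)
qed

lemma is_weak_gradient_weak_gradient: "f \<in> H1 \<Omega> \<Longrightarrow> is_weak_gradient \<Omega> f (weak_gradient \<Omega> f)"
  unfolding H1_def weak_gradient_def by (auto intro: someI[of "is_weak_gradient \<Omega> f"])

lemma dirichlet_integrable:
  assumes "u \<in> H1 \<Omega>" "v \<in> H1 \<Omega>"
  shows "integrable (lebesgue_on \<Omega>) (\<lambda>x. weak_gradient \<Omega> u x \<bullet> weak_gradient \<Omega> v x)"
proof -
  have "integrable (lebesgue_on \<Omega>) (\<lambda>x. (weak_gradient \<Omega> u x \<bullet> i) * (weak_gradient \<Omega> v x \<bullet> i))"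
    if "i \<in> Basis" for i
    using is_weak_gradient_weak_gradient[OF assms(1)] is_weak_gradient_weak_gradient[OF assms(2)] that
    by (intro L2_mult_integrable) (auto simp: is_weak_gradient_def)
  then show ?thesis by (subst euclidean_inner) auto
qed

lemma H1_subspace:
  assumes "\<Omega> \<in> sets lebesgue" "bounded \<Omega>" shows "vector_subspace (H1 \<Omega>)"
proof
  show "0 \<in> H1 \<Omega>"
    unfolding H1_def by (auto simp: is_weak_gradient_def L2.zero_in[unfolded zero_fun_def]
        intro!: L2.zero_in exI[of _ "\<lambda>x. 0"])
  show "u + v \<in> H1 \<Omega>" if "u \<in> H1 \<Omega>" "v \<in> H1 \<Omega>" for u v
    using that is_weak_gradient_add[OF assms] unfolding H1_def by (blast intro: L2.add_in)
  show "c *\<^sub>R v \<in> H1 \<Omega>" if "v \<in> H1 \<Omega>" for c v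
    using that is_weak_gradient_scaleR unfolding H1_def by (blast intro: L2.scaleR_in)
qed

text \<open>\<open>weak_gradient\<close> chooses a gradient for each function separately, so it is
  additive and homogeneous only almost everywhere, by uniqueness. Under the integral this is enough
  for a bilinear form.\<close>

lemma dirichlet_semi_inner:
  assumes \<Omega>: "open \<Omega>" "bounded \<Omega>"
  shows "semi_inner_space (H1 \<Omega>) (dirichlet_form \<Omega>)"
proof -
  have \<Omega>m: "\<Omega> \<in> sets lebesgue" using \<Omega> by simp
  interpret vector_subspace "H1 \<Omega>" by (rule H1_subspace[OF \<Omega>m \<Omega>(2)])
  show ?thesis
  proof
    fix u v w :: "'a \<Rightarrow> real" and c :: real
    show "0 \<le> dirichlet_form \<Omega> v v" by (simp add: dirichlet_form_def)
    show "dirichlet_form \<Omega> u v = dirichlet_form \<Omega> v u" by (simp add: dirichlet_form_def inner_commute)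
    assume u: "u \<in> H1 \<Omega>" and w: "w \<in> H1 \<Omega>"
    have "AE x in lebesgue_on \<Omega>. weak_gradient \<Omega> (c *\<^sub>R u) x = c *\<^sub>R weak_gradient \<Omega> u x"
      using u scaleR_in[OF u]
      by (intro is_weak_gradient_unique[OF \<Omega>, of "c *\<^sub>R u"] is_weak_gradient_scaleR is_weak_gradient_weak_gradient)
    then have "dirichlet_form \<Omega> (c *\<^sub>R u) w =
        (\<integral>x. c * (weak_gradient \<Omega> u x \<bullet> weak_gradient \<Omega> w x) \<partial>lebesgue_on \<Omega>)"
      unfolding dirichlet_form_def
      using dirichlet_integrable[OF scaleR_in[OF u] w] dirichlet_integrable[OF u w]
      by (intro integral_cong_AE borel_measurable_integrable) auto
    then show "dirichlet_form \<Omega> (c *\<^sub>R u) w = c * dirichlet_form \<Omega> u w"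
      by (simp add: dirichlet_form_def)
    assume v: "v \<in> H1 \<Omega>"
    have "AE x in lebesgue_on \<Omega>. weak_gradient \<Omega> (u + v) x = weak_gradient \<Omega> u x + weak_gradient \<Omega> v x"
      using u v add_in[OF u v]
      by (intro is_weak_gradient_unique[OF \<Omega>, of "u + v"] is_weak_gradient_add[OF \<Omega>m \<Omega>(2)] is_weak_gradient_weak_gradient)
        (auto simp: H1_def)
    then have "dirichlet_form \<Omega> (u + v) w =
        (\<integral>x. weak_gradient \<Omega> u x \<bullet> weak_gradient \<Omega> w x + weak_gradient \<Omega> v x \<bullet> weak_gradient \<Omega> w x \<partial>lebesgue_on \<Omega>)"
      unfolding dirichlet_form_def
      using dirichlet_integrable[OF add_in[OF u v] w] dirichlet_integrable[OF u w] dirichlet_integrable[OF v w]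
      by (intro integral_cong_AE borel_measurable_integrable) (auto simp: inner_add_left elim!: eventually_mono)
    then show "dirichlet_form \<Omega> (u + v) w = dirichlet_form \<Omega> u w + dirichlet_form \<Omega> v w"
      using dirichlet_integrable[OF u w] dirichlet_integrable[OF v w] by (simp add: dirichlet_form_def)
  qed
qed

text \<open>The polarisation of the square of \<open>H1_norm\<close>; it yields the triangle
  inequality for that norm through Cauchy-Schwarz.\<close>

definition H1_inner :: "'a::euclidean_space set \<Rightarrow> ('a \<Rightarrow> real) \<Rightarrow> ('a \<Rightarrow> real) \<Rightarrow> real" where
  "H1_inner \<Omega> u v = L2_inner (lebesgue_on \<Omega>) u v + dirichlet_form \<Omega> u v"

lemma H1_norm_eq: "H1_norm \<Omega> = (\<lambda>v. sqrt (H1_inner \<Omega> v v))"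
  by (simp add: fun_eq_iff H1_norm_def H1_inner_def)

lemma H1_semi_inner:
  assumes \<Omega>: "open \<Omega>" "bounded \<Omega>"
  shows "semi_inner_space (H1 \<Omega>) (H1_inner \<Omega>)"
proof -
  interpret D: semi_inner_space "H1 \<Omega>" "dirichlet_form \<Omega>" by (rule dirichlet_semi_inner[OF \<Omega>])
  show ?thesis
    by standard
      (auto simp: H1_inner_def H1_def D.sym D.ip_add_left D.ip_scaleR_left D.nonneg L2.sym
        L2.ip_add_left L2.ip_scaleR_left L2.nonneg distrib_left intro!: add_nonneg_nonneg
        D.nonneg D.sym D.ip_add_left D.ip_scaleR_left)
qed

lemma L2_norm_le_H1_norm: "L2_norm (lebesgue_on \<Omega>) v \<le> H1_norm \<Omega> v"
  unfolding L2_norm_def H1_norm_def by (simp add: dirichlet_form_def)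


subsection \<open>Traces\<close>

lemma L2_restrict_space:
  assumes f: "f \<in> L2 M" and A: "A \<in> sets M"
  shows "f \<in> L2 (restrict_space M A)" "L2_norm (restrict_space M A) f \<le> L2_norm M f"
proof -
  have int: "integrable M (\<lambda>x. indicator A x * (f x)\<^sup>2)"
    using integrable_mult_indicator[OF A, of "\<lambda>x. (f x)\<^sup>2"] f by (simp add: L2_def)
  then have "integrable (restrict_space M A) (\<lambda>x. (f x)\<^sup>2)"
    using A by (subst integrable_restrict_space) auto
  then show "f \<in> L2 (restrict_space M A)"
    using f by (auto simp: L2_def measurable_restrict_space1)
  have "(\<integral>x. f x * f x \<partial>restrict_space M A) = (\<integral>x. indicator A x * (f x)\<^sup>2 \<partial>M)"
    using A by (subst integral_restrict_space) (auto simp: power2_eq_square)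
  also have "\<dots> \<le> (\<integral>x. (f x)\<^sup>2 \<partial>M)"
    using int f by (intro integral_mono) (auto simp: L2_def indicator_def)
  finally show "L2_norm (restrict_space M A) f \<le> L2_norm M f"
    by (simp add: L2_norm_def L2_inner_def power2_eq_square)
qed

lemma sets_surface_measure [simp]: "sets surface_measure = sets borel"
  unfolding surface_measure_def by (simp add: sets.sigma_sets_eq[of borel, simplified])

lemma space_surface_measure [simp]: "space surface_measure = UNIV"
  unfolding surface_measure_def by (simp add: space_measure_of_conv)

text \<open>Formulated for one part \<Gamma> of the boundary because it is instantiated twice: with
  \<open>\<Gamma>1\<close> for the space \<open>V0\<close>, and with \<open>\<Gamma>2\<close> for
  the traces in the boundary term.\<close>

locale lipschitz_trace =
  fixes \<Omega> :: "'a::euclidean_space set" and tr and \<Gamma> :: "'a set"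
  assumes \<Omega>_open: "open \<Omega>" and \<Omega>_bounded: "bounded \<Omega>" and trace: "trace_operator \<Omega> tr"
    and \<Gamma>_borel: "\<Gamma> \<in> sets borel" and \<Gamma>_subset: "\<Gamma> \<subseteq> frontier \<Omega>"
begin

sublocale H1: semi_inner_space "H1 \<Omega>" "H1_inner \<Omega>"
  by (rule H1_semi_inner[OF \<Omega>_open \<Omega>_bounded])

lemma surface_on_restrict: "surface_on \<Gamma> = restrict_space (surface_on (frontier \<Omega>)) \<Gamma>"
  using \<Gamma>_borel \<Gamma>_subset by (subst restrict_restrict_space) (auto simp: Int_absorb1)

lemma \<Gamma>_sets: "\<Gamma> \<in> sets (surface_on (frontier \<Omega>))"
  using \<Gamma>_borel \<Gamma>_subset by (auto simp: sets_restrict_space)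

lemma AE_surface_on:
  assumes "AE x in surface_on (frontier \<Omega>). P x" shows "AE x in surface_on \<Gamma>. P x"
  unfolding surface_on_restrict using assms \<Gamma>_sets \<Gamma>_subset
  by (subst AE_restrict_space_iff) (auto simp: space_restrict_space Int_absorb2 elim!: eventually_mono)

lemma trace_in_L2: "v \<in> H1 \<Omega> \<Longrightarrow> tr v \<in> L2 (surface_on \<Gamma>)"
  using trace L2_restrict_space(1)[OF _ \<Gamma>_sets] unfolding surface_on_restrict
  by (auto simp: trace_operator_def)

lemma trace_add: "v \<in> H1 \<Omega> \<Longrightarrow> w \<in> H1 \<Omega> \<Longrightarrow> AE x in surface_on \<Gamma>. tr (v + w) x = tr v x + tr w x"
  using trace by (intro AE_surface_on) (auto simp: trace_operator_def)

lemma trace_scaleR: "v \<in> H1 \<Omega> \<Longrightarrow> AE x in surface_on \<Gamma>. tr (c *\<^sub>R v) x = c * tr v x"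
  using trace by (intro AE_surface_on) (auto simp: trace_operator_def)

lemma trace_diff:
  assumes "v \<in> H1 \<Omega>" "w \<in> H1 \<Omega>"
  shows "AE x in surface_on \<Gamma>. tr (v - w) x = tr v x - tr w x"
  using trace_add[OF H1.diff_in[OF assms] assms(2)] by eventually_elim simp

lemma trace_bounded: "\<exists>K. \<forall>v\<in>H1 \<Omega>. L2_norm (surface_on \<Gamma>) (tr v) \<le> K * H1_norm \<Omega> v"
proof -
  obtain K where K: "\<And>v. v \<in> H1 \<Omega> \<Longrightarrow> L2_norm (surface_on (frontier \<Omega>)) (tr v) \<le> K * H1_norm \<Omega> v"
    using trace unfolding trace_operator_def by blast
  have "L2_norm (surface_on \<Gamma>) (tr v) \<le> K * H1_norm \<Omega> v" if "v \<in> H1 \<Omega>" for v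
  proof -
    have "tr v \<in> L2 (surface_on (frontier \<Omega>))" using trace that by (auto simp: trace_operator_def)
    from L2_restrict_space(2)[OF this \<Gamma>_sets] K[OF that] show ?thesis
      unfolding surface_on_restrict by linarith
  qed
  then show ?thesis by blast
qed

text \<open>As \<open>tr v - tr w\<close> equals \<open>tr (v - w)\<close> almost everywhere, the
  bound of the trace operator is also a Lipschitz bound, which is what
  \<open>L2_time_compose\<close> asks for.\<close>

lemma L2_time_trace:
  assumes V: "V \<subseteq> H1 \<Omega>" "seminormed_space V (H1_norm \<Omega>)"
    and u: "u \<in> L2_time T V (H1_norm \<Omega>)"
  shows "(\<lambda>t. tr (u t)) \<in> L2L2 T (surface_on \<Gamma>)"
proof -
  obtain K where K: "\<And>v. v \<in> H1 \<Omega> \<Longrightarrow> L2_norm (surface_on \<Gamma>) (tr v) \<le> K * H1_norm \<Omega> v"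
    using trace_bounded by blast
  interpret V: seminormed_space V "H1_norm \<Omega>" by (rule V)
  show ?thesis
    unfolding L2L2_def
  proof (rule V.L2_time_compose[OF L2_normed.seminormed_space_axioms u])
    show "tr v \<in> L2 (surface_on \<Gamma>)" if "v \<in> V" for v using that V trace_in_L2 by blast
    show "L2_norm (surface_on \<Gamma>) (tr v) \<le> K * H1_norm \<Omega> v" if "v \<in> V" for v using that V K by blast
    show "L2_norm (surface_on \<Gamma>) (tr v - tr w) \<le> K * H1_norm \<Omega> (v - w)" if "v \<in> V" "w \<in> V" for v w
    proof -
      have vw: "v \<in> H1 \<Omega>" "w \<in> H1 \<Omega>" using that V by auto
      have "AE x in surface_on \<Gamma>. (tr v - tr w) x = tr (v - w) x"
        using trace_diff[OF vw] by eventually_elim simp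
      then have "L2_norm (surface_on \<Gamma>) (tr v - tr w) = L2_norm (surface_on \<Gamma>) (tr (v - w))"
        unfolding L2_norm_def using vw
        by (intro arg_cong[where f = sqrt] L2_inner_cong_AE L2.diff_in trace_in_L2 H1.diff_in)
      then show ?thesis using K[OF H1.diff_in[OF vw]] by simp
    qed
  qed
qed

lemma V0_subset_H1: "V0 \<Omega> tr \<Gamma> \<subseteq> H1 \<Omega>"
  by (auto simp: V0_def)

lemma V0_semi_inner: "semi_inner_space (V0 \<Omega> tr \<Gamma>) (H1_inner \<Omega>)"
proof
  \<comment> \<open>The trace of the zero function vanishes almost everywhere by homogeneity with
    factor 0.\<close>
  have "AE x in surface_on \<Gamma>. tr (0 *\<^sub>R 0) x = 0" using trace_scaleR[OF H1.zero_in, of 0] by simp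
  then show "0 \<in> V0 \<Omega> tr \<Gamma>" by (simp add: V0_def H1.zero_in)
  show "u + v \<in> V0 \<Omega> tr \<Gamma>" if "u \<in> V0 \<Omega> tr \<Gamma>" "v \<in> V0 \<Omega> tr \<Gamma>" for u v
  proof -
    have uv: "u \<in> H1 \<Omega>" "v \<in> H1 \<Omega>" and 0: "AE x in surface_on \<Gamma>. tr u x = 0" "AE x in surface_on \<Gamma>. tr v x = 0"
      using that by (auto simp: V0_def)
    have "AE x in surface_on \<Gamma>. tr (u + v) x = 0"
      using trace_add[OF uv] 0 by eventually_elim simp
    then show ?thesis using H1.add_in[OF uv] by (simp add: V0_def)
  qed
  show "c *\<^sub>R v \<in> V0 \<Omega> tr \<Gamma>" if "v \<in> V0 \<Omega> tr \<Gamma>" for c v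
  proof -
    have v: "v \<in> H1 \<Omega>" and 0: "AE x in surface_on \<Gamma>. tr v x = 0"
      using that by (auto simp: V0_def)
    have "AE x in surface_on \<Gamma>. tr (c *\<^sub>R v) x = 0"
      using trace_scaleR[OF v, of c] 0 by eventually_elim simp
    then show ?thesis using H1.scaleR_in[OF v] by (simp add: V0_def)
  qed
qed (use V0_subset_H1 in \<open>auto intro: H1.sym H1.ip_add_left H1.ip_scaleR_left H1.nonneg\<close>)

lemma V0_seminormed: "seminormed_space (V0 \<Omega> tr \<Gamma>) (H1_norm \<Omega>)"
  unfolding H1_norm_eq by (rule semi_inner_space.seminormed[OF V0_semi_inner])

end


subsection \<open>Dual spaces\<close>

context seminormed_space
begin

lemma dual_norm_le:
  assumes "\<And>v. v \<in> X \<Longrightarrow> N v \<le> 1 \<Longrightarrow> \<bar>F v\<bar> \<le> b"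
  shows "dual_norm X N F \<le> b"
  unfolding dual_norm_def
proof (rule cSup_least)
  show "{\<bar>F v\<bar> | v. v \<in> X \<and> N v \<le> 1} \<noteq> {}" using zero_in by (auto intro!: exI[of _ 0])
qed (use assms in auto)

text \<open>A real supremum is an upper bound only for a bounded set. The bound used is |K|, since
  the constant \<open>K\<close> in \<open>dual_space\<close> may be negative.\<close>

lemma dual_norm_upper:
  assumes F: "F \<in> dual_space X N" and v: "v \<in> X" "N v \<le> 1"
  shows "\<bar>F v\<bar> \<le> dual_norm X N F"
  unfolding dual_norm_def
proof (rule cSup_upper)
  obtain K where K: "\<And>v. v \<in> X \<Longrightarrow> \<bar>F v\<bar> \<le> K * N v"
    using F unfolding dual_space_def by blast
  show "bdd_above {\<bar>F v\<bar> | v. v \<in> X \<and> N v \<le> 1}"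
  proof (rule bdd_aboveI[of _ "\<bar>K\<bar>"], clarify)
    fix v assume v: "v \<in> X" "N v \<le> 1"
    have "K * N v \<le> \<bar>K\<bar> * 1"
      using v seminorm_nonneg[OF v(1)] by (intro mult_mono) auto
    then show "\<bar>F v\<bar> \<le> \<bar>K\<bar>" using K[OF v(1)] by simp
  qed
qed (use v in auto)

text \<open>Normalising \<open>v\<close> is impossible when N v = 0; in that case F v = 0 by the
  boundedness of the functional.\<close>

lemma dual_norm_bound:
  assumes F: "F \<in> dual_space X N" and v: "v \<in> X"
  shows "\<bar>F v\<bar> \<le> dual_norm X N F * N v"
proof (cases "N v = 0")
  case True
  obtain K where "\<bar>F v\<bar> \<le> K * N v"
    using F v unfolding dual_space_def by blast
  then show ?thesis using True by simp
next
  case False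
  then have pos: "N v > 0" using seminorm_nonneg[OF v] by simp
  define w where "w = inverse (N v) *\<^sub>R v"
  have "w \<in> X" "N w = 1" using v pos by (auto simp: w_def scaleR_in homogeneous)
  then have "\<bar>F w\<bar> \<le> dual_norm X N F" by (intro dual_norm_upper F) auto
  moreover have "F w = inverse (N v) * F v"
    using F v by (simp add: w_def dual_space_def)
  ultimately show ?thesis using pos by (simp add: abs_mult field_simps)
qed

lemma dual_norm_nonneg:
  assumes "F \<in> dual_space X N" shows "0 \<le> dual_norm X N F"
  using dual_norm_upper[OF assms zero_in] by simp

lemma dual_space_add: "F \<in> dual_space X N \<Longrightarrow> G \<in> dual_space X N \<Longrightarrow> F + G \<in> dual_space X N"
proof -
  assume F: "F \<in> dual_space X N" and G: "G \<in> dual_space X N"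
  have "\<bar>F v + G v\<bar> \<le> (dual_norm X N F + dual_norm X N G) * N v" if "v \<in> X" for v
    using dual_norm_bound[OF F that] dual_norm_bound[OF G that] by (simp add: distrib_right)
  then have "\<exists>K. \<forall>v\<in>X. \<bar>F v + G v\<bar> \<le> K * N v" by blast
  then show ?thesis
    using F G unfolding dual_space_def by (simp add: distrib_left)
qed

lemma dual_space_scaleR: "F \<in> dual_space X N \<Longrightarrow> c *\<^sub>R F \<in> dual_space X N"
proof -
  assume F: "F \<in> dual_space X N"
  have "\<bar>c * F v\<bar> \<le> (\<bar>c\<bar> * dual_norm X N F) * N v" if "v \<in> X" for v
    using mult_left_mono[OF dual_norm_bound[OF F that], of "\<bar>c\<bar>"] by (simp add: abs_mult mult.assoc)
  then have "\<exists>K. \<forall>v\<in>X. \<bar>c * F v\<bar> \<le> K * N v" by blast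
  then show ?thesis
    using F unfolding dual_space_def by (simp add: distrib_left scaleR_fun_def)
qed

lemma dual_norm_scaleR_le:
  assumes F: "F \<in> dual_space X N" shows "dual_norm X N (c *\<^sub>R F) \<le> \<bar>c\<bar> * dual_norm X N F"
proof (rule dual_norm_le)
  fix v assume v: "v \<in> X" "N v \<le> 1"
  have "\<bar>F v\<bar> \<le> dual_norm X N F * 1"
    using dual_norm_bound[OF F v(1)] mult_left_mono[OF v(2) dual_norm_nonneg[OF F]] by linarith
  then show "\<bar>(c *\<^sub>R F) v\<bar> \<le> \<bar>c\<bar> * dual_norm X N F"
    by (simp add: scaleR_fun_def abs_mult mult_left_mono)
qed

text \<open>Functionals are functions on the whole type, while \<open>dual_norm\<close> sees only
  their values on \<open>X\<close>; hence again only a seminorm.\<close>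

lemma dual_seminormed: "seminormed_space (dual_space X N) (dual_norm X N)"
proof
  show "0 \<in> dual_space X N" by (auto simp: dual_space_def intro!: exI[of _ 0])
  fix F G c assume F: "F \<in> dual_space X N"
  show "c *\<^sub>R F \<in> dual_space X N" by (rule dual_space_scaleR[OF F])
  show "dual_norm X N (c *\<^sub>R F) = \<bar>c\<bar> * dual_norm X N F"
  proof (cases "c = 0")
    case True
    then show ?thesis
      using dual_norm_scaleR_le[OF F, of 0] dual_norm_nonneg[OF dual_space_scaleR[OF F, of 0]] by simp
  next
    case False
    \<comment> \<open>The upper estimate for the factor 1/c is the lower estimate for the factor
      c.\<close>
    have "dual_norm X N (inverse c *\<^sub>R c *\<^sub>R F) \<le> \<bar>inverse c\<bar> * dual_norm X N (c *\<^sub>R F)"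
      by (rule dual_norm_scaleR_le[OF dual_space_scaleR[OF F]])
    then have "\<bar>c\<bar> * dual_norm X N F \<le> dual_norm X N (c *\<^sub>R F)"
      using False by (simp add: field_simps)
    then show ?thesis using dual_norm_scaleR_le[OF F, of c] by simp
  qed
  assume G: "G \<in> dual_space X N"
  show "F + G \<in> dual_space X N" by (rule dual_space_add[OF F G])
  show "dual_norm X N (F + G) \<le> dual_norm X N F + dual_norm X N G"
  proof (rule dual_norm_le)
    fix v assume v: "v \<in> X" "N v \<le> 1"
    have "\<bar>F v\<bar> \<le> dual_norm X N F * 1" "\<bar>G v\<bar> \<le> dual_norm X N G * 1"
      using dual_norm_bound[OF F v(1)] mult_left_mono[OF v(2) dual_norm_nonneg[OF F]]
        dual_norm_bound[OF G v(1)] mult_left_mono[OF v(2) dual_norm_nonneg[OF G]] by linarith+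
    then show "\<bar>(F + G) v\<bar> \<le> dual_norm X N F + dual_norm X N G" by simp
  qed
qed

lemma dual_pairing:
  "seminormed_pairing (dual_space X N) (dual_norm X N) X N (\<lambda>F v. F v)"
proof -
  interpret D: seminormed_space "dual_space X N" "dual_norm X N" by (rule dual_seminormed)
  show ?thesis
    by standard (auto simp: scaleR_fun_def intro: dual_norm_bound, auto simp: dual_space_def)
qed

end


subsection \<open>Primitives and difference quotients in time\<close>

text \<open>In effect \<open>f\<close> is extended by zero off (0, T): the primitive is 0 to the
  left of 0 and constant to the right of T, so difference quotients near the endpoints need no case
  distinction.\<close>

definition primitive :: "real \<Rightarrow> (real \<Rightarrow> real) \<Rightarrow> real \<Rightarrow> real" where
  "primitive T f t = (\<integral>r. indicator {..t} r * f r \<partial>time T)"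

text \<open>The step may have either sign; a negative step gives the backward quotient needed for
  the integration by parts.\<close>

definition diff_quot :: "(real \<Rightarrow> real) \<Rightarrow> real \<Rightarrow> real \<Rightarrow> real" where
  "diff_quot G h t = (G (t + h) - G t) / h"

lemma finite_measure_time: "finite_measure (time T)"
  by (intro finite_measure_lebesgue_on) simp

lemma indicator_measurable_time [measurable]:
  assumes "A \<in> sets lebesgue" shows "(indicator A :: real \<Rightarrow> real) \<in> borel_measurable (time T)"
  using assms by (intro measurable_restrict_space1 borel_measurable_indicator)

lemma indicator_integrable_time:
  fixes f :: "real \<Rightarrow> real"
  assumes f: "integrable (time T) f" and A: "A \<in> sets lebesgue"
  shows "integrable (time T) (\<lambda>r. indicator A r * f r)"
proof (rule Bochner_Integration.integrable_bound[OF f])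
  show "(\<lambda>r. indicator A r * f r) \<in> borel_measurable (time T)"
    by (rule borel_measurable_times[OF indicator_measurable_time[OF A] borel_measurable_integrable[OF f]])
qed (auto simp: indicator_def)

lemma continuous_integrable_time:
  fixes f :: "real \<Rightarrow> real"
  assumes "continuous_on UNIV f" shows "integrable (time T) f"
  by (intro L2_integrable finite_measure_time continuous_in_L2 assms) auto

lemma AE_time_space: "AE t in time T. 0 < t \<and> t < T"
  by (rule AE_I2) simp

lemma continuous_mult_integrable_time:
  fixes f g :: "real \<Rightarrow> real"
  assumes g: "continuous_on UNIV g" and f: "integrable (time T) f"
  shows "integrable (time T) (\<lambda>t. g t * f t)"
proof -
  obtain B where B: "\<And>t. t \<in> {0..T} \<Longrightarrow> \<bar>g t\<bar> \<le> B"
    using compact_imp_bounded[OF compact_continuous_image[OF continuous_on_subset[OF g] compact_Icc[of 0 T]]]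
    by (force simp: bounded_iff)
  show ?thesis
  proof (rule Bochner_Integration.integrable_bound)
    show "integrable (time T) (\<lambda>t. B * f t)" using f by simp
    show "(\<lambda>t. g t * f t) \<in> borel_measurable (time T)"
      using continuous_integrable_time[OF g] f by (intro borel_measurable_times borel_measurable_integrable)
    show "AE t in time T. norm (g t * f t) \<le> norm (B * f t)"
      using AE_time_space
    proof eventually_elim
      case (elim t)
      then show ?case using B[of t] by (auto simp: abs_mult intro!: mult_right_mono)
    qed
  qed
qed

lemma AE_time_neq: "AE t in time T. t \<noteq> x"
proof -
  have "AE t in lebesgue. t \<notin> {x}" by (intro AE_not_in) (simp add: negligible_iff_null_sets[symmetric])
  then show ?thesis by (simp add: AE_restrict_space_iff) (auto elim!: eventually_mono)
qed

lemma primitive_linear: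
  assumes "integrable (time T) f" "integrable (time T) g"
  shows "primitive T (\<lambda>r. a * f r + b * g r) t = a * primitive T f t + b * primitive T g t"
proof -
  have "integrable (time T) (\<lambda>r. indicator {..t} r * f r)" "integrable (time T) (\<lambda>r. indicator {..t} r * g r)"
    using assms by (auto intro!: indicator_integrable_time)
  then show ?thesis by (simp add: primitive_def distrib_left mult.left_commute)
qed

lemma primitive_diff:
  assumes f: "integrable (time T) f" and st: "s \<le> t"
  shows "primitive T f t - primitive T f s = (\<integral>r. indicator {s<..t} r * f r \<partial>time T)"
proof -
  have "integrable (time T) (\<lambda>r. indicator {..t} r * f r)" "integrable (time T) (\<lambda>r. indicator {..s} r * f r)"
    using f by (auto intro!: indicator_integrable_time)
  then have "primitive T f t - primitive T f s =
      (\<integral>r. indicator {..t} r * f r - indicator {..s} r * f r \<partial>time T)"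
    by (simp add: primitive_def)
  also have "\<dots> = (\<integral>r. indicator {s<..t} r * f r \<partial>time T)"
    using st by (intro Bochner_Integration.integral_cong) (auto simp: indicator_def)
  finally show ?thesis .
qed

lemma primitive_diff_mono:
  assumes f: "integrable (time T) f" and g: "integrable (time T) g"
    and le: "AE r in time T. f r \<le> g r" and st: "s \<le> t"
  shows "primitive T f t - primitive T f s \<le> primitive T g t - primitive T g s"
  unfolding primitive_diff[OF f st] primitive_diff[OF g st]
proof (rule integral_mono_AE)
  show "AE r in time T. indicator {s<..t} r * f r \<le> indicator {s<..t} r * g r"
    using le by eventually_elim (auto simp: indicator_def)
qed (auto intro!: indicator_integrable_time f g)

lemma primitive_nonpos: "t \<le> 0 \<Longrightarrow> primitive T f t = 0"
  unfolding primitive_def by (rule integral_eq_zero_AE) (auto intro!: AE_I2 simp: indicator_def)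

lemma primitive_ge: "t \<ge> T \<Longrightarrow> primitive T f t = (\<integral>r. f r \<partial>time T)"
  unfolding primitive_def by (intro Bochner_Integration.integral_cong) (auto simp: indicator_def)

lemma primitive_bounds:
  assumes f: "integrable (time T) f" and nonneg: "AE r in time T. 0 \<le> f r"
  shows "0 \<le> primitive T f t" "primitive T f t \<le> (\<integral>r. f r \<partial>time T)"
proof -
  show "0 \<le> primitive T f t"
    unfolding primitive_def using nonneg
    by (intro integral_nonneg_AE) (auto simp: indicator_def elim!: eventually_mono)
  show "primitive T f t \<le> (\<integral>r. f r \<partial>time T)"
    unfolding primitive_def
  proof (rule integral_mono_AE)
    show "AE r in time T. indicator {..t} r * f r \<le> f r"
      using nonneg by eventually_elim (auto simp: indicator_def)
  qed (auto intro!: indicator_integrable_time f)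
qed

text \<open>Dominated convergence with majorant |f|; the indicators converge except possibly at the
  single time r = a.\<close>

lemma primitive_continuous:
  assumes f: "integrable (time T) f"
  shows "continuous_on UNIV (primitive T f)"
  unfolding continuous_on_sequentially
proof (intro allI ballI impI, elim conjE)
  fix x :: "nat \<Rightarrow> real" and a assume x: "x \<longlonglongrightarrow> a"
  have "(\<lambda>n. \<integral>r. indicator {..x n} r * f r \<partial>time T) \<longlonglongrightarrow> (\<integral>r. indicator {..a} r * f r \<partial>time T)"
  proof (rule integral_dominated_convergence)
    show "integrable (time T) (\<lambda>r. \<bar>f r\<bar>)" using f by simp
    show "AE r in time T. (\<lambda>n. indicator {..x n} r * f r) \<longlonglongrightarrow> indicator {..a} r * f r"
      using AE_time_neq[of a T]
    proof eventually_elim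
      case (elim r)
      have "eventually (\<lambda>n. indicator {..x n} r * f r = indicator {..a} r * f r) sequentially"
      proof (cases "r < a")
        case True
        from order_tendstoD(1)[OF x this] show ?thesis
          by eventually_elim (use True in \<open>auto simp: indicator_def\<close>)
      next
        case False
        then have "a < r" using elim by simp
        from order_tendstoD(2)[OF x this] show ?thesis
          by eventually_elim (use \<open>a < r\<close> in \<open>auto simp: indicator_def\<close>)
      qed
      then show ?case by (rule tendsto_eventually)
    qed
    show "AE r in time T. norm (indicator {..x n} r * f r) \<le> \<bar>f r\<bar>" for n
      by (intro AE_I2) (auto simp: indicator_def)
  qed (auto intro!: borel_measurable_integrable[OF indicator_integrable_time[OF f]])
  then show "(primitive T f \<circ> x) \<longlonglongrightarrow> primitive T f a" by (simp add: primitive_def o_def)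
qed

text \<open>An inequality only, because part of the interval from \<open>s\<close> to
  \<open>t\<close> may lie outside (0, T), where nothing is accumulated.\<close>

lemma primitive_const_diff:
  assumes "s \<le> t" "0 \<le> c"
  shows "primitive T (\<lambda>r. c) t - primitive T (\<lambda>r. c) s \<le> c * (t - s)"
proof -
  have int: "integrable (time T) (\<lambda>r. c)" by (rule finite_measure.integrable_const[OF finite_measure_time])
  have "(\<integral>r. indicator {s<..t} r * c \<partial>time T) = (\<integral>r. indicator ({0<..<T} \<inter> {s<..t}) r * c \<partial>lebesgue)"
    by (subst integral_restrict_space) (auto simp: indicator_inter_arith mult.assoc)
  also have "\<dots> \<le> (\<integral>r. indicator {s<..t} r * c \<partial>lebesgue)"
  proof (intro integral_mono integrable_mult_left integrable_real_indicator)
    have "emeasure lebesgue ({0<..<T} \<inter> {s<..t}) \<le> emeasure lebesgue {s<..t}" by (intro emeasure_mono) auto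
    then show "emeasure lebesgue ({0<..<T} \<inter> {s<..t}) < \<infinity>"
      using assms by (simp add: ennreal_less_top order.strict_trans1)
  qed (use assms in \<open>auto simp: indicator_def\<close>)
  also have "\<dots> = c * (t - s)" using assms by simp
  finally show ?thesis by (simp add: primitive_diff[OF int assms(1)])
qed

lemma diff_quot_uminus: "diff_quot G h t = (G t - G (t + h)) / (- h)"
  by (simp add: diff_quot_def minus_divide_left)

lemma diff_quot_primitive_mono:
  assumes "integrable (time T) f" "integrable (time T) g" "AE r in time T. f r \<le> g r" "h \<noteq> 0"
  shows "diff_quot (primitive T f) h t \<le> diff_quot (primitive T g) h t"
proof (cases "h > 0")
  case True
  then show ?thesis
    unfolding diff_quot_def using primitive_diff_mono[OF assms(1-3), of t "t + h"] by (simp add: divide_right_mono)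
next
  case False
  then show ?thesis
    unfolding diff_quot_uminus using assms(4) primitive_diff_mono[OF assms(1-3), of "t + h" t]
    by (intro divide_right_mono) auto
qed

lemma diff_quot_primitive_linear:
  assumes "integrable (time T) f" "integrable (time T) g"
  shows "diff_quot (primitive T (\<lambda>r. a * f r + b * g r)) h t =
    a * diff_quot (primitive T f) h t + b * diff_quot (primitive T g) h t"
  by (simp add: diff_quot_def primitive_linear[OF assms] add_divide_distrib[symmetric] diff_divide_distrib[symmetric] algebra_simps)

lemma diff_quot_primitive_const:
  assumes "h \<noteq> 0" "0 \<le> c" shows "diff_quot (primitive T (\<lambda>r. c)) h t \<le> c"
proof (cases "h > 0")
  case True
  then show ?thesis
    unfolding diff_quot_def using primitive_const_diff[of t "t + h" c T] assms by (simp add: pos_divide_le_eq)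
next
  case False
  then have "h < 0" using assms by simp
  then show ?thesis
    unfolding diff_quot_def using primitive_const_diff[of "t + h" t c T] assms by (simp add: neg_divide_le_eq)
qed

text \<open>Forming the quotient of the primitive is linear and monotone for either sign of the
  step, so an almost everywhere bound on \<open>f\<close> becomes a bound on the quotients at every
  \<open>t\<close>. In the applications \<open>g\<close> is a square, and \<open>a\<close> and
  \<open>c\<close> come from Young's inequality.\<close>

lemma diff_quot_primitive_bound:
  assumes f: "integrable (time T) f" and g: "integrable (time T) g"
    and bnd: "AE r in time T. \<bar>f r\<bar> \<le> a * g r + c" and c: "0 \<le> c" and h: "h \<noteq> 0"
  shows "\<bar>diff_quot (primitive T f) h t\<bar> \<le> a * diff_quot (primitive T g) h t + c"
proof -
  have one: "integrable (time T) (\<lambda>r. c)" by (rule finite_measure.integrable_const[OF finite_measure_time])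
  have int: "integrable (time T) (\<lambda>r. a * g r + 1 * c)" using g one by simp
  have eq: "diff_quot (primitive T (\<lambda>r. a * g r + 1 * c)) h t =
      a * diff_quot (primitive T g) h t + 1 * diff_quot (primitive T (\<lambda>r. c)) h t"
    by (rule diff_quot_primitive_linear[OF g one])
  have "diff_quot (primitive T f) h t \<le> diff_quot (primitive T (\<lambda>r. a * g r + 1 * c)) h t"
    by (rule diff_quot_primitive_mono[OF f int _ h]) (use bnd in \<open>auto elim!: eventually_mono\<close>)
  \<comment> \<open>The lower bound is monotonicity for -f, written as a combination to which
    \<open>diff_quot_primitive_linear\<close> applies.\<close>
  moreover have "diff_quot (primitive T (\<lambda>r. (-1) * f r + 0 * c)) h t \<le> diff_quot (primitive T (\<lambda>r. a * g r + 1 * c)) h t"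
    by (rule diff_quot_primitive_mono[OF _ int _ h]) (use bnd f in \<open>auto elim!: eventually_mono\<close>)
  moreover have "diff_quot (primitive T (\<lambda>r. (-1) * f r + 0 * c)) h t = - diff_quot (primitive T f) h t"
    using diff_quot_primitive_linear[OF f one, of "-1" 0 h t] by simp
  ultimately show ?thesis
    using diff_quot_primitive_const[OF h c, of T t] eq by (simp add: abs_le_iff)
qed

lemma diff_quot_continuous:
  assumes "continuous_on UNIV G" shows "continuous_on UNIV (diff_quot G h)"
proof -
  have "continuous_on UNIV (\<lambda>t. G (t + h))"
    by (rule continuous_on_compose2[OF assms]) (auto intro!: continuous_intros)
  then have "continuous_on UNIV (\<lambda>t. (G (t + h) - G t) * inverse h)"
    by (intro continuous_intros assms)
  then show ?thesis by (simp add: diff_quot_def[abs_def] divide_inverse)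
qed

text \<open>The difference quotient of an antiderivative \<open>K\<close> of \<open>G\<close> is an
  antiderivative of the difference quotient of \<open>G\<close>. This replaces a change of variables
  in a shifted integral.\<close>

lemma integral_diff_quot:
  assumes G: "continuous_on UNIV G" and K: "\<And>x. (K has_real_derivative G x) (at x)"
    and ab: "0 \<le> a" "a \<le> b" "b \<le> T"
  shows "(\<integral>t. indicator {a<..<b} t * diff_quot G h t \<partial>time T) = diff_quot K h b - diff_quot K h a"
proof -
  have der: "(diff_quot K h has_real_derivative diff_quot G h x) (at x)" for x
  proof -
    have "((\<lambda>x. K (x + h)) has_real_derivative G (x + h)) (at x)"
      using K[of "x + h"] by (simp add: DERIV_shift)
    from DERIV_cdivide[OF DERIV_diff[OF this K[of x]], of h] show ?thesis
      by (simp add: diff_quot_def[abs_def])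
  qed
  have cont: "continuous_on UNIV (diff_quot G h)" by (rule diff_quot_continuous[OF G])
  have "(\<integral>t. indicator {a<..<b} t * diff_quot G h t \<partial>time T) =
      (\<integral>t. indicator {0<..<T} t * (indicator {a<..<b} t * diff_quot G h t) \<partial>lebesgue)"
    by (subst integral_restrict_space) auto
  also have "\<dots> = (\<integral>t. diff_quot G h t * indicator {a<..<b} t \<partial>lebesgue)"
    using ab by (intro Bochner_Integration.integral_cong) (auto simp: indicator_def)
  also have "\<dots> = (\<integral>t. diff_quot G h t * indicator {a<..<b} t \<partial>lborel)"
    using borel_measurable_continuous_onI[OF cont] by (intro integral_completion) simp
  also have "\<dots> = (\<integral>t. diff_quot G h t * indicator {a..b} t \<partial>lborel)"
  proof (rule integral_cong_AE)
    have "AE t in lborel. t \<noteq> a" "AE t in lborel. t \<noteq> b" by (rule AE_lborel_singleton)+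
    then show "AE t in lborel. diff_quot G h t * indicator {a<..<b} t = diff_quot G h t * indicator {a..b} t"
      by eventually_elim (auto simp: indicator_def)
  qed (use borel_measurable_continuous_onI[OF cont] in simp_all)
  also have "\<dots> = diff_quot K h b - diff_quot K h a"
    using der cont by (intro integral_FTC_Icc_real ab) (auto simp: continuous_on_eq_continuous_at)
  finally show ?thesis .
qed

lemma diff_quot_mean_value:
  assumes K: "\<And>x. (K has_real_derivative G x) (at x)" and h: "h \<noteq> 0"
  obtains z where "diff_quot K h b = G z" "min b (b + h) < z" "z < max b (b + h)"
proof (cases "h > 0")
  case True
  then obtain z where "b < z" "z < b + h" "K (b + h) - K b = (b + h - b) * G z"
    using MVT2[of b "b + h" K G] K by auto
  then show thesis using True by (intro that[of z]) (auto simp: diff_quot_def)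
next
  case False
  then have "h < 0" using h by simp
  then obtain z where "b + h < z" "z < b" "K b - K (b + h) = (b - (b + h)) * G z"
    using MVT2[of "b + h" b K G] K by auto
  then show thesis using \<open>h < 0\<close> by (intro that[of z]) (auto simp: diff_quot_uminus)
qed

text \<open>The bound independent of the step. By the mean value theorem the integral is a
  difference of two values of the primitive, and both lie between 0 and the integral of
  \<open>f\<close>.\<close>

lemma integral_diff_quot_primitive_le:
  assumes f: "integrable (time T) f" and nonneg: "AE r in time T. 0 \<le> f r" and T: "0 \<le> T" and h: "h \<noteq> 0"
  shows "(\<integral>t. diff_quot (primitive T f) h t \<partial>time T) \<le> (\<integral>r. f r \<partial>time T)"
proof -
  obtain K where K: "\<And>x. (K has_real_derivative primitive T f x) (at x)"
    using antiderivative_on_UNIV[OF primitive_continuous[OF f]] by blast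
  have "(\<integral>t. diff_quot (primitive T f) h t \<partial>time T) =
      (\<integral>t. indicator {0<..<T} t * diff_quot (primitive T f) h t \<partial>time T)"
    by (intro Bochner_Integration.integral_cong) (auto simp: indicator_def)
  also have "\<dots> = diff_quot K h T - diff_quot K h 0"
    by (rule integral_diff_quot[OF primitive_continuous[OF f] K]) (use T in auto)
  also have "\<dots> \<le> (\<integral>r. f r \<partial>time T)"
  proof -
    obtain y z where "diff_quot K h T = primitive T f y" "diff_quot K h 0 = primitive T f z"
      using diff_quot_mean_value[OF K h] by metis
    then show ?thesis
      using primitive_bounds[OF f nonneg, of y] primitive_bounds[OF f nonneg, of z] by simp
  qed
  finally show ?thesis .
qed

section \<open>Weak convergence of difference quotients\<close>

lemma LIMSEQ_approx:
  fixes a :: "nat \<Rightarrow> real"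
  assumes "\<And>\<epsilon>. \<epsilon> > 0 \<Longrightarrow> \<exists>b \<beta>. b \<longlonglongrightarrow> \<beta> \<and> (\<forall>n. \<bar>a n - b n\<bar> \<le> \<epsilon>) \<and> \<bar>\<alpha> - \<beta>\<bar> \<le> \<epsilon>"
  shows "a \<longlonglongrightarrow> \<alpha>"
proof (rule LIMSEQ_I)
  fix r :: real assume r: "0 < r"
  then obtain b \<beta> where b: "b \<longlonglongrightarrow> \<beta>" "\<And>n. \<bar>a n - b n\<bar> \<le> r / 4" "\<bar>\<alpha> - \<beta>\<bar> \<le> r / 4"
    using assms[of "r / 4"] by auto
  obtain n0 where n0: "\<And>n. n \<ge> n0 \<Longrightarrow> \<bar>b n - \<beta>\<bar> < r / 4"
    using LIMSEQ_D[OF b(1), of "r / 4"] r by auto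
  have "norm (a n - \<alpha>) < r" if "n \<ge> n0" for n
    using n0[OF that] b(2)[of n] b(3) r unfolding real_norm_def by linarith
  then show "\<exists>no. \<forall>n\<ge>no. norm (a n - \<alpha>) < r" by blast
qed

text \<open>The free weight \<open>a\<close> is chosen first, small enough to control the term with
  x for a given bound on it; the other term then becomes small with y.\<close>

lemma young_inequality:
  fixes x y :: real assumes "0 < a" shows "\<bar>x * y\<bar> \<le> a * x\<^sup>2 + y\<^sup>2 / a"
proof -
  have "0 \<le> (sqrt a * \<bar>x\<bar> - \<bar>y\<bar> / sqrt a)\<^sup>2" by simp
  also have "\<dots> = a * x\<^sup>2 + y\<^sup>2 / a - 2 * \<bar>x * y\<bar>"
    using assms by (simp add: power2_diff power_mult_distrib power_divide abs_mult)
  finally show ?thesis by simp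
qed

text \<open>The majorant of \<open>F\<close> contains a quotient and so depends on the step, but its
  integral is bounded independently of the step.\<close>

lemma integral_diff_quot_dominated:
  fixes F k :: "real \<Rightarrow> real"
  assumes f: "integrable (time T) f" "AE r in time T. 0 \<le> f r" and T: "0 \<le> T" and h: "h \<noteq> 0" and a: "0 < a"
    and F: "integrable (time T) F" and k: "integrable (time T) k"
    and le: "AE t in time T. \<bar>F t\<bar> \<le> a * diff_quot (primitive T f) h t + k t"
  shows "\<bar>\<integral>t. F t \<partial>time T\<bar> \<le> a * (\<integral>r. f r \<partial>time T) + (\<integral>t. k t \<partial>time T)"
proof -
  have D: "integrable (time T) (diff_quot (primitive T f) h)"
    by (intro continuous_integrable_time diff_quot_continuous primitive_continuous f)
  have "\<bar>\<integral>t. F t \<partial>time T\<bar> \<le> (\<integral>t. \<bar>F t\<bar> \<partial>time T)" by (rule integral_abs_bound)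
  also have "\<dots> \<le> (\<integral>t. a * diff_quot (primitive T f) h t + k t \<partial>time T)"
    using le D F k by (intro integral_mono_AE) auto
  also have "\<dots> \<le> a * (\<integral>r. f r \<partial>time T) + (\<integral>t. k t \<partial>time T)"
    using D k a integral_diff_quot_primitive_le[OF f T h] by simp
  finally show ?thesis .
qed

text \<open>On an interval the integral is a difference of quotients of an antiderivative
  \<open>K\<close> of the primitive, and these converge to derivatives of \<open>K\<close>. Box
  induction extends this to measurable sets. Its union case exchanges two limits and needs tails
  that are small uniformly in \<open>n\<close>; square integrability of \<open>f\<close> provides
  them.\<close>

lemma integral_diff_quot_tendsto:
  assumes T: "0 < T" and f: "integrable (time T) f" and f2: "integrable (time T) (\<lambda>r. (f r)\<^sup>2)"
    and h: "h \<longlonglongrightarrow> 0" "\<And>n. h n \<noteq> 0" and E: "E \<in> sets lebesgue"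
  shows "(\<lambda>n. \<integral>t. indicator E t * diff_quot (primitive T f) (h n) t \<partial>time T) \<longlonglongrightarrow>
    (\<integral>t. indicator E t * f t \<partial>time T)"
proof -
  let ?D = "\<lambda>n. diff_quot (primitive T f) (h n)"
  have intD: "integrable (time T) (?D n)" for n
    by (intro continuous_integrable_time diff_quot_continuous primitive_continuous f)
  obtain K where K: "\<And>x. (K has_real_derivative primitive T f x) (at x)"
    using antiderivative_on_UNIV[OF primitive_continuous[OF f]] by blast
  have Klim: "(\<lambda>n. diff_quot K (h n) x) \<longlonglongrightarrow> primitive T f x" for x
  proof -
    have "filterlim h (at 0) sequentially" using h by (auto simp: filterlim_at)
    from filterlim_compose[OF K[of x, unfolded DERIV_def] this] show ?thesis
      by (simp add: diff_quot_def)
  qed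
  have interval: "(\<lambda>n. \<integral>t. indicator {a<..<b} t * ?D n t \<partial>time T) \<longlonglongrightarrow> (\<integral>t. indicator {a<..<b} t * f t \<partial>time T)"
    for a b
  proof -
    \<comment> \<open>The endpoints are clamped to [0, T]. Making \<open>b'\<close> at least
      \<open>a'\<close> turns an interval with b < a into the empty interval with a' = b'.\<close>
    define a' where "a' = max 0 (min T a)"
    define b' where "b' = max a' (min T b)"
    have ab': "0 \<le> a'" "a' \<le> b'" "b' \<le> T" using T by (auto simp: a'_def b'_def)
    have ind: "(indicator {a<..<b} t :: real) = indicator {a'<..<b'} t" if "t \<in> space (time T)" for t
      using that by (auto simp: indicator_def a'_def b'_def)
    have restrict: "(\<integral>t. indicator {a<..<b} t * g t \<partial>time T) = (\<integral>t. indicator {a'<..<b'} t * g t \<partial>time T)"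
      for g :: "real \<Rightarrow> real"
      by (rule Bochner_Integration.integral_cong[OF refl]) (simp only: ind)
    have "(\<integral>t. indicator {a<..<b} t * ?D n t \<partial>time T) = diff_quot K (h n) b' - diff_quot K (h n) a'" for n
      using integral_diff_quot[OF primitive_continuous[OF f] K ab', of "h n"]
      by (simp add: restrict)
    moreover have "(\<integral>t. indicator {a<..<b} t * f t \<partial>time T) = primitive T f b' - primitive T f a'"
    proof -
      have "(\<integral>t. indicator {a<..<b} t * f t \<partial>time T) = (\<integral>t. indicator {a'<..<b'} t * f t \<partial>time T)"
        by (rule restrict)
      also have "\<dots> = (\<integral>t. indicator {a'<..b'} t * f t \<partial>time T)"
      proof (rule integral_cong_AE)
        show "AE t in time T. indicator {a'<..<b'} t * f t = indicator {a'<..b'} t * f t"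
          using AE_time_neq[of b' T] by eventually_elim (auto simp: indicator_def)
      qed (auto intro!: borel_measurable_integrable indicator_integrable_time f)
      finally show ?thesis by (simp add: primitive_diff[OF f ab'(2)])
    qed
    ultimately show ?thesis using tendsto_diff[OF Klim[of b'] Klim[of a']] by simp
  qed
  have total: "(\<lambda>n. \<integral>t. ?D n t \<partial>time T) \<longlonglongrightarrow> (\<integral>t. f t \<partial>time T)"
  proof -
    have "(\<integral>t. indicator {0<..<T} t * g t \<partial>time T) = (\<integral>t. g t \<partial>time T)" for g :: "real \<Rightarrow> real"
      by (rule Bochner_Integration.integral_cong) auto
    then show ?thesis using interval[of 0 T] by simp
  qed
  define C where "C = (\<integral>r. (f r)\<^sup>2 \<partial>time T)"
  have C: "0 \<le> C" by (simp add: C_def)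
  \<comment> \<open>The first term is small by the choice of \<open>a\<close> alone, for every
    \<open>n\<close>; the second becomes small once \<open>A\<close> has small measure.\<close>
  have small: "\<bar>\<integral>t. indicator A t * ?D n t \<partial>time T\<bar> \<le> a * C + (\<integral>t. indicator A t \<partial>time T) / a"
    "\<bar>\<integral>t. indicator A t * f t \<partial>time T\<bar> \<le> a * C + (\<integral>t. indicator A t \<partial>time T) / a"
    if a: "0 < a" and A: "A \<in> sets lebesgue" for a A n
  proof -
    have intA: "integrable (time T) (indicator A :: real \<Rightarrow> real)"
      using indicator_integrable_time[OF finite_measure.integrable_const[OF finite_measure_time, of T "1::real"] A]
      by simp
    let ?D2 = "diff_quot (primitive T (\<lambda>r. (f r)\<^sup>2)) (h n)"
    have D2: "0 \<le> ?D2 t" for t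
      using diff_quot_primitive_mono[OF _ f2 _ h(2), of "\<lambda>r. 0" n t]
      by (simp add: diff_quot_def primitive_def)
    have Dle: "\<bar>?D n t\<bar> \<le> a * ?D2 t + 1 / a" for t
    proof (rule diff_quot_primitive_bound[OF f f2 _ _ h(2)])
      show "AE r in time T. \<bar>f r\<bar> \<le> a * (f r)\<^sup>2 + 1 / a"
        using young_inequality[OF a, of "f _" 1] by (intro AE_I2) simp
    qed (use a in simp)
    have "\<bar>\<integral>t. indicator A t * ?D n t \<partial>time T\<bar> \<le> a * C + (\<integral>t. indicator A t / a \<partial>time T)"
      unfolding C_def
    proof (rule integral_diff_quot_dominated[OF f2 _ _ h(2) a indicator_integrable_time[OF intD A]])
      show "AE t in time T. \<bar>indicator A t * ?D n t\<bar> \<le> a * ?D2 t + indicator A t / a"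
        using Dle D2 a by (intro AE_I2) (auto simp: indicator_def)
    qed (use T intA in auto)
    then show "\<bar>\<integral>t. indicator A t * ?D n t \<partial>time T\<bar> \<le> a * C + (\<integral>t. indicator A t \<partial>time T) / a" by simp
    have "\<bar>\<integral>t. indicator A t * f t \<partial>time T\<bar> \<le> (\<integral>t. \<bar>indicator A t * f t\<bar> \<partial>time T)"
      by (rule integral_abs_bound)
    also have "\<dots> \<le> (\<integral>t. a * (f t)\<^sup>2 + indicator A t / a \<partial>time T)"
    proof (rule integral_mono)
      show "\<bar>indicator A t * f t\<bar> \<le> a * (f t)\<^sup>2 + indicator A t / a" for t
        using young_inequality[OF a, of "f t" 1] a by (auto simp: indicator_def)
    qed (use f2 intA indicator_integrable_time[OF f A] in auto)
    also have "\<dots> = a * C + (\<integral>t. indicator A t \<partial>time T) / a"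
      using f2 intA by (simp add: C_def)
    finally show "\<bar>\<integral>t. indicator A t * f t \<partial>time T\<bar> \<le> a * C + (\<integral>t. indicator A t \<partial>time T) / a" .
  qed
  show ?thesis
    using E
  proof (induction rule: lebesgue_box_induct)
    case (box a b)
    show ?case using interval by (simp add: box_real)
  next
    case empty
    show ?case by simp
  next
    case (compl A)
    have eq: "(\<integral>t. indicator (UNIV - A) t * g t \<partial>time T) = (\<integral>t. g t \<partial>time T) - (\<integral>t. indicator A t * g t \<partial>time T)"
      if g: "integrable (time T) g" for g :: "real \<Rightarrow> real"
      using indicator_integrable_time[OF g compl(1)]
      by (subst Bochner_Integration.integral_diff[symmetric, OF g])
        (auto intro!: Bochner_Integration.integral_cong simp: indicator_def)
    show ?case
      unfolding eq[OF intD] eq[OF f] by (intro tendsto_diff total compl)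
  next
    case (union A)
    note A = union(2)
    \<comment> \<open>The part of the union beyond the first \<open>k\<close> sets: it is the error
      of the finite sums in \<open>split\<close>, and its measure tends to 0.\<close>
    define R where "R k = (\<Union>i. A i) - (\<Union>i<k. A i)" for k :: nat
    have R: "R k \<in> sets lebesgue" for k using A by (auto simp: R_def)
    have split: "(\<integral>t. indicator (\<Union>i. A i) t * g t \<partial>time T) =
        (\<Sum>i<k. \<integral>t. indicator (A i) t * g t \<partial>time T) + (\<integral>t. indicator (R k) t * g t \<partial>time T)"
      if g: "integrable (time T) g" for g :: "real \<Rightarrow> real" and k
    proof -
      have "indicator (\<Union>i. A i) t = (\<Sum>i<k. indicator (A i) t) + (indicator (R k) t :: real)" for t
      proof -
        have "indicator (\<Union>i<k. A i) t = (\<Sum>i<k. indicator (A i) t :: real)"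
          using union(1) by (intro indicator_UN_disjoint) (auto simp: disjoint_family_on_def)
        moreover have "indicator (\<Union>i. A i) t = indicator (\<Union>i<k. A i) t + (indicator (R k) t :: real)"
          by (auto simp: R_def indicator_def)
        ultimately show ?thesis by simp
      qed
      then have "(\<integral>t. indicator (\<Union>i. A i) t * g t \<partial>time T) =
          (\<integral>t. (\<Sum>i<k. indicator (A i) t * g t) + indicator (R k) t * g t \<partial>time T)"
        by (simp only: distrib_right sum_distrib_right)
      also have "\<dots> = (\<integral>t. (\<Sum>i<k. indicator (A i) t * g t) \<partial>time T) + (\<integral>t. indicator (R k) t * g t \<partial>time T)"
        by (intro Bochner_Integration.integral_add Bochner_Integration.integrable_sum indicator_integrable_time[OF g] A R)
      also have "(\<integral>t. (\<Sum>i<k. indicator (A i) t * g t) \<partial>time T) = (\<Sum>i<k. \<integral>t. indicator (A i) t * g t \<partial>time T)"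
        by (intro Bochner_Integration.integral_sum indicator_integrable_time[OF g] A)
      finally show ?thesis .
    qed
    have "(\<lambda>k. \<integral>t. indicator (R k) t \<partial>time T) \<longlonglongrightarrow> (\<integral>t. (0::real) \<partial>time T)"
    proof (rule integral_dominated_convergence)
      show "integrable (time T) (\<lambda>t. 1::real)" by (rule finite_measure.integrable_const[OF finite_measure_time])
      show "AE t in time T. (\<lambda>k. indicator (R k) t) \<longlonglongrightarrow> (0::real)"
      proof (intro AE_I2 tendsto_eventually)
        fix t
        show "eventually (\<lambda>k. indicator (R k) t = (0::real)) sequentially"
        proof (cases "t \<in> (\<Union>i. A i)")
          case True
          then obtain i where i: "t \<in> A i" by auto
          show ?thesis
            using eventually_gt_at_top[of i] by eventually_elim (use i in \<open>auto simp: R_def indicator_def\<close>)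
        qed (auto simp: R_def)
      qed
      show "(indicator (R k) :: real \<Rightarrow> real) \<in> borel_measurable (time T)" for k by (rule indicator_measurable_time[OF R])
      show "AE t in time T. norm (indicator (R k) t :: real) \<le> 1" for k
        by (intro AE_I2) (simp add: indicator_def)
    qed simp
    then have Rlim: "(\<lambda>k. \<integral>t. indicator (R k) t \<partial>time T) \<longlonglongrightarrow> (0::real)" by simp
    show ?case
    proof (rule LIMSEQ_approx)
      fix \<epsilon> :: real assume \<epsilon>: "\<epsilon> > 0"
      \<comment> \<open>This makes \<open>a * C\<close> at most half of \<epsilon>; the summand 1
        keeps the denominator positive when C = 0.\<close>
      define a where "a = \<epsilon> / (2 * (C + 1))"
      have a: "a > 0" using \<epsilon> C by (simp add: a_def)
      have aC: "a * C \<le> \<epsilon> / 2"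
        using \<epsilon> C by (simp add: a_def field_simps)
      have "eventually (\<lambda>k. (\<integral>t. indicator (R k) t \<partial>time T) < a * \<epsilon> / 2) sequentially"
        using order_tendstoD(2)[OF Rlim, of "a * \<epsilon> / 2"] a \<epsilon> by simp
      then obtain k where "(\<integral>t. indicator (R k) t \<partial>time T) < a * \<epsilon> / 2"
        by (auto simp: eventually_sequentially)
      then have "(\<integral>t. indicator (R k) t \<partial>time T) / a < \<epsilon> / 2"
        using a by (simp only: pos_divide_less_eq[OF a]) (simp add: mult.commute)
      then have k: "a * C + (\<integral>t. indicator (R k) t \<partial>time T) / a \<le> \<epsilon>"
        using aC by linarith
      show "\<exists>b \<beta>. b \<longlonglongrightarrow> \<beta> \<and>
          (\<forall>n. \<bar>(\<integral>t. indicator (\<Union>i. A i) t * ?D n t \<partial>time T) - b n\<bar> \<le> \<epsilon>) \<and>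
          \<bar>(\<integral>t. indicator (\<Union>i. A i) t * f t \<partial>time T) - \<beta>\<bar> \<le> \<epsilon>"
      proof (intro exI conjI allI)
        show "(\<lambda>n. \<Sum>i<k. \<integral>t. indicator (A i) t * ?D n t \<partial>time T) \<longlonglongrightarrow>
            (\<Sum>i<k. \<integral>t. indicator (A i) t * f t \<partial>time T)"
          using union by (intro tendsto_sum) auto
        show "\<bar>(\<integral>t. indicator (\<Union>i. A i) t * ?D n t \<partial>time T) - (\<Sum>i<k. \<integral>t. indicator (A i) t * ?D n t \<partial>time T)\<bar> \<le> \<epsilon>" for n
          unfolding split[OF intD, of n k] using small(1)[OF a R[of k], of n] k by simp
        show "\<bar>(\<integral>t. indicator (\<Union>i. A i) t * f t \<partial>time T) - (\<Sum>i<k. \<integral>t. indicator (A i) t * f t \<partial>time T)\<bar> \<le> \<epsilon>"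
          unfolding split[OF f, of k] using small(2)[OF a R[of k]] k by simp
      qed
    qed
  next
    case (null A B)
    have "AE t in time T. (indicator A t :: real) = indicator B t"
      using null(3) by (simp add: AE_restrict_space_iff) (auto elim!: eventually_mono)
    then have "(\<integral>t. indicator A t * g t \<partial>time T) = (\<integral>t. indicator B t * g t \<partial>time T)"
      if g: "integrable (time T) g" for g :: "real \<Rightarrow> real"
      using indicator_integrable_time[OF g null(1)] indicator_integrable_time[OF g null(2)]
      by (intro integral_cong_AE borel_measurable_integrable) (auto elim!: eventually_mono)
    then show ?case using null(4) intD f by simp
  qed
qed

text \<open>The test functions are differences of two rescaled smooth steps. Their derivatives are
  approximate identities at \<open>a\<close> and \<open>b\<close>, which reproduce G a - G b, while
  the test functions themselves tend to the indicator of the interval from \<open>a\<close> to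
  \<open>b\<close> and produce the increment of the primitive.\<close>

lemma weak_derivative_primitive:
  assumes T: "0 < T" and G: "continuous_on {0..T} G" and f: "integrable (time T) f"
    and weak: "\<And>\<phi>. \<phi> \<in> test_functions {0<..<T} \<Longrightarrow>
      (\<integral>t. deriv \<phi> t * G t \<partial>time T) = - (\<integral>t. \<phi> t * f t \<partial>time T)"
    and t: "t \<in> {0..T}"
  shows "G t - G 0 = primitive T f t"
proof -
  obtain R \<rho> :: "real \<Rightarrow> real" where \<rho>: "\<And>k. Ck k \<rho>" and R: "\<And>x. (R has_real_derivative \<rho> x) (at x)"
    and \<rho>0: "\<And>x. 0 \<le> \<rho> x" "\<And>x. x \<notin> {0<..<1} \<Longrightarrow> \<rho> x = 0"
    and R01: "\<And>x. x \<le> 0 \<Longrightarrow> R x = 0" "\<And>x. x \<ge> 1 \<Longrightarrow> R x = 1"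
    using smooth_step by metis
  have Rmono: "R x \<le> R y" if "x \<le> y" for x y
    using R \<rho>0(1) by (intro DERIV_nonneg_imp_nondecreasing[OF that]) blast
  have Rb: "0 \<le> R x" "R x \<le> 1" for x
    using Rmono[of "min x 0" x] R01(1)[of "min x 0"] Rmono[of x "max x 1"] R01(2)[of "max x 1"] by auto
  have \<rho>c: "continuous_on UNIV \<rho>" using \<rho>[of 0] by simp
  have G2: "integrable (time T) G"
  proof -
    \<comment> \<open>\<open>G\<close> is continuous on [0, T] only; clamping its argument extends
      it continuously to the whole line.\<close>
    have "continuous_on UNIV (\<lambda>t. G (max 0 (min T t)))"
      using T by (intro continuous_on_compose2[OF G]) (auto intro!: continuous_intros)
    then have "integrable (time T) (\<lambda>t. G (max 0 (min T t)))" by (rule continuous_integrable_time)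
    then show ?thesis by (rule Bochner_Integration.integrable_cong[THEN iffD1, rotated -1]) auto
  qed
  \<comment> \<open>Widths that tend to 0 and never exceed \<delta>. The kernel \<open>k\<close> is
    the bump \<rho> rescaled to mass 1 between \<open>a\<close> and
    \<open>a + e \<delta> n\<close>.\<close>
  define e where "e \<delta> n = \<delta> / real (Suc n)" for \<delta> :: real and n
  define k where "k \<delta> a n y = \<rho> ((y - a) / e \<delta> n) / e \<delta> n" for \<delta> a :: real and n y
  have e: "0 < e \<delta> n" "e \<delta> n \<le> \<delta>" if "0 < \<delta>" for \<delta> n
    using that by (auto simp: e_def field_simps)
  have elim0: "e \<delta> \<longlonglongrightarrow> 0" for \<delta>
    unfolding e_def by (rule LIMSEQ_Suc[OF lim_const_over_n])
  have kc: "continuous_on UNIV (k \<delta> a n)" if "0 < \<delta>" for \<delta> a n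
  proof -
    have "continuous_on UNIV (\<lambda>y. \<rho> ((y - a) / e \<delta> n))"
      using e(1)[OF that, of n] by (intro continuous_on_compose2[OF \<rho>c]) (auto intro!: continuous_intros)
    then show ?thesis
      unfolding k_def[abs_def] using e(1)[OF that, of n] by (intro continuous_intros) auto
  qed
  have Rder: "((\<lambda>y. R ((y - a) / e \<delta> n)) has_real_derivative k \<delta> a n y) (at y)" if "0 < \<delta>" for \<delta> a n y
  proof -
    have "((\<lambda>y. (y - a) / e \<delta> n) has_real_derivative 1 / e \<delta> n) (at y)"
      using e(1)[OF that, of n] by (auto intro!: derivative_eq_intros)
    from DERIV_chain2[OF R this] show ?thesis by (simp add: k_def)
  qed
  have k1: "(\<integral>y. k \<delta> a n y \<partial>time T) = 1" if \<delta>: "0 < \<delta>" and a: "0 \<le> a" "a + \<delta> < T" for \<delta> a n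
  proof -
    have "(\<integral>y. k \<delta> a n y \<partial>time T) = (\<integral>y. indicator {0<..<T} y * k \<delta> a n y \<partial>lebesgue)"
      by (subst integral_restrict_space) auto
    also have "\<dots> = (\<integral>y. k \<delta> a n y * indicator {a..a + \<delta>} y \<partial>lebesgue)"
    proof (rule Bochner_Integration.integral_cong[OF refl])
      fix y
      show "indicator {0<..<T} y * k \<delta> a n y = k \<delta> a n y * indicator {a..a + \<delta>} y"
      proof (cases "0 < (y - a) / e \<delta> n \<and> (y - a) / e \<delta> n < 1")
        case True
        then have "a < y" "y < a + e \<delta> n" using e(1)[OF \<delta>, of n] by (auto simp: field_simps)
        then have "y \<in> {0<..<T}" "y \<in> {a..a + \<delta>}" using a e(2)[OF \<delta>, of n] by auto
        then show ?thesis by simp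
      next
        case False
        then have "\<rho> ((y - a) / e \<delta> n) = 0" by (intro \<rho>0) simp
        then show ?thesis by (simp add: k_def)
      qed
    qed
    also have "\<dots> = (\<integral>y. k \<delta> a n y * indicator {a..a + \<delta>} y \<partial>lborel)"
      using borel_measurable_continuous_onI[OF kc[OF \<delta>]] by (intro integral_completion) simp
    also have "\<dots> = R ((a + \<delta> - a) / e \<delta> n) - R ((a - a) / e \<delta> n)"
      using Rder[OF \<delta>] kc[OF \<delta>] \<delta>
      by (intro integral_FTC_Icc_real) (auto simp: continuous_on_eq_continuous_at)
    also have "\<dots> = 1" using R01 e[OF \<delta>, of n] by (simp add: field_simps)
    finally show ?thesis .
  qed
  have kG: "(\<lambda>n. \<integral>y. k \<delta> a n y * G y \<partial>time T) \<longlonglongrightarrow> G a" if \<delta>: "0 < \<delta>" and a: "0 < a" "a + \<delta> < T" for \<delta> a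
  proof (rule LIMSEQ_I)
    fix r :: real assume r: "0 < r"
    have "continuous (at a within {0..T}) G"
      using G a \<delta> by (simp add: continuous_on_eq_continuous_within)
    then obtain d where d: "d > 0" "\<And>y. y \<in> {0..T} \<Longrightarrow> dist y a < d \<Longrightarrow> dist (G y) (G a) < r / 2"
      using r unfolding continuous_within_eps_delta by (metis half_gt_zero)
    obtain n0 where n0: "\<And>n. n \<ge> n0 \<Longrightarrow> e \<delta> n < d"
      using order_tendstoD(2)[OF elim0[of \<delta>] d(1)] by (auto simp: eventually_sequentially)
    have "norm ((\<integral>y. k \<delta> a n y * G y \<partial>time T) - G a) < r" if n: "n \<ge> n0" for n
    proof -
      have intk: "integrable (time T) (k \<delta> a n)" by (intro continuous_integrable_time kc \<delta>)
      have intkG: "integrable (time T) (\<lambda>y. k \<delta> a n y * G y)"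
        by (rule continuous_mult_integrable_time[OF kc[OF \<delta>] G2])
      have "(\<integral>y. k \<delta> a n y * G y \<partial>time T) - G a = (\<integral>y. k \<delta> a n y * G y - G a * k \<delta> a n y \<partial>time T)"
        using intk intkG k1[OF \<delta> _ a(2), of n] a(1) by simp
      also have "\<bar>\<dots>\<bar> \<le> (\<integral>y. \<bar>k \<delta> a n y * G y - G a * k \<delta> a n y\<bar> \<partial>time T)"
        by (rule integral_abs_bound)
      also have "\<dots> \<le> (\<integral>y. k \<delta> a n y * (r / 2) \<partial>time T)"
      proof (rule integral_mono)
        fix y assume y: "y \<in> space (time T)"
        show "\<bar>k \<delta> a n y * G y - G a * k \<delta> a n y\<bar> \<le> k \<delta> a n y * (r / 2)"
        proof (cases "0 < (y - a) / e \<delta> n \<and> (y - a) / e \<delta> n < 1")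
          case True
          then have "a < y" "y < a + e \<delta> n" using e(1)[OF \<delta>, of n] by (auto simp: field_simps)
          then have "\<bar>G y - G a\<bar> \<le> r / 2"
            using d(2)[of y] n0[OF n] y by (simp add: dist_real_def)
          moreover have "0 \<le> k \<delta> a n y" using \<rho>0(1) e(1)[OF \<delta>, of n] by (simp add: k_def)
          ultimately have "k \<delta> a n y * \<bar>G y - G a\<bar> \<le> k \<delta> a n y * (r / 2)" by (rule mult_left_mono)
          moreover have "\<bar>k \<delta> a n y * G y - G a * k \<delta> a n y\<bar> = k \<delta> a n y * \<bar>G y - G a\<bar>"
            using \<open>0 \<le> k \<delta> a n y\<close> by (metis abs_mult abs_of_nonneg mult.commute right_diff_distrib)
          ultimately show ?thesis by simp
        next
          case False
          then have "\<rho> ((y - a) / e \<delta> n) = 0" by (intro \<rho>0) simp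
          then show ?thesis by (simp add: k_def)
        qed
      qed (use intk intkG in auto)
      also have "\<dots> = r / 2" using k1[OF \<delta> _ a(2), of n] a(1) by simp
      finally show ?thesis using r by simp
    qed
    then show "\<exists>no. \<forall>n\<ge>no. norm ((\<integral>y. k \<delta> a n y * G y \<partial>time T) - G a) < r" by blast
  qed
  have main: "G b - G a = primitive T f b - primitive T f a" if ab: "0 < a" "a < b" "b < T" for a b
  proof -
    \<comment> \<open>Half the distance from \<open>b\<close> to \<open>T\<close>, so that the
      supports of the test functions, contained in [a, b + \<delta>], stay inside (0, T).\<close>
    define \<delta> where "\<delta> = (T - b) / 2"
    have \<delta>: "0 < \<delta>" "b + \<delta> < T" "a + \<delta> < T" using ab by (auto simp: \<delta>_def field_simps)
    define \<phi> where "\<phi> n y = R ((y - a) / e \<delta> n) - R ((y - b) / e \<delta> n)" for n y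
    have \<phi>d: "(\<phi> n has_real_derivative k \<delta> a n y - k \<delta> b n y) (at y)" for n y
      unfolding \<phi>_def[abs_def] by (intro DERIV_diff Rder \<delta>)
    have \<phi>t: "\<phi> n \<in> test_functions {0<..<T}" for n
    proof -
      have "Ck j (k \<delta> c n)" for j c
      proof -
        have "Ck j (\<lambda>y. \<rho> (inverse (e \<delta> n) \<bullet> y + (- c / e \<delta> n)) * inverse (e \<delta> n))"
          by (intro Ck_mult Ck_const Ck_compose_affine \<rho>)
        then show ?thesis by (simp add: k_def[abs_def] divide_inverse algebra_simps)
      qed
      from Ck_add[OF this[of _ a] Ck_mult[OF Ck_const[of _ "-1"] this[of _ b]]]
      have "Ck j (\<lambda>y. k \<delta> a n y - k \<delta> b n y)" for j by simp
      then have "Ck (Suc j) (\<phi> n)" for j by (rule Ck_SucI_real[OF \<phi>d])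
      then have "Ck j (\<phi> n)" for j using Ck_SucD by blast
      moreover have "{y. \<phi> n y \<noteq> 0} \<subseteq> {a..b + \<delta>}"
      proof
        fix y assume y: "y \<in> {y. \<phi> n y \<noteq> 0}"
        show "y \<in> {a..b + \<delta>}"
        proof (rule ccontr)
          assume "y \<notin> {a..b + \<delta>}"
          then consider "y < a" | "y > b + \<delta>" by fastforce
          then show False
          proof cases
            case 1
            then have "(y - a) / e \<delta> n \<le> 0" "(y - b) / e \<delta> n \<le> 0"
              using ab e(1)[OF \<delta>(1), of n] by (auto simp: divide_le_0_iff)
            then show False using y R01 by (simp add: \<phi>_def)
          next
            case 2
            then have "(y - a) / e \<delta> n \<ge> 1" "(y - b) / e \<delta> n \<ge> 1"
              using ab e[OF \<delta>(1), of n] by (auto simp: field_simps)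
            then show False using y R01 by (simp add: \<phi>_def)
          qed
        qed
      qed
      then have sub: "closure {y. \<phi> n y \<noteq> 0} \<subseteq> {a..b + \<delta>}"
        by (rule closure_minimal) simp
      moreover have "compact (closure {y. \<phi> n y \<noteq> 0})"
        using compact_Int_closed[OF compact_Icc closed_closure, of a "b + \<delta>" "{y. \<phi> n y \<noteq> 0}"] sub
        by (simp add: Int_absorb1)
      moreover have "{a..b + \<delta>} \<subseteq> {0<..<T}" using ab \<delta> by auto
      ultimately show ?thesis unfolding test_functions_def by blast
    qed
    have "deriv (\<phi> n) = (\<lambda>y. k \<delta> a n y - k \<delta> b n y)" for n
      using DERIV_imp_deriv[OF \<phi>d] by blast
    then have eq: "(\<integral>y. (k \<delta> a n y - k \<delta> b n y) * G y \<partial>time T) = - (\<integral>y. \<phi> n y * f y \<partial>time T)" for n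
      using weak[OF \<phi>t[of n]] by simp
    have intkG: "integrable (time T) (\<lambda>y. k \<delta> c n y * G y)" for c n
      by (rule continuous_mult_integrable_time[OF kc[OF \<delta>(1)] G2])
    have "(\<integral>y. (k \<delta> a n y - k \<delta> b n y) * G y \<partial>time T) =
        (\<integral>y. k \<delta> a n y * G y \<partial>time T) - (\<integral>y. k \<delta> b n y * G y \<partial>time T)" for n
      using intkG by (simp add: left_diff_distrib)
    then have lim1: "(\<lambda>n. - (\<integral>y. \<phi> n y * f y \<partial>time T)) \<longlonglongrightarrow> G a - G b"
      using tendsto_diff[OF kG[OF \<delta>(1) ab(1) \<delta>(3)] kG[OF \<delta>(1) _ \<delta>(2)]] ab unfolding eq[symmetric] by simp
    have "(\<lambda>n. \<integral>y. \<phi> n y * f y \<partial>time T) \<longlonglongrightarrow> (\<integral>y. indicator {a<..b} y * f y \<partial>time T)"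
    proof (rule integral_dominated_convergence)
      show "integrable (time T) (\<lambda>y. \<bar>f y\<bar>)" using f by simp
      have "continuous_on UNIV (\<phi> n)" for n using test_function_continuous(1)[OF \<phi>t] .
      then have \<phi>m: "\<phi> n \<in> borel_measurable (time T)" for n
        by (intro borel_measurable_integrable continuous_integrable_time)
      show "(\<lambda>y. \<phi> n y * f y) \<in> borel_measurable (time T)" for n
        by (rule borel_measurable_times[OF \<phi>m borel_measurable_integrable[OF f]])
      show "(\<lambda>y. indicator {a<..b} y * f y) \<in> borel_measurable (time T)"
        using f by (intro borel_measurable_integrable indicator_integrable_time) auto
      have "\<bar>\<phi> n y\<bar> \<le> 1" for n y
        using Rb[of "(y - a) / e \<delta> n"] Rb[of "(y - b) / e \<delta> n"] by (simp add: \<phi>_def)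
      then show "AE y in time T. norm (\<phi> n y * f y) \<le> \<bar>f y\<bar>" for n
        by (intro AE_I2) (simp add: abs_mult mult_le_cancel_right1 mult_left_le_one_le)
      show "AE y in time T. (\<lambda>n. \<phi> n y * f y) \<longlonglongrightarrow> indicator {a<..b} y * f y"
      proof (intro AE_I2 tendsto_mult_right)
        fix y
        \<comment> \<open>At y = c the value is R 0 = 0. The limit of \<open>\<phi> n\<close> is
          therefore the indicator of the half-open interval that occurs in
          \<open>primitive_diff\<close>.\<close>
        have R0: "(\<lambda>n. R ((y - c) / e \<delta> n)) \<longlonglongrightarrow> (if c < y then 1 else 0)" for c
        proof (cases "c < y")
          case True
          have "eventually (\<lambda>n. e \<delta> n < y - c) sequentially"
            using order_tendstoD(2)[OF elim0[of \<delta>], of "y - c"] True by simp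
          then have "eventually (\<lambda>n. R ((y - c) / e \<delta> n) = 1) sequentially"
          proof eventually_elim
            case (elim n)
            then show ?case using e(1)[OF \<delta>(1), of n] by (intro R01) (simp add: field_simps)
          qed
          then show ?thesis using True by (simp add: tendsto_eventually)
        next
          case False
          then have "R ((y - c) / e \<delta> n) = 0" for n
            using e(1)[OF \<delta>(1), of n] by (intro R01) (simp add: divide_le_0_iff)
          then show ?thesis using False by simp
        qed
        show "(\<lambda>n. \<phi> n y) \<longlonglongrightarrow> indicator {a<..b} y"
          unfolding \<phi>_def using tendsto_diff[OF R0[of a] R0[of b]] ab
          by (auto simp: indicator_def split: if_splits)
      qed
    qed
    then have "(\<lambda>n. - (\<integral>y. \<phi> n y * f y \<partial>time T)) \<longlonglongrightarrow> - (primitive T f b - primitive T f a)"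
      using ab by (intro tendsto_minus) (simp add: primitive_diff[OF f])
    from LIMSEQ_unique[OF this lim1] show ?thesis by simp
  qed
  \<comment> \<open>By \<open>main\<close> this difference is constant on the open interval;
    continuity carries the constancy to the endpoints, where the kernels on (0, T) do not
    reach.\<close>
  define H where "H t = G t - primitive T f t" for t
  have cl: "closure {0<..<T} = {0..T}" using T by simp
  have "H t = H (T / 2)" if "t \<in> {0<..<T}" for t
    using main[of t "T / 2"] main[of "T / 2" t] that T
    by (cases "t < T / 2"; cases "t = T / 2") (auto simp: H_def)
  moreover have "continuous_on (closure {0<..<T}) H"
    unfolding H_def cl using primitive_continuous[OF f] G
    by (intro continuous_on_diff) (auto intro: continuous_on_subset)
  ultimately have "H s = H (T / 2)" if "s \<in> {0..T}" for s
    using continuous_constant_on_closure[of "{0<..<T}" H "H (T / 2)" s] that cl by blast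
  from this[OF t] this[of 0] show ?thesis using T by (simp add: H_def primitive_nonpos)
qed


subsection \<open>Integration by parts in time\<close>

context seminormed_space
begin

text \<open>The difference vanishes at r = t, so the punctured limit is a full one and
  \<open>g\<close> is allowed to take the value \<open>t\<close>.\<close>

lemma seminorm_tendsto_compose:
  assumes "((\<lambda>r. N (c r - c t)) \<longlongrightarrow> 0) (at t)" and g: "(g \<longlongrightarrow> t) F"
  shows "((\<lambda>x. N (c (g x) - c t)) \<longlongrightarrow> 0) F"
proof -
  have "((\<lambda>r. N (c r - c t)) \<longlongrightarrow> 0) (nhds t)"
    using assms(1) tendsto_at_iff_tendsto_nhds[of "\<lambda>r. N (c r - c t)" t] by simp
  then show ?thesis by (rule filterlim_compose[OF _ g])
qed

text \<open>Sampling \<open>c\<close> at the last point of the grid of mesh 1/(k+1) before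
  \<open>t\<close> gives simple functions, since only finitely many grid points are met on a bounded
  interval; continuity gives convergence at every time.\<close>

lemma L2_time_continuous:
  fixes c :: "real \<Rightarrow> 'b"
  assumes X: "\<And>t. c t \<in> X" and cont: "\<And>t. ((\<lambda>r. N (c r - c t)) \<longlongrightarrow> 0) (at t)"
  shows "c \<in> L2_time T X N"
proof -
  define g where "g k t = of_int \<lfloor>real (Suc k) * t\<rfloor> / real (Suc k)" for k t
  have gt: "(\<lambda>k. g k t) \<longlonglongrightarrow> t" for t
  proof (rule LIM_zero_cancel, rule Lim_null_comparison)
    have "\<bar>g k t - t\<bar> \<le> inverse (real (Suc k))" for k
    proof -
      have "g k t - t = (of_int \<lfloor>real (Suc k) * t\<rfloor> - real (Suc k) * t) * inverse (real (Suc k))"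
        by (simp add: g_def field_simps)
      moreover have "\<bar>of_int \<lfloor>real (Suc k) * t\<rfloor> - real (Suc k) * t\<bar> \<le> 1"
        using floor_correct[of "real (Suc k) * t"] by (simp only: abs_le_iff) linarith
      ultimately show ?thesis
        by (simp only: abs_mult abs_inverse) (simp add: mult_left_le_one_le)
    qed
    then show "eventually (\<lambda>k. norm (g k t - t) \<le> inverse (real (Suc k))) sequentially" by simp
    show "(\<lambda>k. inverse (real (Suc k))) \<longlonglongrightarrow> 0" by (rule LIMSEQ_inverse_real_of_nat)
  qed
  have gs: "simple_function (time T) (g k)" for k
  proof (rule simple_function_borel_measurable)
    have "g k \<in> borel_measurable borel" unfolding g_def[abs_def] by measurable
    then show "g k \<in> borel_measurable (time T)"
      by (intro measurable_restrict_space1 measurable_completion) simp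
    have "g k ` {0<..<T} \<subseteq> (\<lambda>i. of_int i / real (Suc k)) ` {0..\<lfloor>real (Suc k) * T\<rfloor>}"
    proof
      fix y assume "y \<in> g k ` {0<..<T}"
      then obtain t where t: "0 < t" "t < T" "y = g k t" by auto
      have "\<lfloor>real (Suc k) * t\<rfloor> \<in> {0..\<lfloor>real (Suc k) * T\<rfloor>}"
        using t by (auto intro!: floor_mono mult_left_mono simp: zero_le_floor)
      then show "y \<in> (\<lambda>i. of_int i / real (Suc k)) ` {0..\<lfloor>real (Suc k) * T\<rfloor>}"
        unfolding t(3) g_def by blast
    qed
    then show "finite (g k ` space (time T))" by (simp add: finite_subset)
  qed
  have sm: "strongly_measurable (time T) X N c"
    unfolding strongly_measurable_def
  proof (intro exI conjI allI)
    show "simple_function (time T) (\<lambda>t. c (g k t))" for k by (rule simple_function_compose1[OF gs])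
    show "(\<lambda>t. c (g k t)) ` space (time T) \<subseteq> X" for k using X by auto
    show "AE t in time T. (\<lambda>k. N (c (g k t) - c t)) \<longlonglongrightarrow> 0"
      by (rule AE_I2) (rule seminorm_tendsto_compose[OF cont gt])
  qed
  have "continuous_on UNIV (\<lambda>t. N (c t))"
    unfolding continuous_on_eq_continuous_at[OF open_UNIV] isCont_def
  proof
    fix t
    have "\<bar>N (c r) - N (c t)\<bar> \<le> N (c r - c t)" for r by (rule reverse_triangle[OF X X])
    then show "(\<lambda>r. N (c r)) \<midarrow>t\<rightarrow> N (c t)"
      by (intro LIM_zero_cancel[where l = "N (c t)"] Lim_null_comparison[OF _ cont]) simp
  qed
  then have "integrable (time T) (\<lambda>t. (N (c t))\<^sup>2)"
    by (intro continuous_integrable_time continuous_intros)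
  then show ?thesis using X sm by (simp add: L2_time_def)
qed

lemma L2_time_dual_apply:
  assumes w: "w \<in> L2_time T (dual_space X N) (dual_norm X N)" and v: "v \<in> X"
  shows "integrable (time T) (\<lambda>t. w t v)" "integrable (time T) (\<lambda>t. (w t v)\<^sup>2)"
proof -
  interpret P: seminormed_pairing "dual_space X N" "dual_norm X N" X N "\<lambda>F v. F v" by (rule dual_pairing)
  show i: "integrable (time T) (\<lambda>t. w t v)" by (rule P.pairing_integrable[OF w L2_time_const[OF v]])
  show "integrable (time T) (\<lambda>t. (w t v)\<^sup>2)"
  proof (rule Bochner_Integration.integrable_bound)
    show "integrable (time T) (\<lambda>t. (N v)\<^sup>2 * (dual_norm X N (w t))\<^sup>2)" using w by (simp add: L2_time_def)
    show "(\<lambda>t. (w t v)\<^sup>2) \<in> borel_measurable (time T)"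
      using borel_measurable_integrable[OF i] by (rule borel_measurable_power)
    have "AE t in time T. w t \<in> dual_space X N" using w by (simp add: L2_time_def)
    then show "AE t in time T. norm ((w t v)\<^sup>2) \<le> norm ((N v)\<^sup>2 * (dual_norm X N (w t))\<^sup>2)"
    proof eventually_elim
      case (elim t)
      have "\<bar>w t v\<bar>\<^sup>2 \<le> (dual_norm X N (w t) * N v)\<^sup>2"
        by (rule power_mono[OF dual_norm_bound[OF elim v] abs_ge_zero])
      then show ?case by (simp add: power_mult_distrib mult.commute)
    qed
  qed
qed

text \<open>Splitting along the level sets leaves in each summand one fixed vector \<open>v\<close>,
  hence a scalar problem in time.\<close>

lemma integral_simple_function_split:
  fixes F :: "real \<Rightarrow> 'b \<Rightarrow> real"
  assumes s: "simple_function (time T) s" and F: "\<And>v. v \<in> s ` {0<..<T} \<Longrightarrow> integrable (time T) (\<lambda>t. F t v)"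
  shows "(\<integral>t. F t (s t) \<partial>time T) =
    (\<Sum>v\<in>s ` {0<..<T}. \<integral>t. indicator (s -` {v} \<inter> {0<..<T}) t * F t v \<partial>time T)"
    and "s -` {v} \<inter> {0<..<T} \<in> sets lebesgue"
proof -
  have sets: "s -` {v} \<inter> {0<..<T} \<in> sets lebesgue" for v
    using simple_functionD(2)[OF s, of "{v}"] by (simp add: sets_restrict_space_iff)
  then show "s -` {v} \<inter> {0<..<T} \<in> sets lebesgue" .
  have fin: "finite (s ` {0<..<T})" using simple_functionD(1)[OF s] by simp
  have "(\<integral>t. F t (s t) \<partial>time T) =
      (\<integral>t. (\<Sum>v\<in>s ` {0<..<T}. indicator (s -` {v} \<inter> {0<..<T}) t * F t v) \<partial>time T)"
  proof (rule Bochner_Integration.integral_cong[OF refl])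
    fix t assume "t \<in> space (time T)"
    then have t: "t \<in> {0<..<T}" by simp
    have "(\<Sum>v\<in>s ` {0<..<T}. indicator (s -` {v} \<inter> {0<..<T}) t * F t v) =
        (\<Sum>v\<in>s ` {0<..<T}. if v = s t then F t v else 0)"
      using t by (intro sum.cong) (auto simp: indicator_def)
    also have "\<dots> = F t (s t)"
      using fin t by (simp add: sum.delta)
    finally show "F t (s t) = (\<Sum>v\<in>s ` {0<..<T}. indicator (s -` {v} \<inter> {0<..<T}) t * F t v)" by simp
  qed
  also have "\<dots> = (\<Sum>v\<in>s ` {0<..<T}. \<integral>t. indicator (s -` {v} \<inter> {0<..<T}) t * F t v \<partial>time T)"
    by (intro Bochner_Integration.integral_sum indicator_integrable_time F sets)
  finally show "(\<integral>t. F t (s t) \<partial>time T) =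
    (\<Sum>v\<in>s ` {0<..<T}. \<integral>t. indicator (s -` {v} \<inter> {0<..<T}) t * F t v \<partial>time T)" .
qed

text \<open>\<open>c t\<close> plays the part of the functional that maps v to (u(t), v), whose
  increments at fixed vectors are known. With a simple function in place of \<open>p\<close> the
  claim is a finite sum of instances of \<open>integral_diff_quot_tendsto\<close>; \<open>p\<close>
  itself is reached by approximation, with errors bounded uniformly in \<open>n\<close>.\<close>

lemma diff_quot_pairing_tendsto:
  assumes T: "0 < T" and w: "w \<in> L2_time T (dual_space X N) (dual_norm X N)" and p: "p \<in> L2_time T X N"
    and c_primitive: "\<And>v s t. v \<in> X \<Longrightarrow>
      c t v - c s v = primitive T (\<lambda>r. w r v) t - primitive T (\<lambda>r. w r v) s"
    and c_diff: "\<And>t u v. u \<in> X \<Longrightarrow> v \<in> X \<Longrightarrow> c t (u - v) = c t u - c t v"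
    and c_int: "\<And>d q. q \<in> L2_time T X N \<Longrightarrow> integrable (time T) (\<lambda>t. c (t + d) (q t))"
    and h: "h \<longlonglongrightarrow> 0" "\<And>n. h n \<noteq> 0"
  shows "(\<lambda>n. \<integral>t. (c (t + h n) (p t) - c t (p t)) / h n \<partial>time T) \<longlonglongrightarrow> (\<integral>t. w t (p t) \<partial>time T)"
proof -
  interpret P: seminormed_pairing "dual_space X N" "dual_norm X N" X N "\<lambda>F v. F v" by (rule dual_pairing)
  define \<Delta> where "\<Delta> n v t = (c (t + h n) v - c t v) / h n" for n v t
  define g where "g r = (dual_norm X N (w r))\<^sup>2" for r
  define C where "C = (\<integral>r. g r \<partial>time T)"
  have wX: "AE r in time T. w r \<in> dual_space X N" using w by (simp add: L2_time_def)
  have g: "integrable (time T) g" using w by (simp add: L2_time_def g_def[abs_def])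
  have g0: "0 \<le> g r" for r by (simp add: g_def)
  have C: "0 \<le> C" using g0 by (simp add: C_def)
  have int\<Delta>: "integrable (time T) (\<lambda>t. \<Delta> n (q t) t)" if "q \<in> L2_time T X N" for n q
    unfolding \<Delta>_def using c_int[OF that, of "h n"] c_int[OF that, of 0] by simp
  have \<Delta>_eq: "\<Delta> n v t = diff_quot (primitive T (\<lambda>r. w r v)) (h n) t" if "v \<in> X" for n v t
    unfolding \<Delta>_def diff_quot_def c_primitive[OF that] ..
  let ?D = "\<lambda>n. diff_quot (primitive T g) (h n)"
  have wle: "AE r in time T. \<bar>w r v\<bar> \<le> a * g r + (N v)\<^sup>2 / a" if "v \<in> X" "0 < a" for a v
    using wX
  proof eventually_elim
    case (elim r)
    have "\<bar>w r v\<bar> \<le> dual_norm X N (w r) * N v" by (rule dual_norm_bound[OF elim that(1)])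
    also have "\<dots> \<le> a * g r + (N v)\<^sup>2 / a"
      using young_inequality[OF that(2), of "dual_norm X N (w r)" "N v"] by (simp add: g_def)
    finally show ?case .
  qed
  \<comment> \<open>The choice of \<open>a\<close> controls the term with the derivative for every
    step, and the other term is small when \<open>q\<close> is small in square mean; the later
    choice for \<open>q\<close> is the approximation error \<open>p t - s k t\<close>.\<close>
  have small: "\<bar>\<integral>t. \<Delta> n (q t) t \<partial>time T\<bar> \<le> a * C + (\<integral>t. (N (q t))\<^sup>2 \<partial>time T) / a"
    "\<bar>\<integral>t. w t (q t) \<partial>time T\<bar> \<le> a * C + (\<integral>t. (N (q t))\<^sup>2 \<partial>time T) / a"
    if q: "q \<in> L2_time T X N" and a: "0 < a" for n q a
  proof -
    have qX: "AE t in time T. q t \<in> X" and q2: "integrable (time T) (\<lambda>t. (N (q t))\<^sup>2)"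
      using q by (auto simp: L2_time_def)
    have "\<bar>\<integral>t. \<Delta> n (q t) t \<partial>time T\<bar> \<le> a * C + (\<integral>t. (N (q t))\<^sup>2 / a \<partial>time T)"
      unfolding C_def
    proof (rule integral_diff_quot_dominated[OF g _ _ h(2) a int\<Delta>[OF q]])
      show "AE t in time T. \<bar>\<Delta> n (q t) t\<bar> \<le> a * ?D n t + (N (q t))\<^sup>2 / a"
        using qX
      proof eventually_elim
        case (elim t)
        show ?case
          unfolding \<Delta>_eq[OF elim]
          by (rule diff_quot_primitive_bound[OF L2_time_dual_apply(1)[OF w elim] g wle[OF elim a] _ h(2)])
            (use a in simp)
      qed
    qed (use g0 T q2 in auto)
    then show "\<bar>\<integral>t. \<Delta> n (q t) t \<partial>time T\<bar> \<le> a * C + (\<integral>t. (N (q t))\<^sup>2 \<partial>time T) / a" by simp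
    have intw: "integrable (time T) (\<lambda>t. w t (q t))" by (rule P.pairing_integrable[OF w q])
    have "\<bar>\<integral>t. w t (q t) \<partial>time T\<bar> \<le> (\<integral>t. \<bar>w t (q t)\<bar> \<partial>time T)"
      by (rule integral_abs_bound)
    also have "\<dots> \<le> (\<integral>t. a * g t + (N (q t))\<^sup>2 / a \<partial>time T)"
    proof (rule integral_mono_AE)
      show "AE t in time T. \<bar>w t (q t)\<bar> \<le> a * g t + (N (q t))\<^sup>2 / a"
        using qX wX
      proof eventually_elim
        case (elim t)
        have "\<bar>w t (q t)\<bar> \<le> dual_norm X N (w t) * N (q t)" by (rule dual_norm_bound[OF elim(2,1)])
        also have "\<dots> \<le> a * g t + (N (q t))\<^sup>2 / a"
          using young_inequality[OF a, of "dual_norm X N (w t)" "N (q t)"] by (simp add: g_def)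
        finally show ?case .
      qed
    qed (use g q2 intw in auto)
    also have "\<dots> = a * C + (\<integral>t. (N (q t))\<^sup>2 \<partial>time T) / a"
      using g q2 by (simp add: C_def)
    finally show "\<bar>\<integral>t. w t (q t) \<partial>time T\<bar> \<le> a * C + (\<integral>t. (N (q t))\<^sup>2 \<partial>time T) / a" .
  qed
  have simple: "(\<lambda>n. \<integral>t. \<Delta> n (s t) t \<partial>time T) \<longlonglongrightarrow> (\<integral>t. w t (s t) \<partial>time T)"
    if s: "simple_function (time T) s" "s ` {0<..<T} \<subseteq> X" for s
  proof -
    have vX: "v \<in> X" if "v \<in> s ` {0<..<T}" for v using that s(2) by blast
    have int1: "integrable (time T) (\<lambda>t. \<Delta> n v t)" if "v \<in> s ` {0<..<T}" for n v
      using int\<Delta>[OF L2_time_const[OF vX[OF that]], of n] .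
    have int2: "integrable (time T) (\<lambda>t. w t v)" if "v \<in> s ` {0<..<T}" for v
      by (rule L2_time_dual_apply(1)[OF w vX[OF that]])
    have split1: "(\<integral>t. \<Delta> n (s t) t \<partial>time T) =
        (\<Sum>v\<in>s ` {0<..<T}. \<integral>t. indicator (s -` {v} \<inter> {0<..<T}) t * \<Delta> n v t \<partial>time T)" for n
      by (rule integral_simple_function_split(1)[OF s(1), of "\<lambda>t v. \<Delta> n v t"]) (rule int1)
    have split2: "(\<integral>t. w t (s t) \<partial>time T) =
        (\<Sum>v\<in>s ` {0<..<T}. \<integral>t. indicator (s -` {v} \<inter> {0<..<T}) t * w t v \<partial>time T)"
      by (rule integral_simple_function_split(1)[OF s(1), of "\<lambda>t v. w t v"]) (rule int2)
    show ?thesis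
      unfolding split1 split2
    proof (rule tendsto_sum)
      fix v assume "v \<in> s ` {0<..<T}"
      then have v: "v \<in> X" by (rule vX)
      show "(\<lambda>n. \<integral>t. indicator (s -` {v} \<inter> {0<..<T}) t * \<Delta> n v t \<partial>time T) \<longlonglongrightarrow>
          (\<integral>t. indicator (s -` {v} \<inter> {0<..<T}) t * w t v \<partial>time T)"
        unfolding \<Delta>_eq[OF v]
        using simple_functionD(2)[OF s(1), of "{v}"]
        by (intro integral_diff_quot_tendsto T L2_time_dual_apply[OF w v] h) (simp add: sets_restrict_space_iff)
    qed
  qed
  obtain s where s: "\<And>k. simple_function (time T) (s k)" "\<And>k. s k ` {0<..<T} \<subseteq> X"
    and slim: "(\<lambda>k. \<integral>t. (N (p t - s k t))\<^sup>2 \<partial>time T) \<longlonglongrightarrow> 0"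
    by (rule L2_time_simple_approx[OF p]) (rule that)
  have sp: "s k \<in> L2_time T X N" for k by (rule L2_time_simple_function[OF s])
  have ps: "(\<lambda>t. p t - s k t) \<in> L2_time T X N" for k by (rule L2_time_diff[OF p sp])
  have pX: "AE t in time T. p t \<in> X" and sX: "AE t in time T. s k t \<in> X" for k
    using p sp[of k] by (auto simp: L2_time_def)
  show ?thesis
    unfolding \<Delta>_def[symmetric]
  proof (rule LIMSEQ_approx)
    fix \<epsilon> :: real assume \<epsilon>: "\<epsilon> > 0"
    define a where "a = \<epsilon> / (2 * (C + 1))"
    have a: "a > 0" using \<epsilon> C by (simp add: a_def)
    have aC: "a * C \<le> \<epsilon> / 2"
      using \<epsilon> C by (simp add: a_def field_simps)
    have "eventually (\<lambda>k. (\<integral>t. (N (p t - s k t))\<^sup>2 \<partial>time T) < a * \<epsilon> / 2) sequentially"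
      using order_tendstoD(2)[OF slim, of "a * \<epsilon> / 2"] a \<epsilon> by simp
    then obtain k where "(\<integral>t. (N (p t - s k t))\<^sup>2 \<partial>time T) < a * \<epsilon> / 2"
      by (auto simp: eventually_sequentially)
    then have "(\<integral>t. (N (p t - s k t))\<^sup>2 \<partial>time T) / a < \<epsilon> / 2"
      using a by (simp only: pos_divide_less_eq[OF a]) (simp add: mult.commute)
    then have k: "a * C + (\<integral>t. (N (p t - s k t))\<^sup>2 \<partial>time T) / a \<le> \<epsilon>"
      using aC by linarith
    show "\<exists>b \<beta>. b \<longlonglongrightarrow> \<beta> \<and> (\<forall>n. \<bar>(\<integral>t. \<Delta> n (p t) t \<partial>time T) - b n\<bar> \<le> \<epsilon>) \<and>
        \<bar>(\<integral>t. w t (p t) \<partial>time T) - \<beta>\<bar> \<le> \<epsilon>"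
    proof (intro exI conjI allI)
      show "(\<lambda>n. \<integral>t. \<Delta> n (s k t) t \<partial>time T) \<longlonglongrightarrow> (\<integral>t. w t (s k t) \<partial>time T)"
        by (rule simple[OF s])
      fix n
      have "(\<integral>t. \<Delta> n (p t) t \<partial>time T) - (\<integral>t. \<Delta> n (s k t) t \<partial>time T) =
          (\<integral>t. \<Delta> n (p t) t - \<Delta> n (s k t) t \<partial>time T)"
        by (rule Bochner_Integration.integral_diff[OF int\<Delta>[OF p] int\<Delta>[OF sp], symmetric])
      also have "\<dots> = (\<integral>t. \<Delta> n (p t - s k t) t \<partial>time T)"
      proof (rule integral_cong_AE)
        show "AE t in time T. \<Delta> n (p t) t - \<Delta> n (s k t) t = \<Delta> n (p t - s k t) t"
          using pX sX[of k]
          by eventually_elim (simp add: \<Delta>_def c_diff diff_divide_distrib[symmetric])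
      qed (use int\<Delta>[OF p] int\<Delta>[OF sp] int\<Delta>[OF ps] in auto)
      finally show "\<bar>(\<integral>t. \<Delta> n (p t) t \<partial>time T) - (\<integral>t. \<Delta> n (s k t) t \<partial>time T)\<bar> \<le> \<epsilon>"
        using small(1)[OF ps a, of n k] k by simp
      have "(\<integral>t. w t (p t) \<partial>time T) - (\<integral>t. w t (s k t) \<partial>time T) = (\<integral>t. w t (p t) - w t (s k t) \<partial>time T)"
        by (rule Bochner_Integration.integral_diff[OF P.pairing_integrable[OF w p] P.pairing_integrable[OF w sp], symmetric])
      also have "\<dots> = (\<integral>t. w t (p t - s k t) \<partial>time T)"
      proof (rule integral_cong_AE)
        show "AE t in time T. w t (p t) - w t (s k t) = w t (p t - s k t)"
          using wX pX sX[of k] by eventually_elim (simp add: P.diff_right)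
      qed (use P.pairing_integrable[OF w p] P.pairing_integrable[OF w sp] P.pairing_integrable[OF w ps] in auto)
      finally show "\<bar>(\<integral>t. w t (p t) \<partial>time T) - (\<integral>t. w t (s k t) \<partial>time T)\<bar> \<le> \<epsilon>"
        using small(2)[OF ps a, of k] k by simp
    qed
  qed
qed

end

section \<open>Continuous representatives and the product rule in time\<close>

lemma test_function_deriv:
  fixes \<phi> :: "real \<Rightarrow> real"
  assumes "\<phi> \<in> test_functions S"
  shows "continuous_on UNIV (deriv \<phi>)"
proof -
  have "Ck (Suc 0) \<phi>" using assms unfolding test_functions_def by blast
  then have d: "(\<phi> has_derivative frechet_derivative \<phi> (at x)) (at x)" for x by (rule Ck_Suc_has_derivative)
  have "frechet_derivative \<phi> (at x) 1 = deriv \<phi> x" for x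
  proof -
    have "(\<phi> has_real_derivative frechet_derivative \<phi> (at x) 1) (at x)"
    proof (rule has_derivative_imp_has_field_derivative[OF d])
      show "y * frechet_derivative \<phi> (at x) 1 = frechet_derivative \<phi> (at x) y" for y
        using linear_scale[OF has_derivative_linear[OF d], of x y 1] by simp
    qed
    then show ?thesis by (simp add: DERIV_imp_deriv)
  qed
  then show ?thesis using test_function_continuous(2)[OF assms, of 1] by simp
qed

text \<open>The representative in \<open>value_at\<close> is prescribed on [0, T] only. Clamping the
  time extends it to a continuous function on the line, constant outside [0, T] just like
  \<open>primitive\<close>; times can then be shifted freely, and the last identity holds for all
  real times.\<close>

lemma continuous_representative:
  fixes u :: "real \<Rightarrow> 'a::euclidean_space \<Rightarrow> real"
  assumes T: "0 < T" and V: "seminormed_space V N" "V \<subseteq> L2 (lebesgue_on \<Omega>)"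
    and le: "\<And>v. v \<in> V \<Longrightarrow> L2_norm (lebesgue_on \<Omega>) v \<le> N v"
    and u: "u \<in> L2_time T V N" and w: "w \<in> L2_time T (dual_space V N) (dual_norm V N)"
    and weak: "weak_time_derivative T \<Omega> V u w" and val: "value_at T \<Omega> u s v0" and s: "s \<in> {0..T}"
  obtains c where "\<And>t. c t \<in> L2 (lebesgue_on \<Omega>)"
    "\<And>t. ((\<lambda>r. L2_norm (lebesgue_on \<Omega>) (c r - c t)) \<longlongrightarrow> 0) (at t)"
    "AE t in time T. AE x in lebesgue_on \<Omega>. c t x = u t x"
    "AE x in lebesgue_on \<Omega>. c s x = v0 x"
    "\<And>t. t \<le> 0 \<Longrightarrow> c t = c 0" "\<And>t. t \<ge> T \<Longrightarrow> c t = c T"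
    "\<And>v t r. v \<in> V \<Longrightarrow> L2_inner (lebesgue_on \<Omega>) (c t) v - L2_inner (lebesgue_on \<Omega>) (c r) v =
      primitive T (\<lambda>t. w t v) t - primitive T (\<lambda>t. w t v) r"
proof -
  let ?L = "lebesgue_on \<Omega>"
  interpret V: seminormed_space V N by (rule V)
  obtain uc where uc: "\<And>t. t \<in> {0..T} \<Longrightarrow> uc t \<in> L2 ?L"
    and ucont: "\<And>t. t \<in> {0..T} \<Longrightarrow> ((\<lambda>r. L2_norm ?L (uc r - uc t)) \<longlongrightarrow> 0) (at t within {0..T})"
    and ueq: "AE t in time T. AE x in ?L. uc t x = u t x" and us: "AE x in ?L. uc s x = v0 x"
    using val unfolding value_at_def L2L2_eq_def by blast
  define cl where "cl t = max 0 (min T t)" for t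
  have cl: "cl t \<in> {0..T}" for t using T by (auto simp: cl_def)
  have cl_id: "cl t = t" if "t \<in> {0..T}" for t using that by (auto simp: cl_def)
  define c where "c t = uc (cl t)" for t
  have uV: "AE t in time T. u t \<in> V" using u by (simp add: L2_time_def)
  have uL: "u \<in> L2_time T (L2 ?L) (L2_norm ?L)"
    using V.L2_time_compose[OF L2_normed.seminormed_space_axioms u, of "\<lambda>v. v" ?L 1] V(2) le V.diff_in by auto
  show thesis
  proof (rule that[of c])
    show "c t \<in> L2 ?L" for t using uc cl by (simp add: c_def)
    show "((\<lambda>r. L2_norm ?L (c r - c t)) \<longlongrightarrow> 0) (at t)" for t
      unfolding LIM_def
    proof (intro allI impI)
      fix e :: real assume e: "0 < e"
      obtain d where d: "d > 0" "\<And>r. r \<in> {0..T} \<Longrightarrow> 0 < dist r (cl t) \<Longrightarrow> dist r (cl t) < d \<Longrightarrow>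
          dist (L2_norm ?L (uc r - uc (cl t))) 0 < e"
        using ucont[OF cl[of t]] e unfolding Lim_within by blast
      have "dist (L2_norm ?L (c r - c t)) 0 < e" if r: "dist r t < d" for r
      \<comment> \<open>The limit hypothesis is punctured, so different times with the same clamped
        value are treated apart. Otherwise it matters that clamping does not increase
        distances.\<close>
      proof (cases "cl r = cl t")
        case True
        then show ?thesis using e by (simp add: c_def)
      next
        case False
        have "dist (cl r) (cl t) \<le> dist r t" by (auto simp: cl_def dist_real_def)
        then show ?thesis using d(2)[OF cl[of r]] False r by (simp add: c_def)
      qed
      then show "\<exists>d>0. \<forall>r. r \<noteq> t \<and> dist r t < d \<longrightarrow> dist (L2_norm ?L (c r - c t)) 0 < e"
        using d(1) by blast
    qed
    show "AE t in time T. AE x in ?L. c t x = u t x"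
      using AE_time_space ueq by eventually_elim (simp add: c_def cl_id)
    show "AE x in ?L. c s x = v0 x" using us s by (simp add: c_def cl_id)
    show "c t = c 0" if "t \<le> 0" for t using that T by (simp add: c_def cl_def)
    show "c t = c T" if "t \<ge> T" for t using that T by (simp add: c_def cl_def)
    fix v t r assume v: "v \<in> V"
    then have vL: "v \<in> L2 ?L" using V(2) by blast
    define G where "G t = L2_inner ?L (uc t) v" for t
    have G: "continuous_on {0..T} G"
      unfolding continuous_on_def
    proof
      fix t assume t: "t \<in> {0..T}"
      have "eventually (\<lambda>r. norm (G r - G t) \<le> L2_norm ?L (uc r - uc t) * L2_norm ?L v) (at t within {0..T})"
        unfolding eventually_at_filter
      proof (intro always_eventually allI impI)
        show "norm (G r - G t) \<le> L2_norm ?L (uc r - uc t) * L2_norm ?L v" if "r \<in> {0..T}" for r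
          using L2_pairing.bounded[OF L2.diff_in[OF uc[OF that] uc[OF t]] vL]
            L2_pairing.diff_left[OF uc[OF that] uc[OF t] vL] by (simp add: G_def)
      qed
      from Lim_null_comparison[OF this tendsto_mult_left_zero[OF ucont[OF t]]]
      show "(G \<longlongrightarrow> G t) (at t within {0..T})" by (rule LIM_zero_cancel)
    qed
    have Gu: "AE t in time T. G t = L2_inner ?L (u t) v"
      using AE_time_space ueq uV
    proof eventually_elim
      case (elim t)
      then show ?case
        unfolding G_def using uc[of t] V(2) vL by (intro L2_inner_cong_AE) auto
    qed
    have um: "(\<lambda>t. L2_inner ?L (u t) v) \<in> borel_measurable (time T)"
      by (rule borel_measurable_integrable[OF L2_pairing.pairing_integrable[OF uL L2_normed.L2_time_const[OF vL]]])
    have Gm: "G \<in> borel_measurable (time T)"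
      by (rule borel_measurable_lebesgue_on_AE[OF _ um Gu]) simp
    have f: "integrable (time T) (\<lambda>t. w t v)" by (rule V.L2_time_dual_apply(1)[OF w v])
    have weakG: "(\<integral>t. deriv \<phi> t * G t \<partial>time T) = - (\<integral>t. \<phi> t * w t v \<partial>time T)"
      if \<phi>: "\<phi> \<in> test_functions {0<..<T}" for \<phi>
    proof -
      have dm: "deriv \<phi> \<in> borel_measurable (time T)"
        by (rule borel_measurable_integrable[OF continuous_integrable_time[OF test_function_deriv[OF \<phi>]]])
      have "(\<integral>t. deriv \<phi> t * G t \<partial>time T) = (\<integral>t. deriv \<phi> t * L2_inner ?L (u t) v \<partial>time T)"
      proof (rule integral_cong_AE)
        show "AE t in time T. deriv \<phi> t * G t = deriv \<phi> t * L2_inner ?L (u t) v"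
          using Gu by eventually_elim simp
      qed (use dm Gm um in auto)
      also have "\<dots> = - (\<integral>t. \<phi> t * w t v \<partial>time T)"
        using weak \<phi> v unfolding weak_time_derivative_def by blast
      finally show ?thesis .
    qed
    have "primitive T f (cl t) = primitive T f t" for f t
      using T primitive_nonpos[of t T f] primitive_nonpos[of 0 T f] primitive_ge[of T t f] primitive_ge[of T T f]
      by (cases "t \<le> 0"; cases "t \<ge> T") (auto simp: cl_def)
    then have "G (cl t) - G 0 = primitive T (\<lambda>t. w t v) t" for t
      using weak_derivative_primitive[OF T G f weakG cl[of t]] by simp
    from this[of t] this[of r]
    show "L2_inner ?L (c t) v - L2_inner ?L (c r) v = primitive T (\<lambda>t. w t v) t - primitive T (\<lambda>t. w t v) r"
      by (simp add: G_def c_def)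
  qed
qed

text \<open>
  The difference quotients of one function to the right and of the other to the left add up to
  a telescoping expression, so that no product of two difference quotients has to be controlled.
\<close>
lemma weak_integration_by_parts:
  fixes u p :: "real \<Rightarrow> 'a::euclidean_space \<Rightarrow> real"
  assumes T: "0 < T" and V: "seminormed_space V N" "V \<subseteq> L2 (lebesgue_on \<Omega>)"
    and le: "\<And>v. v \<in> V \<Longrightarrow> L2_norm (lebesgue_on \<Omega>) v \<le> N v"
    and u: "u \<in> L2_time T V N" and w: "w \<in> L2_time T (dual_space V N) (dual_norm V N)"
    and uw: "weak_time_derivative T \<Omega> V u w" and u0: "value_at T \<Omega> u 0 0"
    and p: "p \<in> L2_time T V N" and z: "z \<in> L2_time T (dual_space V N) (dual_norm V N)"
    and pz: "weak_time_derivative T \<Omega> V p z" and pT: "value_at T \<Omega> p T 0"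
  shows "(\<integral>t. w t (p t) \<partial>time T) + (\<integral>t. z t (u t) \<partial>time T) = 0"
proof -
  let ?L = "lebesgue_on \<Omega>"
  let ?N = "L2_norm ?L"
  interpret V: seminormed_space V N by (rule V)
  have T0: "0 \<in> {0..T}" "T \<in> {0..T}" using T by auto
  obtain c where c: "\<And>t. c t \<in> L2 ?L" "\<And>t. ((\<lambda>r. ?N (c r - c t)) \<longlongrightarrow> 0) (at t)"
    and cu: "AE t in time T. AE x in ?L. c t x = u t x" and c0: "AE x in ?L. c 0 x = 0 x"
    and cl: "\<And>t. t \<le> 0 \<Longrightarrow> c t = c 0" and cr: "\<And>t. t \<ge> T \<Longrightarrow> c t = c T"
    and cprim: "\<And>v t r. v \<in> V \<Longrightarrow> L2_inner ?L (c t) v - L2_inner ?L (c r) v =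
      primitive T (\<lambda>t. w t v) t - primitive T (\<lambda>t. w t v) r"
    by (rule continuous_representative[OF T V _ u w uw u0 T0(1)]) (assumption | rule le that)+
  obtain k where k: "\<And>t. k t \<in> L2 ?L" "\<And>t. ((\<lambda>r. ?N (k r - k t)) \<longlongrightarrow> 0) (at t)"
    and kp: "AE t in time T. AE x in ?L. k t x = p t x" and kT: "AE x in ?L. k T x = 0 x"
    and kl: "\<And>t. t \<le> 0 \<Longrightarrow> k t = k 0" and kr: "\<And>t. t \<ge> T \<Longrightarrow> k t = k T"
    and kprim: "\<And>v t r. v \<in> V \<Longrightarrow> L2_inner ?L (k t) v - L2_inner ?L (k r) v =
      primitive T (\<lambda>t. z t v) t - primitive T (\<lambda>t. z t v) r"
    by (rule continuous_representative[OF T V _ p z pz pT T0(2)]) (assumption | rule le that)+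
  have toL2: "q \<in> L2_time T (L2 ?L) ?N" if "q \<in> L2_time T V N" for q
    using V.L2_time_compose[OF L2_normed.seminormed_space_axioms that, of "\<lambda>v. v" ?L 1] V(2) le V.diff_in by auto
  have shift: "(\<lambda>t. a (t + d)) \<in> L2_time T (L2 ?L) ?N"
    if "\<And>t. a t \<in> L2 ?L" "\<And>t. ((\<lambda>r. ?N (a r - a t)) \<longlongrightarrow> 0) (at t)" for a :: "real \<Rightarrow> 'a \<Rightarrow> real" and d
  proof (rule L2_normed.L2_time_continuous)
    show "((\<lambda>r. ?N (a (r + d) - a (t + d))) \<longlongrightarrow> 0) (at t)" for t
      by (rule L2_normed.seminorm_tendsto_compose[OF that(2)]) (auto intro!: tendsto_intros)
  qed (rule that)
  have int: "integrable (time T) (\<lambda>t. L2_inner ?L (a (t + d)) (q t))"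
    if "\<And>t. a t \<in> L2 ?L" "\<And>t. ((\<lambda>r. ?N (a r - a t)) \<longlongrightarrow> 0) (at t)" "q \<in> L2_time T V N"
    for a :: "real \<Rightarrow> 'a \<Rightarrow> real" and d q
    by (rule L2_pairing.pairing_integrable[OF shift[OF that(1,2)] toL2[OF that(3)]])
  have diff: "L2_inner ?L (a t) (v - v') = L2_inner ?L (a t) v - L2_inner ?L (a t) v'"
    if "\<And>t. a t \<in> L2 ?L" "v \<in> V" "v' \<in> V" for a :: "real \<Rightarrow> 'a \<Rightarrow> real" and t v v'
    using that V(2) by (intro L2_pairing.diff_right) auto
  define h where "h n = inverse (real (Suc n))" for n
  have h: "h \<longlonglongrightarrow> 0" "\<And>n. h n > 0" unfolding h_def by (rule LIMSEQ_inverse_real_of_nat) simp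
  have h': "(\<lambda>n. - h n) \<longlonglongrightarrow> 0" using tendsto_minus[OF h(1)] by simp
  \<comment> \<open>Forward quotients of \<open>u\<close> are paired with \<open>p\<close>, and in
    \<open>B\<close> backward quotients of \<open>p\<close> with \<open>u\<close>. Each sequence
    converges to one of the two integrals in the claim.\<close>
  define A where "A n = (\<integral>t. (L2_inner ?L (c (t + h n)) (p t) - L2_inner ?L (c t) (p t)) / h n \<partial>time T)" for n
  define B where "B n = (\<integral>t. (L2_inner ?L (k (t + - h n)) (u t) - L2_inner ?L (k t) (u t)) / - h n \<partial>time T)" for n
  have A: "A \<longlonglongrightarrow> (\<integral>t. w t (p t) \<partial>time T)"
    unfolding A_def
  proof (rule V.diff_quot_pairing_tendsto[where c = "\<lambda>t v. L2_inner ?L (c t) v", OF T w p])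
    show "h n \<noteq> 0" for n using h(2)[of n] by simp
  qed (fact cprim diff[OF c(1)] int[OF c] h(1))+
  have B: "B \<longlonglongrightarrow> (\<integral>t. z t (u t) \<partial>time T)"
    unfolding B_def
  proof (rule V.diff_quot_pairing_tendsto[where c = "\<lambda>t v. L2_inner ?L (k t) v", OF T z u])
    show "- h n \<noteq> 0" for n using h(2)[of n] by simp
  qed (fact kprim diff[OF k(1)] int[OF k] h')+
  define g where "g n t = L2_inner ?L (c (t + h n)) (k t)" for n t
  have g: "continuous_on UNIV (g n)" for n
    unfolding continuous_on_def g_def
  proof
    fix x
    have "((\<lambda>t. t + h n) \<longlongrightarrow> x + h n) (at x)" by (intro tendsto_intros)
    from L2_pairing.pairing_tendsto[OF c(1) c(1) L2_normed.seminorm_tendsto_compose[OF c(2) this] k(1) k(1) k(2)]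
    show "((\<lambda>t. L2_inner ?L (c (t + h n)) (k t)) \<longlongrightarrow> L2_inner ?L (c (x + h n)) (k x)) (at x)" .
  qed
  \<comment> \<open>The terms (c t, k t) cancel by symmetry, and what remains is g n t - g n (t - h
    n), divided by h n.\<close>
  have AB: "A n + B n = (\<integral>t. diff_quot (g n) (- h n) t \<partial>time T)" for n
  proof -
    have "A n + B n = (\<integral>t. (L2_inner ?L (c (t + h n)) (p t) - L2_inner ?L (c t) (p t)) / h n +
        (L2_inner ?L (k (t + - h n)) (u t) - L2_inner ?L (k t) (u t)) / - h n \<partial>time T)"
      unfolding A_def B_def
      using int[OF c p, of "h n"] int[OF c p, of 0] int[OF k u, of "- h n"] int[OF k u, of 0]
      by (intro Bochner_Integration.integral_add[symmetric]) auto
    also have "\<dots> = (\<integral>t. diff_quot (g n) (- h n) t \<partial>time T)"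
    proof (rule integral_cong_AE)
      have uV: "AE t in time T. u t \<in> V" and pV: "AE t in time T. p t \<in> V"
        using u p by (auto simp: L2_time_def)
      then show "AE t in time T. (L2_inner ?L (c (t + h n)) (p t) - L2_inner ?L (c t) (p t)) / h n +
          (L2_inner ?L (k (t + - h n)) (u t) - L2_inner ?L (k t) (u t)) / - h n = diff_quot (g n) (- h n) t"
        using cu kp
      proof eventually_elim
        case (elim t)
        have uL: "u t \<in> L2 ?L" and pL: "p t \<in> L2 ?L" using elim V(2) by auto
        have p': "L2_inner ?L x (p t) = L2_inner ?L x (k t)" if "x \<in> L2 ?L" for x
          using elim(4) by (intro L2_inner_cong_AE that pL k) auto
        have u': "L2_inner ?L x (u t) = L2_inner ?L (c t) x" if "x \<in> L2 ?L" for x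
          unfolding L2.sym[OF c(1) that] using elim(3) by (intro L2_inner_cong_AE that uL c) auto
        show ?case
          using h(2)[of n] by (simp add: p' u' c k g_def diff_quot_def field_simps)
      qed
      show "diff_quot (g n) (- h n) \<in> borel_measurable (time T)"
        by (intro borel_measurable_integrable continuous_integrable_time diff_quot_continuous g)
      show "(\<lambda>t. (L2_inner ?L (c (t + h n)) (p t) - L2_inner ?L (c t) (p t)) / h n +
        (L2_inner ?L (k (t + - h n)) (u t) - L2_inner ?L (k t) (u t)) / - h n) \<in> borel_measurable (time T)"
        using int[OF c p, of "h n"] int[OF c p, of 0] int[OF k u, of "- h n"] int[OF k u, of 0]
        by (intro borel_measurable_integrable Bochner_Integration.integrable_add) auto
    qed
    finally show ?thesis .
  qed
  \<comment> \<open>The integral is the difference of the means of \<open>g n\<close> over the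
    intervals of length \<open>h n\<close> that end at T and at 0; the mean value theorem turns
    these means into values of \<open>g n\<close>.\<close>
  have "\<exists>x y. A n + B n = g n x - g n y \<and> T - h n < x \<and> x < T \<and> - h n < y \<and> y < 0" for n
  proof -
    obtain K where K: "\<And>x. (K has_real_derivative g n x) (at x)"
      using antiderivative_on_UNIV[OF g] by blast
    have "A n + B n = (\<integral>t. indicator {0<..<T} t * diff_quot (g n) (- h n) t \<partial>time T)"
      unfolding AB by (intro Bochner_Integration.integral_cong) auto
    also have "\<dots> = diff_quot K (- h n) T - diff_quot K (- h n) 0"
      by (rule integral_diff_quot[OF g K]) (use T in auto)
    finally have eq: "A n + B n = diff_quot K (- h n) T - diff_quot K (- h n) 0" .
    have hn: "- h n \<noteq> 0" using h(2)[of n] by simp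
    obtain x where "diff_quot K (- h n) T = g n x" "min T (T + - h n) < x" "x < max T (T + - h n)"
      by (rule diff_quot_mean_value[OF K hn])
    moreover obtain y where "diff_quot K (- h n) 0 = g n y" "min 0 (0 + - h n) < y" "y < max 0 (0 + - h n)"
      by (rule diff_quot_mean_value[OF K hn])
    ultimately show ?thesis using h(2)[of n] eq by (intro exI[of _ x] exI[of _ y]) auto
  qed
  then obtain x y where xy: "\<And>n. A n + B n = g n (x n) - g n (y n)" "\<And>n. T - h n < x n" "\<And>n. x n < T"
    "\<And>n. - h n < y n" "\<And>n. y n < 0"
    by metis
  have x: "x \<longlonglongrightarrow> T"
    by (rule tendsto_sandwich[of "\<lambda>n. T - h n" _ _ "\<lambda>n. T"])
      (use xy(2,3) tendsto_diff[OF tendsto_const h(1), of T] in \<open>auto simp: less_imp_le\<close>)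
  have y: "(\<lambda>n. y n + h n) \<longlonglongrightarrow> 0"
    by (rule tendsto_sandwich[of "\<lambda>n. 0" _ _ h])
      (use xy(4,5) h(1) in \<open>auto simp: less_imp_le intro!: always_eventually\<close>, (smt (verit))+)
  \<comment> \<open>Since x n + h n exceeds T and y n is negative, the constant extensions freeze
    \<open>c\<close> at T here and \<open>k\<close> at 0 in \<open>gy\<close>.\<close>
  have gx: "g n (x n) = L2_inner ?L (c T) (k (x n))" for n
    unfolding g_def using cr[of "x n + h n"] xy(2)[of n] by simp
  have gy: "g n (y n) = L2_inner ?L (c (y n + h n)) (k 0)" for n
    unfolding g_def using kl[of "y n"] xy(5)[of n] by simp
  have "(\<lambda>n. g n (x n)) \<longlonglongrightarrow> L2_inner ?L (c T) (k T)"
    unfolding gx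
    by (rule L2_pairing.pairing_tendsto[OF c(1) c(1) _ k(1) k(1) L2_normed.seminorm_tendsto_compose[OF k(2) x]]) simp
  \<comment> \<open>The terminal condition on \<open>p\<close> enters here; the initial condition on
    \<open>u\<close> does the same for the limit at time 0 below.\<close>
  moreover have "L2_inner ?L (c T) (k T) = 0"
    using L2_inner_cong_AE[OF c(1) c(1) k(1) L2.zero_in _ kT, of T T] by (simp add: L2_inner_def)
  ultimately have 1: "(\<lambda>n. g n (x n)) \<longlonglongrightarrow> 0" by simp
  have "(\<lambda>n. g n (y n)) \<longlonglongrightarrow> L2_inner ?L (c 0) (k 0)"
    unfolding gy
    by (rule L2_pairing.pairing_tendsto[OF c(1) c(1) L2_normed.seminorm_tendsto_compose[OF c(2) y] k(1) k(1)]) simp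
  moreover have "L2_inner ?L (c 0) (k 0) = 0"
    using L2_inner_cong_AE[OF c(1) L2.zero_in k(1) k(1) c0, of 0 0] by (simp add: L2_inner_def)
  ultimately have 2: "(\<lambda>n. g n (y n)) \<longlonglongrightarrow> 0" by simp
  have "(\<lambda>n. A n + B n) \<longlonglongrightarrow> 0" using tendsto_diff[OF 1 2] by (simp add: xy(1))
  from LIMSEQ_unique[OF tendsto_add[OF A B] this] show ?thesis .
qed


subsection \<open>The spaces $L^2(0,T;L^2)$\<close>

lemma L2L2_semi_inner: "semi_inner_space (L2L2 T M) (L2L2_inner T M)"
proof
  have AE: "AE t in time T. u t \<in> L2 M" if "u \<in> L2L2 T M" for u
    using that by (simp add: L2L2_def L2_time_def)
  have int: "integrable (time T) (\<lambda>t. L2_inner M (u t) (v t))" if "u \<in> L2L2 T M" "v \<in> L2L2 T M" for u v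
    using that unfolding L2L2_def by (rule L2_pairing.pairing_integrable)
  show "0 \<in> L2L2 T M"
    using L2_normed.L2_time_const[OF L2.zero_in[of M], where T = T] by (simp add: L2L2_def zero_fun_def)
  fix u v w :: "real \<Rightarrow> 'a \<Rightarrow> real" and c :: real
  assume u: "u \<in> L2L2 T M"
  show cu: "c *\<^sub>R u \<in> L2L2 T M"
    using L2_normed.L2_time_scaleR[OF u[unfolded L2L2_def], of c] by (simp add: L2L2_def scaleR_fun_def[of c u])
  show "0 \<le> L2L2_inner T M u u"
    unfolding L2L2_inner_def using AE[OF u]
    by (intro integral_nonneg_AE) (auto elim!: eventually_mono simp: L2.nonneg)
  assume v: "v \<in> L2L2 T M"
  show uv: "u + v \<in> L2L2 T M"
    using L2_normed.L2_time_add[OF u[unfolded L2L2_def] v[unfolded L2L2_def]]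
    by (simp add: L2L2_def plus_fun_def[of u v])
  show "L2L2_inner T M u v = L2L2_inner T M v u"
    by (simp add: L2L2_inner_def L2_inner_def mult.commute)
  have "L2L2_inner T M (c *\<^sub>R u) v = (\<integral>t. c * L2_inner M (u t) (v t) \<partial>time T)"
    unfolding L2L2_inner_def
  proof (rule integral_cong_AE)
    show "AE t in time T. L2_inner M ((c *\<^sub>R u) t) (v t) = c * L2_inner M (u t) (v t)"
      using AE[OF u] AE[OF v] by eventually_elim (simp add: scaleR_fun_def[of c u] L2.ip_scaleR_left)
  qed (use int[OF cu v] int[OF u v] in auto)
  then show "L2L2_inner T M (c *\<^sub>R u) v = c * L2L2_inner T M u v"
    by (simp add: L2L2_inner_def)
  assume w: "w \<in> L2L2 T M"
  have "L2L2_inner T M (u + v) w = (\<integral>t. L2_inner M (u t) (w t) + L2_inner M (v t) (w t) \<partial>time T)"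
    unfolding L2L2_inner_def
  proof (rule integral_cong_AE)
    show "AE t in time T. L2_inner M ((u + v) t) (w t) = L2_inner M (u t) (w t) + L2_inner M (v t) (w t)"
      using AE[OF u] AE[OF v] AE[OF w] by eventually_elim (simp add: L2.ip_add_left)
  qed (use int[OF uv w] int[OF u w] int[OF v w] in auto)
  then show "L2L2_inner T M (u + v) w = L2L2_inner T M u w + L2L2_inner T M v w"
    using int[OF u w] int[OF v w] by (simp add: L2L2_inner_def)
qed

interpretation LL: semi_inner_space "L2L2 T M" "L2L2_inner T M" for T M
  by (rule L2L2_semi_inner)

lemma L2L2_norm_square: "u \<in> L2L2 T M \<Longrightarrow> (L2L2_norm T M u)\<^sup>2 = L2L2_inner T M u u"
  by (simp add: L2L2_norm_def LL.nonneg)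

lemma AE_L2L2: "u \<in> L2L2 T M \<Longrightarrow> AE t in time T. u t \<in> L2 M"
  by (simp add: L2L2_def L2_time_def)

lemma L2L2_pairing_integrable:
  "u \<in> L2L2 T M \<Longrightarrow> v \<in> L2L2 T M \<Longrightarrow> integrable (time T) (\<lambda>t. L2_inner M (u t) (v t))"
  unfolding L2L2_def by (rule L2_pairing.pairing_integrable)

lemma L2L2_inner_cong:
  assumes "u \<in> L2L2 T M" "u' \<in> L2L2 T M" "v \<in> L2L2 T M" "v' \<in> L2L2 T M"
    and "L2L2_eq T M u u'" "L2L2_eq T M v v'"
  shows "L2L2_inner T M u v = L2L2_inner T M u' v'"
  unfolding L2L2_inner_def
proof (rule integral_cong_AE)
  show "AE t in time T. L2_inner M (u t) (v t) = L2_inner M (u' t) (v' t)"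
    using assms(5,6)[unfolded L2L2_eq_def] AE_L2L2[OF assms(1)] AE_L2L2[OF assms(2)]
      AE_L2L2[OF assms(3)] AE_L2L2[OF assms(4)]
    by eventually_elim (rule L2_inner_cong_AE)
qed (use L2L2_pairing_integrable[OF assms(1,3)] L2L2_pairing_integrable[OF assms(2,4)] in auto)

text \<open>A nonnegative integrand with integral zero vanishes almost everywhere, used once in time
  and once in space. This turns a vanishing norm into equality in the Bochner space.\<close>

lemma L2L2_inner_self_eq_0:
  assumes "u \<in> L2L2 T M" shows "L2L2_inner T M u u = 0 \<longleftrightarrow> L2L2_eq T M u 0"
proof -
  have "L2L2_inner T M u u = 0 \<longleftrightarrow> (AE t in time T. L2_inner M (u t) (u t) = 0)"
    unfolding L2L2_inner_def using AE_L2L2[OF assms]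
    by (intro integral_nonneg_eq_0_iff_AE L2L2_pairing_integrable assms)
      (auto elim!: eventually_mono simp: L2.nonneg)
  also have "\<dots> \<longleftrightarrow> L2L2_eq T M u 0"
    unfolding L2L2_eq_def
  proof (rule eventually_subst)
    show "AE t in time T. (L2_inner M (u t) (u t) = 0) = (AE x in M. u t x = 0 t x)"
      using AE_L2L2[OF assms] by eventually_elim (simp add: L2_inner_self_eq_0)
  qed
  finally show ?thesis .
qed

lemma L2L2_eq_diff: "L2L2_eq T M u u' \<Longrightarrow> L2L2_eq T M (u - v) (u' - v)"
  unfolding L2L2_eq_def by (elim eventually_mono) auto


subsection \<open>Linearity of the state equation\<close>

lemma value_at_add:
  assumes "value_at T \<Omega> u s v" "value_at T \<Omega> u' s v'"
  shows "value_at T \<Omega> (\<lambda>t. u t + u' t) s (v + v')"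
proof -
  let ?L = "lebesgue_on \<Omega>"
  obtain a where a: "\<And>t. t \<in> {0..T} \<Longrightarrow> a t \<in> L2 ?L"
      "\<And>t. t \<in> {0..T} \<Longrightarrow> ((\<lambda>r. L2_norm ?L (a r - a t)) \<longlongrightarrow> 0) (at t within {0..T})"
      "L2L2_eq T ?L a u" "AE x in ?L. a s x = v x"
    using assms(1) unfolding value_at_def by blast
  obtain b where b: "\<And>t. t \<in> {0..T} \<Longrightarrow> b t \<in> L2 ?L"
      "\<And>t. t \<in> {0..T} \<Longrightarrow> ((\<lambda>r. L2_norm ?L (b r - b t)) \<longlongrightarrow> 0) (at t within {0..T})"
      "L2L2_eq T ?L b u'" "AE x in ?L. b s x = v' x"
    using assms(2) unfolding value_at_def by blast
  have cont: "((\<lambda>r. L2_norm ?L ((a r + b r) - (a t + b t))) \<longlongrightarrow> 0) (at t within {0..T})" if t: "t \<in> {0..T}" for t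
  proof (rule Lim_null_comparison[OF _ tendsto_add_zero[OF a(2)[OF t] b(2)[OF t]]])
    have "norm (L2_norm ?L ((a r + b r) - (a t + b t))) \<le> L2_norm ?L (a r - a t) + L2_norm ?L (b r - b t)"
      if r: "r \<in> {0..T}" for r
    proof -
      have mem: "a r - a t \<in> L2 ?L" "b r - b t \<in> L2 ?L" using a(1) b(1) r t by (auto intro: L2.diff_in)
      have eq: "(a r + b r) - (a t + b t) = (a r - a t) + (b r - b t)" by simp
      show ?thesis
        unfolding eq using L2_normed.triangle[OF mem] L2_normed.seminorm_nonneg[OF L2.add_in[OF mem]] by simp
    qed
    then show "eventually (\<lambda>r. norm (L2_norm ?L ((a r + b r) - (a t + b t))) \<le>
        L2_norm ?L (a r - a t) + L2_norm ?L (b r - b t)) (at t within {0..T})"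
      unfolding eventually_at_filter by (intro always_eventually allI impI)
  qed
  have "L2L2_eq T ?L (\<lambda>t. a t + b t) (\<lambda>t. u t + u' t)"
    using a(3) b(3) unfolding L2L2_eq_def
  proof eventually_elim
    case (elim t)
    then show ?case by eventually_elim simp
  qed
  moreover have "AE x in ?L. (a s + b s) x = (v + v') x"
    using a(4) b(4) by eventually_elim simp
  ultimately show ?thesis
    unfolding value_at_def using a(1) b(1) cont
    by (intro exI[of _ "\<lambda>t. a t + b t"]) (auto intro: L2.add_in)
qed

lemma value_at_scaleR:
  assumes "value_at T \<Omega> u s v" shows "value_at T \<Omega> (\<lambda>t. c *\<^sub>R u t) s (c *\<^sub>R v)"
proof -
  let ?L = "lebesgue_on \<Omega>"
  obtain a where a: "\<And>t. t \<in> {0..T} \<Longrightarrow> a t \<in> L2 ?L"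
      "\<And>t. t \<in> {0..T} \<Longrightarrow> ((\<lambda>r. L2_norm ?L (a r - a t)) \<longlongrightarrow> 0) (at t within {0..T})"
      "L2L2_eq T ?L a u" "AE x in ?L. a s x = v x"
    using assms(1) unfolding value_at_def by blast
  have cont: "((\<lambda>r. L2_norm ?L (c *\<^sub>R a r - c *\<^sub>R a t)) \<longlongrightarrow> 0) (at t within {0..T})" if t: "t \<in> {0..T}" for t
  proof (rule Lim_null_comparison[OF _ tendsto_mult_right_zero[OF a(2)[OF t], of "\<bar>c\<bar>"]])
    have "norm (L2_norm ?L (c *\<^sub>R a r - c *\<^sub>R a t)) \<le> \<bar>c\<bar> * L2_norm ?L (a r - a t)"
      if r: "r \<in> {0..T}" for r
    proof -
      have mem: "a r - a t \<in> L2 ?L" using a(1) r t by (auto intro: L2.diff_in)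
      have "L2_norm ?L (c *\<^sub>R a r - c *\<^sub>R a t) = \<bar>c\<bar> * L2_norm ?L (a r - a t)"
        using L2_normed.homogeneous[OF mem, of c] by (simp add: scaleR_diff_right)
      then show ?thesis using L2_normed.seminorm_nonneg[OF mem] by simp
    qed
    then show "eventually (\<lambda>r. norm (L2_norm ?L (c *\<^sub>R a r - c *\<^sub>R a t)) \<le> \<bar>c\<bar> * L2_norm ?L (a r - a t)) (at t within {0..T})"
      unfolding eventually_at_filter by (intro always_eventually allI impI)
  qed
  have "L2L2_eq T ?L (\<lambda>t. c *\<^sub>R a t) (\<lambda>t. c *\<^sub>R u t)"
    using a(3) unfolding L2L2_eq_def
  proof eventually_elim
    case (elim t)
    then show ?case by eventually_elim (simp add: scaleR_fun_def)
  qed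
  moreover have "AE x in ?L. (c *\<^sub>R a s) x = (c *\<^sub>R v) x"
    using a(4) by eventually_elim (simp add: scaleR_fun_def)
  ultimately show ?thesis
    unfolding value_at_def using a(1) cont
    by (intro exI[of _ "\<lambda>t. c *\<^sub>R a t"]) (auto intro: L2.scaleR_in)
qed

lemma weak_time_derivative_add:
  fixes u u' :: "real \<Rightarrow> 'a::euclidean_space \<Rightarrow> real"
  assumes V: "seminormed_space V N" "V \<subseteq> L2 (lebesgue_on \<Omega>)"
    and u: "u \<in> L2L2 T (lebesgue_on \<Omega>)" "u' \<in> L2L2 T (lebesgue_on \<Omega>)"
    and w: "w \<in> L2_time T (dual_space V N) (dual_norm V N)" "w' \<in> L2_time T (dual_space V N) (dual_norm V N)"
    and uw: "weak_time_derivative T \<Omega> V u w" "weak_time_derivative T \<Omega> V u' w'"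
  shows "weak_time_derivative T \<Omega> V (\<lambda>t. u t + u' t) (\<lambda>t. w t + w' t)"
  unfolding weak_time_derivative_def
proof (intro ballI)
  let ?L = "lebesgue_on \<Omega>"
  interpret V: seminormed_space V N by (rule V)
  fix \<phi> v assume \<phi>: "\<phi> \<in> test_functions {0<..<T}" and v: "v \<in> V"
  then have vL: "v \<in> L2 ?L" using V by blast
  have vc: "(\<lambda>t. v) \<in> L2L2 T ?L" unfolding L2L2_def by (rule L2_normed.L2_time_const[OF vL])
  have iu: "integrable (time T) (\<lambda>t. deriv \<phi> t * L2_inner ?L (x t) v)" if "x \<in> L2L2 T ?L" for x
    by (rule continuous_mult_integrable_time[OF test_function_deriv[OF \<phi>] L2L2_pairing_integrable[OF that vc]])
  have iw: "integrable (time T) (\<lambda>t. \<phi> t * y t v)" if "y \<in> L2_time T (dual_space V N) (dual_norm V N)" for y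
    by (rule continuous_mult_integrable_time[OF test_function_continuous(1)[OF \<phi>] V.L2_time_dual_apply(1)[OF that v]])
  have uu: "(\<lambda>t. u t + u' t) \<in> L2L2 T ?L" using LL.add_in[OF u] by (simp add: plus_fun_def[of u u'])
  have "(\<integral>t. deriv \<phi> t * L2_inner ?L (u t + u' t) v \<partial>time T) =
      (\<integral>t. deriv \<phi> t * L2_inner ?L (u t) v + deriv \<phi> t * L2_inner ?L (u' t) v \<partial>time T)"
  proof (rule integral_cong_AE)
    show "AE t in time T. deriv \<phi> t * L2_inner ?L (u t + u' t) v =
        deriv \<phi> t * L2_inner ?L (u t) v + deriv \<phi> t * L2_inner ?L (u' t) v"
      using AE_L2L2[OF u(1)] AE_L2L2[OF u(2)]
      by eventually_elim (simp add: L2.ip_add_left vL distrib_left)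
  qed (use iu[OF uu] iu[OF u(1)] iu[OF u(2)] in auto)
  also have "\<dots> = (\<integral>t. deriv \<phi> t * L2_inner ?L (u t) v \<partial>time T) + (\<integral>t. deriv \<phi> t * L2_inner ?L (u' t) v \<partial>time T)"
    using iu[OF u(1)] iu[OF u(2)] by simp
  also have "\<dots> = - (\<integral>t. \<phi> t * w t v \<partial>time T) - (\<integral>t. \<phi> t * w' t v \<partial>time T)"
    using uw \<phi> v by (simp add: weak_time_derivative_def)
  also have "\<dots> = - (\<integral>t. \<phi> t * (w t + w' t) v \<partial>time T)"
    using iw[OF w(1)] iw[OF w(2)] by (simp add: distrib_left)
  finally show "(\<integral>t. deriv \<phi> t * L2_inner ?L (u t + u' t) v \<partial>time T) = - (\<integral>t. \<phi> t * (w t + w' t) v \<partial>time T)" .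
qed

lemma weak_time_derivative_scaleR:
  fixes u :: "real \<Rightarrow> 'a::euclidean_space \<Rightarrow> real"
  assumes "weak_time_derivative T \<Omega> V u w"
  shows "weak_time_derivative T \<Omega> V (\<lambda>t. c *\<^sub>R u t) (\<lambda>t. c *\<^sub>R w t)"
  using assms unfolding weak_time_derivative_def L2_inner_def
  by (simp add: scaleR_fun_def mult.assoc mult.left_commute[of _ c])

section \<open>States and adjoint states for arbitrary controls\<close>

locale control_problem =
  \<Gamma>1: lipschitz_trace \<Omega> tr \<Gamma>1 + \<Gamma>2: lipschitz_trace \<Omega> tr \<Gamma>2
  for \<Omega> :: "'a::euclidean_space set" and tr and \<Gamma>1 \<Gamma>2 :: "'a set" +
  fixes T :: real and g :: "real \<Rightarrow> 'a \<Rightarrow> real" and vb :: "'a \<Rightarrow> real"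
  assumes T_pos: "0 < T" and vb: "vb \<in> H1 \<Omega>"
begin

abbreviation "V \<equiv> V0 \<Omega> tr \<Gamma>1"
abbreviation "VN \<equiv> H1_norm \<Omega>"
abbreviation "L \<equiv> lebesgue_on \<Omega>"
abbreviation "S \<equiv> surface_on \<Gamma>2"

sublocale V: seminormed_space V VN
  by (rule \<Gamma>1.V0_seminormed)

sublocale D: semi_inner_space "H1 \<Omega>" "dirichlet_form \<Omega>"
  by (rule dirichlet_semi_inner[OF \<Gamma>1.\<Omega>_open \<Gamma>1.\<Omega>_bounded])

sublocale V': seminormed_space "dual_space V VN" "dual_norm V VN"
  by (rule V.dual_seminormed)

lemma V_H1: "v \<in> V \<Longrightarrow> v \<in> H1 \<Omega>"
  using \<Gamma>1.V0_subset_H1 by blast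

lemma H1_L2: "v \<in> H1 \<Omega> \<Longrightarrow> v \<in> L2 L"
  by (simp add: H1_def)

lemma V_L2: "V \<subseteq> L2 L"
  using V_H1 H1_L2 by blast

lemma L2_time_V_L2L2: "u \<in> L2_time T V VN \<Longrightarrow> u \<in> L2L2 T L"
  unfolding L2L2_def
  using V.L2_time_compose[OF L2_normed.seminormed_space_axioms, of u T "\<lambda>v. v" L 1] V_L2
  by (auto simp: L2_norm_le_H1_norm)

lemma state_L2L2:
  assumes "is_state T \<Omega> tr \<Gamma>1 \<Gamma>2 g vb q u" shows "u \<in> L2L2 T L"
proof -
  have "(\<lambda>t. u t - vb) \<in> L2L2 T L"
    using assms unfolding is_state_def by (intro L2_time_V_L2L2) simp
  moreover have "(\<lambda>t. vb) \<in> L2L2 T L"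
    unfolding L2L2_def using vb H1_L2 by (intro L2_normed.L2_time_const)
  ultimately have "(\<lambda>t. u t - vb) + (\<lambda>t. vb) \<in> L2L2 T L" by (rule LL.add_in)
  then show ?thesis by (simp add: plus_fun_def[of "\<lambda>t. u t - vb"])
qed

lemma state_H1:
  assumes "is_state T \<Omega> tr \<Gamma>1 \<Gamma>2 g vb q u" shows "AE t in time T. u t \<in> H1 \<Omega>"
proof -
  have "AE t in time T. u t - vb \<in> V" using assms by (simp add: is_state_def L2_time_def)
  then show ?thesis
  proof eventually_elim
    case (elim t)
    from \<Gamma>1.H1.add_in[OF V_H1[OF this] vb] show ?case by simp
  qed
qed

text \<open>The data \<open>g\<close> and \<open>vb\<close> cancel. What is left is a problem with
  zero initial value whose solution takes values in \<open>V\<close>, and so may itself serve as a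
  test function in the adjoint equation.\<close>

lemma state_diff:
  assumes u1: "is_state T \<Omega> tr \<Gamma>1 \<Gamma>2 g vb q1 u1" and q1: "q1 \<in> L2L2 T S"
    and u2: "is_state T \<Omega> tr \<Gamma>1 \<Gamma>2 g vb q2 u2" and q2: "q2 \<in> L2L2 T S"
  obtains w where "w \<in> L2_time T (dual_space V VN) (dual_norm V VN)"
    "(\<lambda>t. u1 t - u2 t) \<in> L2_time T V VN"
    "weak_time_derivative T \<Omega> V (\<lambda>t. u1 t - u2 t) w"
    "value_at T \<Omega> (\<lambda>t. u1 t - u2 t) 0 0"
    "AE t in time T. \<forall>v\<in>V. w t v + dirichlet_form \<Omega> (u1 t - u2 t) v = - L2_inner S (q1 t - q2 t) (tr v)"
proof -
  obtain w1 where w1: "w1 \<in> L2_time T (dual_space V VN) (dual_norm V VN)" "weak_time_derivative T \<Omega> V u1 w1"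
    "AE t in time T. \<forall>v\<in>V. w1 t v + dirichlet_form \<Omega> (u1 t) v = L2_inner L (g t) v - L2_inner S (q1 t) (tr v)"
    using u1 unfolding is_state_def by blast
  obtain w2 where w2: "w2 \<in> L2_time T (dual_space V VN) (dual_norm V VN)" "weak_time_derivative T \<Omega> V u2 w2"
    "AE t in time T. \<forall>v\<in>V. w2 t v + dirichlet_form \<Omega> (u2 t) v = L2_inner L (g t) v - L2_inner S (q2 t) (tr v)"
    using u2 unfolding is_state_def by blast
  have LL: "u1 \<in> L2L2 T L" "(\<lambda>t. (-1) *\<^sub>R u2 t) \<in> L2L2 T L"
    using state_L2L2[OF u1] LL.scaleR_in[OF state_L2L2[OF u2], of "-1"]
    by (simp_all only: scaleR_fun_def[of "-1" u2])
  have w2': "(\<lambda>t. (-1) *\<^sub>R w2 t) \<in> L2_time T (dual_space V VN) (dual_norm V VN)"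
    by (rule V'.L2_time_scaleR[OF w2(1)])
  show thesis
  proof (rule that[of "\<lambda>t. w1 t - w2 t"])
    show "(\<lambda>t. w1 t - w2 t) \<in> L2_time T (dual_space V VN) (dual_norm V VN)"
      by (rule V'.L2_time_diff[OF w1(1) w2(1)])
    have "(\<lambda>t. u1 t - vb) \<in> L2_time T V VN" "(\<lambda>t. u2 t - vb) \<in> L2_time T V VN"
      using u1 u2 by (auto simp: is_state_def)
    from V.L2_time_diff[OF this] show "(\<lambda>t. u1 t - u2 t) \<in> L2_time T V VN" by simp
    from weak_time_derivative_add[OF V.seminormed_space_axioms V_L2 LL w1(1) w2' w1(2)
        weak_time_derivative_scaleR[OF w2(2)]]
    show "weak_time_derivative T \<Omega> V (\<lambda>t. u1 t - u2 t) (\<lambda>t. w1 t - w2 t)" by simp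
    have "value_at T \<Omega> u1 0 vb" "value_at T \<Omega> u2 0 vb" using u1 u2 by (auto simp: is_state_def)
    from value_at_add[OF this(1) value_at_scaleR[OF this(2), of "-1"]]
    show "value_at T \<Omega> (\<lambda>t. u1 t - u2 t) 0 0" by simp
    show "AE t in time T. \<forall>v\<in>V. (w1 t - w2 t) v + dirichlet_form \<Omega> (u1 t - u2 t) v =
        - L2_inner S (q1 t - q2 t) (tr v)"
      using w1(3) w2(3) state_H1[OF u1] state_H1[OF u2] AE_L2L2[OF q1] AE_L2L2[OF q2]
    proof eventually_elim
      case (elim t)
      show ?case
      proof
        fix v assume v: "v \<in> V"
        have "dirichlet_form \<Omega> (u1 t - u2 t) v = dirichlet_form \<Omega> (u1 t) v - dirichlet_form \<Omega> (u2 t) v"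
          using elim V_H1[OF v] by (intro D.pairing.diff_left)
        moreover have "L2_inner S (q1 t - q2 t) (tr v) = L2_inner S (q1 t) (tr v) - L2_inner S (q2 t) (tr v)"
          using elim \<Gamma>2.trace_in_L2[OF V_H1[OF v]] by (intro L2_pairing.diff_left)
        ultimately show "(w1 t - w2 t) v + dirichlet_form \<Omega> (u1 t - u2 t) v = - L2_inner S (q1 t - q2 t) (tr v)"
          using bspec[OF elim(1) v] bspec[OF elim(2) v] by simp
      qed
    qed
  qed
qed

text \<open>With \<open>q2 = 0\<close> the direction \<open>u1 - u2\<close> is C(q1). Uniqueness of
  the state then identifies, up to null sets, the state at q + s q1 with the state at q plus s
  C(q1).\<close>

lemma state_affine:
  assumes u: "is_state T \<Omega> tr \<Gamma>1 \<Gamma>2 g vb q u" and q: "q \<in> L2L2 T S"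
    and u1: "is_state T \<Omega> tr \<Gamma>1 \<Gamma>2 g vb q1 u1" and q1: "q1 \<in> L2L2 T S"
    and u2: "is_state T \<Omega> tr \<Gamma>1 \<Gamma>2 g vb q2 u2" and q2: "q2 \<in> L2L2 T S"
  shows "is_state T \<Omega> tr \<Gamma>1 \<Gamma>2 g vb (q + s *\<^sub>R (q1 - q2)) (u + s *\<^sub>R (u1 - u2))"
proof -
  obtain w where w: "w \<in> L2_time T (dual_space V VN) (dual_norm V VN)" "weak_time_derivative T \<Omega> V u w"
    "AE t in time T. \<forall>v\<in>V. w t v + dirichlet_form \<Omega> (u t) v = L2_inner L (g t) v - L2_inner S (q t) (tr v)"
    using u unfolding is_state_def by blast
  obtain w' where w': "w' \<in> L2_time T (dual_space V VN) (dual_norm V VN)"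
    and d: "(\<lambda>t. u1 t - u2 t) \<in> L2_time T V VN"
    and wd: "weak_time_derivative T \<Omega> V (\<lambda>t. u1 t - u2 t) w'"
    and v0: "value_at T \<Omega> (\<lambda>t. u1 t - u2 t) 0 0"
    and eq: "AE t in time T. \<forall>v\<in>V. w' t v + dirichlet_form \<Omega> (u1 t - u2 t) v = - L2_inner S (q1 t - q2 t) (tr v)"
    by (rule state_diff[OF u1 q1 u2 q2])
  have sd: "(\<lambda>t. s *\<^sub>R (u1 t - u2 t)) \<in> L2_time T V VN" by (rule V.L2_time_scaleR[OF d])
  have sw: "(\<lambda>t. s *\<^sub>R w' t) \<in> L2_time T (dual_space V VN) (dual_norm V VN)" by (rule V'.L2_time_scaleR[OF w'])
  have point: "(u + s *\<^sub>R (u1 - u2)) = (\<lambda>t. u t + s *\<^sub>R (u1 t - u2 t))"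
    "(q + s *\<^sub>R (q1 - q2)) t = q t + s *\<^sub>R (q1 t - q2 t)" for t
    by (auto simp: scaleR_fun_def[of s "u1 - u2"] scaleR_fun_def[of s "q1 - q2"])
  show ?thesis
    unfolding is_state_def point
  proof (intro conjI bexI[of _ "\<lambda>t. w t + s *\<^sub>R w' t"])
    have "(\<lambda>t. u t - vb) \<in> L2_time T V VN" using u by (simp add: is_state_def)
    from V.L2_time_add[OF this sd]
    show "(\<lambda>t. u t + s *\<^sub>R (u1 t - u2 t) - vb) \<in> L2_time T V VN" by (simp add: algebra_simps)
    show "weak_time_derivative T \<Omega> V (\<lambda>t. u t + s *\<^sub>R (u1 t - u2 t)) (\<lambda>t. w t + s *\<^sub>R w' t)"
      by (rule weak_time_derivative_add[OF V.seminormed_space_axioms V_L2 state_L2L2[OF u]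
            L2_time_V_L2L2[OF sd] w(1) sw w(2) weak_time_derivative_scaleR[OF wd]])
    have "value_at T \<Omega> u 0 vb" using u by (simp add: is_state_def)
    from value_at_add[OF this value_at_scaleR[OF v0, of s]]
    show "value_at T \<Omega> (\<lambda>t. u t + s *\<^sub>R (u1 t - u2 t)) 0 vb" by simp
    show "(\<lambda>t. w t + s *\<^sub>R w' t) \<in> L2_time T (dual_space V VN) (dual_norm V VN)"
      by (rule V'.L2_time_add[OF w(1) sw])
    have dV: "AE t in time T. u1 t - u2 t \<in> V" using d by (simp add: L2_time_def)
    show "AE t in time T. \<forall>v\<in>V. (w t + s *\<^sub>R w' t) v + dirichlet_form \<Omega> (u t + s *\<^sub>R (u1 t - u2 t)) v =
        L2_inner L (g t) v - L2_inner S (q t + s *\<^sub>R (q1 t - q2 t)) (tr v)"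
      using w(3) eq state_H1[OF u] dV AE_L2L2[OF q] AE_L2L2[OF q1] AE_L2L2[OF q2]
    proof eventually_elim
      case (elim t)
      show ?case
      proof
        fix v assume v: "v \<in> V"
        have "dirichlet_form \<Omega> (u t + s *\<^sub>R (u1 t - u2 t)) v =
            dirichlet_form \<Omega> (u t) v + s * dirichlet_form \<Omega> (u1 t - u2 t) v"
          using elim V_H1[OF v] V_H1[OF elim(4)] by (simp add: D.ip_add_left D.ip_scaleR_left \<Gamma>1.H1.scaleR_in)
        moreover have "L2_inner S (q t + s *\<^sub>R (q1 t - q2 t)) (tr v) =
            L2_inner S (q t) (tr v) + s * L2_inner S (q1 t - q2 t) (tr v)"
          using elim \<Gamma>2.trace_in_L2[OF V_H1[OF v]]
          by (simp add: L2.ip_add_left L2.ip_scaleR_left L2.scaleR_in L2.diff_in)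
        ultimately show "(w t + s *\<^sub>R w' t) v + dirichlet_form \<Omega> (u t + s *\<^sub>R (u1 t - u2 t)) v =
            L2_inner L (g t) v - L2_inner S (q t + s *\<^sub>R (q1 t - q2 t)) (tr v)"
          using bspec[OF elim(1) v] arg_cong[OF bspec[OF elim(2) v], of "\<lambda>x. s * x"]
          by (simp add: scaleR_fun_def[of s "w' t"] algebra_simps)
      qed
    qed
  qed
qed

lemma adjoint_trace_L2L2:
  assumes "is_adjoint_state T \<Omega> tr \<Gamma>1 f p" shows "(\<lambda>t. tr (p t)) \<in> L2L2 T S"
  using assms \<Gamma>1.V0_subset_H1 V.seminormed_space_axioms
  by (intro \<Gamma>2.L2_time_trace[of V]) (auto simp: is_adjoint_state_def)

lemma adjoint_identity:
  assumes u1: "is_state T \<Omega> tr \<Gamma>1 \<Gamma>2 g vb q u" and q: "q \<in> L2L2 T S"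
    and u2: "is_state T \<Omega> tr \<Gamma>1 \<Gamma>2 g vb 0 u0"
    and f: "f \<in> L2L2 T L" and p: "is_adjoint_state T \<Omega> tr \<Gamma>1 f p"
  shows "L2L2_inner T L (u - u0) f = - L2L2_inner T S q (\<lambda>t. tr (p t))"
proof -
  obtain w where w: "w \<in> L2_time T (dual_space V VN) (dual_norm V VN)"
    and c: "(\<lambda>t. u t - u0 t) \<in> L2_time T V VN"
    and wc: "weak_time_derivative T \<Omega> V (\<lambda>t. u t - u0 t) w"
    and c0: "value_at T \<Omega> (\<lambda>t. u t - u0 t) 0 0"
    and eq: "AE t in time T. \<forall>v\<in>V. w t v + dirichlet_form \<Omega> (u t - u0 t) v = - L2_inner S (q t - 0 t) (tr v)"
    by (rule state_diff[OF u1 q u2 LL.zero_in])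
  obtain z where z: "z \<in> L2_time T (dual_space V VN) (dual_norm V VN)" "weak_time_derivative T \<Omega> V p z"
    "AE t in time T. \<forall>v\<in>V. - z t v + dirichlet_form \<Omega> (p t) v = L2_inner L (f t) v"
    using p unfolding is_adjoint_state_def by blast
  have pV: "p \<in> L2_time T V VN" and pT: "value_at T \<Omega> p T 0" using p by (auto simp: is_adjoint_state_def)
  have zero: "(\<integral>t. w t (p t) \<partial>time T) + (\<integral>t. z t (u t - u0 t) \<partial>time T) = 0"
    by (rule weak_integration_by_parts[OF T_pos V.seminormed_space_axioms V_L2 L2_norm_le_H1_norm
          c w wc c0 pV z(1,2) pT])
  interpret P: seminormed_pairing "dual_space V VN" "dual_norm V VN" V VN "\<lambda>F v. F v" by (rule V.dual_pairing)
  have cL: "u - u0 \<in> L2L2 T L" using L2_time_V_L2L2[OF c] by (simp add: fun_diff_def)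
  have i1: "integrable (time T) (\<lambda>t. L2_inner L ((u - u0) t) (f t))" by (rule L2L2_pairing_integrable[OF cL f])
  have i2: "integrable (time T) (\<lambda>t. L2_inner S (q t) (tr (p t)))"
    using L2L2_pairing_integrable[OF q adjoint_trace_L2L2[OF p]] .
  have i3: "integrable (time T) (\<lambda>t. w t (p t))" by (rule P.pairing_integrable[OF w pV])
  have i4: "integrable (time T) (\<lambda>t. z t (u t - u0 t))" by (rule P.pairing_integrable[OF z(1) c])
  have cV: "AE t in time T. u t - u0 t \<in> V" and pV': "AE t in time T. p t \<in> V"
    using c pV by (auto simp: L2_time_def)
  \<comment> \<open>The state equation is subtracted from the adjoint equation. The backward sign in
    the adjoint equation makes both time derivatives appear with the same sign, so that they form
    the derivative of a product.\<close>
  have "(\<integral>t. L2_inner L ((u - u0) t) (f t) + L2_inner S (q t) (tr (p t)) \<partial>time T) =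
      (\<integral>t. - (w t (p t) + z t (u t - u0 t)) \<partial>time T)"
  proof (rule integral_cong_AE)
    show "AE t in time T. L2_inner L ((u - u0) t) (f t) + L2_inner S (q t) (tr (p t)) = - (w t (p t) + z t (u t - u0 t))"
      using eq z(3) cV pV' AE_L2L2[OF f]
    proof eventually_elim
      case (elim t)
      have "dirichlet_form \<Omega> (p t) (u t - u0 t) = dirichlet_form \<Omega> (u t - u0 t) (p t)"
        using elim V_H1 by (intro D.sym)
      moreover have "L2_inner L (f t) (u t - u0 t) = L2_inner L (u t - u0 t) (f t)"
        using elim V_L2 by (intro L2.sym) auto
      ultimately show ?case
        using bspec[OF elim(1) elim(4)] bspec[OF elim(2) elim(3)] by simp
    qed
  qed (use i1 i2 i3 i4 in auto)
  then show ?thesis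
    using i1 i2 i3 i4 zero by (simp add: L2L2_inner_def)
qed

end

section \<open>Differentiation and minimisation of the quadratic cost\<close>

lemma nonpos_if_le_multiples:
  fixes a e :: real
  assumes "0 \<le> e" "\<And>t. t > 0 \<Longrightarrow> a \<le> t * e" shows "a \<le> 0"
proof (rule ccontr)
  assume "\<not> a \<le> 0"
  then show False using assms(1) assms(2)[of "a / (e + 1)"] by (simp add: field_simps)
qed

theorem lemma2p2:
  fixes \<Omega> \<Gamma>1 \<Gamma>2 :: "(real ^ 'n) set"
    and tr :: "((real ^ 'n) \<Rightarrow> real) \<Rightarrow> ((real ^ 'n) \<Rightarrow> real)"
    and T M :: real
    and g zd :: "real \<Rightarrow> (real ^ 'n) \<Rightarrow> real"
    and b vb :: "(real ^ 'n) \<Rightarrow> real"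
    and u p :: "(real \<Rightarrow> (real ^ 'n) \<Rightarrow> real) \<Rightarrow> (real \<Rightarrow> (real ^ 'n) \<Rightarrow> real)"
  assumes domain: "open \<Omega>" "connected \<Omega>" "bounded \<Omega>" "\<Omega> \<noteq> {}" "lipschitz_boundary \<Omega>"
    and boundary: "\<Gamma>1 \<in> sets borel" "\<Gamma>2 \<in> sets borel" "frontier \<Omega> = \<Gamma>1 \<union> \<Gamma>2" "\<Gamma>1 \<inter> \<Gamma>2 = {}"
      "emeasure surface_measure \<Gamma>1 > 0" "emeasure surface_measure \<Gamma>2 > 0"
    and trace: "trace_operator \<Omega> tr"
    and pos: "T > 0" "M > 0"
    and data: "g \<in> L2L2 T (lebesgue_on \<Omega>)" "zd \<in> L2L2 T (lebesgue_on \<Omega>)"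
      "b \<in> H_half \<Omega> tr \<Gamma>1" "vb \<in> H1 \<Omega>" "AE x in surface_on \<Gamma>1. tr vb x = b x"
    and state: "\<And>q. q \<in> L2L2 T (surface_on \<Gamma>2) \<Longrightarrow> is_state T \<Omega> tr \<Gamma>1 \<Gamma>2 g vb q (u q)"
    and state_unique: "\<And>q w. q \<in> L2L2 T (surface_on \<Gamma>2) \<Longrightarrow>
      is_state T \<Omega> tr \<Gamma>1 \<Gamma>2 g vb q w \<Longrightarrow> L2L2_eq T (lebesgue_on \<Omega>) w (u q)"
    and adjoint: "\<And>q. q \<in> L2L2 T (surface_on \<Gamma>2) \<Longrightarrow>
      is_adjoint_state T \<Omega> tr \<Gamma>1 (u q - zd) (p q)"
    and adjoint_unique: "\<And>q w. q \<in> L2L2 T (surface_on \<Gamma>2) \<Longrightarrow>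
      is_adjoint_state T \<Omega> tr \<Gamma>1 (u q - zd) w \<Longrightarrow> L2L2_eq T (lebesgue_on \<Omega>) w (p q)"
  shows
    "(\<forall>q\<in>L2L2 T (surface_on \<Gamma>2). \<forall>\<eta>\<in>L2L2 T (surface_on \<Gamma>2).
        L2L2_inner T (lebesgue_on \<Omega>) (control_map u \<eta>) (u q - zd) =
        - L2L2_inner T (surface_on \<Gamma>2) \<eta> (\<lambda>t. tr (p q t))) \<and>
     (\<forall>q\<in>L2L2 T (surface_on \<Gamma>2).
        gateaux_differentiable (L2L2 T (surface_on \<Gamma>2)) (L2L2_norm T (surface_on \<Gamma>2))
          (cost T \<Omega> \<Gamma>2 M zd u) q \<and>
        (\<forall>\<eta>\<in>L2L2 T (surface_on \<Gamma>2).
           gateaux_derivative (cost T \<Omega> \<Gamma>2 M zd u) q (\<eta> - q) =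
             L2L2_inner T (lebesgue_on \<Omega>) (u \<eta> - u q) (u q - zd) +
             M * L2L2_inner T (surface_on \<Gamma>2) q (\<eta> - q) \<and>
           gateaux_derivative (cost T \<Omega> \<Gamma>2 M zd u) q (\<eta> - q) =
             Pi_form T \<Omega> \<Gamma>2 M u q (\<eta> - q) - L_form T \<Omega> zd u (\<eta> - q))) \<and>
     (\<forall>q\<in>L2L2 T (surface_on \<Gamma>2).
        riesz_representative (L2L2 T (surface_on \<Gamma>2)) (L2L2_inner T (surface_on \<Gamma>2))
          (gateaux_derivative (cost T \<Omega> \<Gamma>2 M zd u) q) (M *\<^sub>R q - (\<lambda>t. tr (p q t)))) \<and>
     (\<forall>qb\<in>L2L2 T (surface_on \<Gamma>2).
        (\<forall>q\<in>L2L2 T (surface_on \<Gamma>2). cost T \<Omega> \<Gamma>2 M zd u qb \<le> cost T \<Omega> \<Gamma>2 M zd u q) \<longleftrightarrow>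
        L2L2_eq T (surface_on \<Gamma>2) (M *\<^sub>R qb - (\<lambda>t. tr (p qb t))) 0)"
proof -
  interpret control_problem \<Omega> tr \<Gamma>1 \<Gamma>2 T g vb
    by standard (use domain boundary trace pos data in auto)
  let ?Q = "L2L2 T S" and ?J = "cost T \<Omega> \<Gamma>2 M zd u"
  let ?C = "control_map u" and ?H = "L2L2_inner T L" and ?B = "L2L2_inner T S"
  have Q0: "0 \<in> ?Q" by (rule LL.zero_in)
  have uH: "u q \<in> L2L2 T L" if "q \<in> ?Q" for q by (rule state_L2L2[OF state[OF that]])
  have CH: "?C q \<in> L2L2 T L" if "q \<in> ?Q" for q
    unfolding control_map_def by (rule LL.diff_in[OF uH[OF that] uH[OF Q0]])
  have fH: "u q - zd \<in> L2L2 T L" if "q \<in> ?Q" for q by (rule LL.diff_in[OF uH[OF that] data(2)])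
  define r where "r q = M *\<^sub>R q - (\<lambda>t. tr (p q t))" for q
  have trQ: "(\<lambda>t. tr (p q t)) \<in> ?Q" if "q \<in> ?Q" for q by (rule adjoint_trace_L2L2[OF adjoint[OF that]])
  have rQ: "r q \<in> ?Q" if "q \<in> ?Q" for q
    unfolding r_def by (intro LL.diff_in LL.scaleR_in trQ that)
  have part1: "?H (?C \<eta>) (u q - zd) = - ?B \<eta> (\<lambda>t. tr (p q t))" if "q \<in> ?Q" "\<eta> \<in> ?Q" for q \<eta>
    unfolding control_map_def
    by (rule adjoint_identity[OF state[OF that(2)] that(2) state[OF Q0] fH[OF that(1)] adjoint[OF that(1)]])
  \<comment> \<open>\<open>D\<close> is the coefficient of s in J(q + s \<eta>), and
    \<open>E\<close> is twice the coefficient of s^2. The value \<open>E \<eta>\<close> is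
    \<Pi>(\<eta>, \<eta>), hence nonnegative.\<close>
  define D where "D q \<eta> = ?H (?C \<eta>) (u q - zd) + M * ?B q \<eta>" for q \<eta>
  define E where "E \<eta> = ?H (?C \<eta>) (?C \<eta>) + M * ?B \<eta> \<eta>" for \<eta>
  have E0: "0 \<le> E \<eta>" if "\<eta> \<in> ?Q" for \<eta>
    unfolding E_def using pos LL.nonneg[OF CH[OF that]] LL.nonneg[OF that] by simp
  have D_r: "D q \<eta> = ?B (r q) \<eta>" if "q \<in> ?Q" "\<eta> \<in> ?Q" for q \<eta>
    unfolding D_def r_def part1[OF that] LL.pairing.diff_left[OF LL.scaleR_in[OF that(1)] trQ[OF that(1)] that(2)]
      LL.ip_scaleR_left[OF that] LL.sym[OF that(2) trQ[OF that(1)]] by simp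
  have expand: "?J (q + s *\<^sub>R \<eta>) = ?J q + s * D q \<eta> + s\<^sup>2 / 2 * E \<eta>" if q: "q \<in> ?Q" and \<eta>: "\<eta> \<in> ?Q" for q \<eta> s
  proof -
    have qs: "q + s *\<^sub>R \<eta> \<in> ?Q" by (intro LL.add_in LL.scaleR_in q \<eta>)
    \<comment> \<open>The control 0 is written out because u \<eta> - u 0 is C(\<eta>). Uniqueness
      gives agreement with the state at q + s \<eta> only up to null sets, which the inner product
      does not see.\<close>
    have "is_state T \<Omega> tr \<Gamma>1 \<Gamma>2 g vb (q + s *\<^sub>R (\<eta> - 0)) (u q + s *\<^sub>R (u \<eta> - u 0))"
      by (rule state_affine[OF state[OF q] q state[OF \<eta>] \<eta> state[OF Q0] Q0])
    then have "L2L2_eq T L (u q + s *\<^sub>R ?C \<eta>) (u (q + s *\<^sub>R \<eta>))"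
      using state_unique[OF qs] by (simp add: control_map_def)
    then have "L2L2_eq T L (u q + s *\<^sub>R ?C \<eta> - zd) (u (q + s *\<^sub>R \<eta>) - zd)" by (rule L2L2_eq_diff)
    then have eq: "L2L2_eq T L ((u q - zd) + s *\<^sub>R ?C \<eta>) (u (q + s *\<^sub>R \<eta>) - zd)" by (simp add: algebra_simps)
    have mem: "(u q - zd) + s *\<^sub>R ?C \<eta> \<in> L2L2 T L" by (intro LL.add_in LL.scaleR_in fH q CH \<eta>)
    have "(L2L2_norm T L (u (q + s *\<^sub>R \<eta>) - zd))\<^sup>2 = ?H (u (q + s *\<^sub>R \<eta>) - zd) (u (q + s *\<^sub>R \<eta>) - zd)"
      by (rule L2L2_norm_square[OF fH[OF qs]])
    also have "\<dots> = ?H ((u q - zd) + s *\<^sub>R ?C \<eta>) ((u q - zd) + s *\<^sub>R ?C \<eta>)"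
      by (rule L2L2_inner_cong[OF mem fH[OF qs] mem fH[OF qs] eq eq, symmetric])
    also have "\<dots> = ?H (u q - zd) (u q - zd) + 2 * s * ?H (?C \<eta>) (u q - zd) + s\<^sup>2 * ?H (?C \<eta>) (?C \<eta>)"
      unfolding LL.ip_expand[OF fH[OF q] CH[OF \<eta>]] LL.sym[OF fH[OF q] CH[OF \<eta>]] ..
    finally have 1: "(L2L2_norm T L (u (q + s *\<^sub>R \<eta>) - zd))\<^sup>2 =
        ?H (u q - zd) (u q - zd) + 2 * s * ?H (?C \<eta>) (u q - zd) + s\<^sup>2 * ?H (?C \<eta>) (?C \<eta>)" .
    have 2: "(L2L2_norm T S (q + s *\<^sub>R \<eta>))\<^sup>2 = ?B q q + 2 * s * ?B q \<eta> + s\<^sup>2 * ?B \<eta> \<eta>"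
      unfolding L2L2_norm_square[OF qs] LL.ip_expand[OF q \<eta>] ..
    show ?thesis
      unfolding cost_def 1 2 L2L2_norm_square[OF fH[OF q]] L2L2_norm_square[OF q] D_def E_def
      by (simp add: field_simps)
  qed
  have lim: "((\<lambda>s. (?J (q + s *\<^sub>R \<eta>) - ?J q) / s) \<longlongrightarrow> D q \<eta>) (at 0)" if "q \<in> ?Q" "\<eta> \<in> ?Q" for q \<eta>
  proof (rule Lim_transform_eventually)
    have "((\<lambda>s. D q \<eta> + s / 2 * E \<eta>) \<longlongrightarrow> D q \<eta> + 0 / 2 * E \<eta>) (at 0)" by (intro tendsto_intros) auto
    then show "((\<lambda>s. D q \<eta> + s / 2 * E \<eta>) \<longlongrightarrow> D q \<eta>) (at 0)" by simp
    show "eventually (\<lambda>s. D q \<eta> + s / 2 * E \<eta> = (?J (q + s *\<^sub>R \<eta>) - ?J q) / s) (at 0)"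
      unfolding eventually_at_filter expand[OF that]
      by (intro always_eventually) (simp add: field_simps power2_eq_square)
  qed
  have gd: "gateaux_derivative ?J q \<eta> = D q \<eta>" if "q \<in> ?Q" "\<eta> \<in> ?Q" for q \<eta>
    unfolding gateaux_derivative_def by (rule tendsto_Lim[OF trivial_limit_at lim[OF that]])
  have dual: "gateaux_derivative ?J q \<in> dual_space ?Q (L2L2_norm T S)" if q: "q \<in> ?Q" for q
    unfolding dual_space_def
  proof (intro CollectI conjI ballI allI exI[of _ "L2L2_norm T S (r q)"])
    fix v w c assume v: "v \<in> ?Q"
    show "gateaux_derivative ?J q (c *\<^sub>R v) = c * gateaux_derivative ?J q v"
      unfolding gd[OF q v] gd[OF q LL.scaleR_in[OF v]] D_r[OF q v] D_r[OF q LL.scaleR_in[OF v]]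
      by (rule LL.ip_scaleR_right[OF rQ[OF q] v])
    show "\<bar>gateaux_derivative ?J q v\<bar> \<le> L2L2_norm T S (r q) * L2L2_norm T S v"
      unfolding gd[OF q v] D_r[OF q v] L2L2_norm_def by (rule LL.cauchy_schwarz[OF rQ[OF q] v])
    assume w: "w \<in> ?Q"
    show "gateaux_derivative ?J q (v + w) = gateaux_derivative ?J q v + gateaux_derivative ?J q w"
      unfolding gd[OF q v] gd[OF q w] gd[OF q LL.add_in[OF v w]] D_r[OF q v] D_r[OF q w] D_r[OF q LL.add_in[OF v w]]
      by (rule LL.ip_add_right[OF rQ[OF q] v w])
  qed
  \<comment> \<open>C(\<eta> - q) and C(\<eta>) - C(q) may differ on null sets, since
    \<open>u\<close> selects representatives freely. Part (i) moves the pairing to the controls,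
    where it is linear in the direction.\<close>
  have form1: "D q (\<eta> - q) = ?H (u \<eta> - u q) (u q - zd) + M * ?B q (\<eta> - q)" if q: "q \<in> ?Q" and \<eta>: "\<eta> \<in> ?Q" for q \<eta>
  proof -
    have "?H (?C (\<eta> - q)) (u q - zd) = ?H (?C \<eta>) (u q - zd) - ?H (?C q) (u q - zd)"
      unfolding part1[OF q LL.diff_in[OF \<eta> q]] part1[OF q \<eta>] part1[OF q q]
      by (simp add: LL.pairing.diff_left[OF \<eta> q trQ[OF q]])
    also have "\<dots> = ?H (?C \<eta> - ?C q) (u q - zd)"
      by (rule LL.pairing.diff_left[OF CH[OF \<eta>] CH[OF q] fH[OF q], symmetric])
    also have "?C \<eta> - ?C q = u \<eta> - u q" by (simp add: control_map_def)
    finally show ?thesis unfolding D_def by (simp only:)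
  qed
  have form2: "D q \<eta> = Pi_form T \<Omega> \<Gamma>2 M u q \<eta> - L_form T \<Omega> zd u \<eta>" if q: "q \<in> ?Q" and \<eta>: "\<eta> \<in> ?Q" for q \<eta>
  proof -
    have zu: "zd - u 0 \<in> L2L2 T L" by (rule LL.diff_in[OF data(2) uH[OF Q0]])
    have split: "u q - zd = ?C q - (zd - u 0)" by (simp add: control_map_def)
    show ?thesis
      unfolding D_def Pi_form_def L_form_def split LL.pairing.diff_right[OF CH[OF \<eta>] CH[OF q] zu]
        LL.sym[OF CH[OF \<eta>] CH[OF q]]
      by simp
  qed
  have optimal: "(\<forall>q\<in>?Q. ?J qb \<le> ?J q) \<longleftrightarrow> L2L2_eq T S (r qb) 0" if qb: "qb \<in> ?Q" for qb
  proof
    assume min: "\<forall>q\<in>?Q. ?J qb \<le> ?J q"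
    let ?r = "r qb"
    have r: "?r \<in> ?Q" by (rule rQ[OF qb])
    \<comment> \<open>A step of length t against the gradient changes J by -t (r, r) + (t^2 / 2) E
      r. Minimality makes this nonnegative, and division by t gives the estimate.\<close>
    have "?B ?r ?r \<le> t * (E ?r / 2)" if "t > 0" for t
    proof -
      have "?J qb \<le> ?J (qb + (- t) *\<^sub>R ?r)"
        using min LL.add_in[OF qb LL.scaleR_in[OF r]] by blast
      then have "0 \<le> t * (t * (E ?r / 2) - ?B ?r ?r)"
        unfolding expand[OF qb r] D_r[OF qb r] by (simp add: power2_eq_square algebra_simps)
      then show ?thesis using that by (simp add: zero_le_mult_iff)
    qed
    \<comment> \<open>This is the limit as t tends to 0.\<close>
    then have "?B ?r ?r \<le> 0" using E0[OF r] by (intro nonpos_if_le_multiples[of "E ?r / 2"]) auto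
    then have "?B ?r ?r = 0" using LL.nonneg[OF r] by simp
    then show "L2L2_eq T S ?r 0" using L2L2_inner_self_eq_0[OF r] by simp
  next
    assume zero: "L2L2_eq T S (r qb) 0"
    show "\<forall>q\<in>?Q. ?J qb \<le> ?J q"
    proof
      fix q assume q: "q \<in> ?Q"
      have d: "q - qb \<in> ?Q" by (rule LL.diff_in[OF q qb])
      have "?B (r qb) (r qb) = 0" using L2L2_inner_self_eq_0[OF rQ[OF qb]] zero by simp
      \<comment> \<open>The linear term vanishes in every direction. As the expansion is exact also
        for s = 1 and its quadratic term is nonnegative, the stationary point is a global
        minimum.\<close>
      then have "?B (r qb) (q - qb) = 0" using LL.cauchy_schwarz[OF rQ[OF qb] d] by simp
      then show "?J qb \<le> ?J q"
        using expand[OF qb d, of 1] E0[OF d] D_r[OF qb d] by simp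
    qed
  qed
  show ?thesis
  proof (intro conjI ballI)
    fix q assume q: "q \<in> ?Q"
    show "gateaux_differentiable ?Q (L2L2_norm T S) ?J q"
      unfolding gateaux_differentiable_def using lim[OF q] gd[OF q] dual[OF q] by simp
    show "riesz_representative ?Q ?B (gateaux_derivative ?J q) (M *\<^sub>R q - (\<lambda>t. tr (p q t)))"
      unfolding riesz_representative_def r_def[symmetric] using rQ[OF q] gd[OF q] D_r[OF q] by simp
    show "(\<forall>q'\<in>?Q. ?J q \<le> ?J q') \<longleftrightarrow> L2L2_eq T S (M *\<^sub>R q - (\<lambda>t. tr (p q t))) 0"
      using optimal[OF q] by (simp only: r_def)
    fix \<eta> assume \<eta>: "\<eta> \<in> ?Q"
    have d: "\<eta> - q \<in> ?Q" by (rule LL.diff_in[OF \<eta> q])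
    show "?H (?C \<eta>) (u q - zd) = - ?B \<eta> (\<lambda>t. tr (p q t))" by (rule part1[OF q \<eta>])
    show "gateaux_derivative ?J q (\<eta> - q) = ?H (u \<eta> - u q) (u q - zd) + M * ?B q (\<eta> - q)"
      unfolding gd[OF q d] by (rule form1[OF q \<eta>])
    show "gateaux_derivative ?J q (\<eta> - q) = Pi_form T \<Omega> \<Gamma>2 M u q (\<eta> - q) - L_form T \<Omega> zd u (\<eta> - q)"
      unfolding gd[OF q d] by (rule form2[OF q d])
  qed
qed

end
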